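(* Let $q$ be a power of 2, let $G=O(2n)$ be the even orthogonal group in characteristic 2 and $\mathfrak{g}=\mathfrak{o}(2n)$ its Lie algebra, and let $G(\mathbf{F}_q)$, $\mathfrak{g}(\mathbf{F}_q)$ be the fixed points of a split Frobenius map relative to $\mathbf{F}_q$ on $G$, $\mathfrak{g}$. Then the numbers of nilpotent $G(\mathbf{F}_q)$-orbits in $\mathfrak{g}(\mathbf{F}_q)$ and in $\mathfrak{g}(\mathbf{F}_q)^*$ are the same.
   Context: $V$ is a $2n$-dimensional vector space over a field of characteristic 2 with a non-defective quadratic form $\alpha$, whose associated bilinear form $\beta$ is non-degenerate. $G=\{g\in GL(V)\mid\alpha(gv)=\alpha(v)\ \forall v\in V\}$, $\mathfrak{g}=\{x\in\mathfrak{gl}(V)\mid\beta(xv,v)=0\ \forall v\in V\}$. $G$ acts on $\mathfrak{g}$ by the adjoint action and on the dual space $\mathfrak{g}^*$ by $(g.\xi)(x)=\xi(\mathrm{Ad}(g)^{-1}x)$. An element $\xi\in\mathfrak{g}^*$ is nilpotent if there is $g\in G$ such that $g.\xi$ vanishes on the Lie algebra $\mathfrak{b}$ of a fixed Borel subgroup; equivalently, the closure of its $G$-orbit (over the algebraic closure) contains 0. Likewise nilpotent elements of $\mathfrak{g}$ are those whose $G$-orbit closure contains 0. *)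

theory Defs
  imports
    "Jordan_Normal_Form.Matrix"
    "HOL-Algebra.Group_Action"
    "HOL-Algebra.Algebraic_Closure_Type"
    "HOL-Computational_Algebra.Polynomial"
    "HOL-Library.FuncSet"
    "HOL-Library.Cardinality"
begin

text \<open>
  The vector space is \<open>V = k\<^sup>N\<close>, \<open>N = 2n\<close>, and \<open>\<FF>\<^sub>q = {a \<in> k. a\<^sup>q = a}\<close>.  Coordinates are taken with respect
  to a basis of an \<open>\<FF>\<^sub>q\<close>-form of \<open>V\<close>, so that Frobenius maps act entrywise.
\<close>

definition polar_form :: "('k::field vec \<Rightarrow> 'k) \<Rightarrow> 'k vec \<Rightarrow> 'k vec \<Rightarrow> 'k" where
  "polar_form \<alpha> v w = \<alpha> (v + w) - \<alpha> v - \<alpha> w"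

text \<open>The polar form is symmetric, so linearity in the first argument gives bilinearity.\<close>

definition quadratic_form :: "nat \<Rightarrow> ('k::field vec \<Rightarrow> 'k) \<Rightarrow> bool" where
  "quadratic_form N \<alpha> \<longleftrightarrow>
     (\<forall>c. \<forall>v\<in>carrier_vec N. \<alpha> (c \<cdot>\<^sub>v v) = c\<^sup>2 * \<alpha> v) \<and>
     (\<forall>u\<in>carrier_vec N. \<forall>v\<in>carrier_vec N. \<forall>w\<in>carrier_vec N.
        polar_form \<alpha> (u + v) w = polar_form \<alpha> u w + polar_form \<alpha> v w) \<and>
     (\<forall>c. \<forall>v\<in>carrier_vec N. \<forall>w\<in>carrier_vec N.
        polar_form \<alpha> (c \<cdot>\<^sub>v v) w = c * polar_form \<alpha> v w)"

definition nondefective :: "nat \<Rightarrow> ('k::field vec \<Rightarrow> 'k) \<Rightarrow> bool" where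
  "nondefective N \<alpha> \<longleftrightarrow>
     (\<forall>v\<in>carrier_vec N. (\<forall>w\<in>carrier_vec N. polar_form \<alpha> v w = 0) \<longrightarrow> v = 0\<^sub>v N)"

text \<open>
  The columns \<open>e\<^sub>1, \<dots>, e\<^sub>n, f\<^sub>1, \<dots>, f\<^sub>n\<close> of \<open>P\<close> form a hyperbolic basis:
  \<open>\<alpha> (\<Sum>\<^sub>i x\<^sub>i e\<^sub>i + y\<^sub>i f\<^sub>i) = \<Sum>\<^sub>i x\<^sub>i y\<^sub>i\<close>.
\<close>

definition hyperbolic_basis :: "nat \<Rightarrow> ('k::field vec \<Rightarrow> 'k) \<Rightarrow> 'k mat \<Rightarrow> bool" where
  "hyperbolic_basis n \<alpha> P \<longleftrightarrow>
     P \<in> carrier_mat (2 * n) (2 * n) \<and> invertible_mat P \<and>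
     (\<forall>v\<in>carrier_vec (2 * n). \<alpha> (P *\<^sub>v v) = (\<Sum>i<n. v $ i * v $ (n + i)))"

definition orthogonal_group :: "nat \<Rightarrow> ('k::field vec \<Rightarrow> 'k) \<Rightarrow> 'k mat monoid" where
  "orthogonal_group n \<alpha> =
     \<lparr>carrier = {g \<in> carrier_mat (2 * n) (2 * n). invertible_mat g \<and>
                   (\<forall>v\<in>carrier_vec (2 * n). \<alpha> (g *\<^sub>v v) = \<alpha> v)},
      monoid.mult = (*), one = 1\<^sub>m (2 * n)\<rparr>"

definition orthogonal_lie :: "nat \<Rightarrow> ('k::field vec \<Rightarrow> 'k) \<Rightarrow> 'k mat set" where
  "orthogonal_lie n \<alpha> = {x \<in> carrier_mat (2 * n) (2 * n).
     \<forall>v\<in>carrier_vec (2 * n). polar_form \<alpha> (x *\<^sub>v v) v = 0}"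

definition Ad :: "'k::field mat monoid \<Rightarrow> 'k mat \<Rightarrow> 'k mat \<Rightarrow> 'k mat" where
  "Ad G g x = g * x * inv\<^bsub>G\<^esub> g"

text \<open>
  The dual of a vector space \<open>L\<close> of matrices over a subfield \<open>K\<close> of \<open>k\<close>; functionals are made
  \<open>undefined\<close> outside \<open>L\<close>, so that they are determined by their values on \<open>L\<close>.
\<close>

definition dual_space :: "'k::field set \<Rightarrow> 'k mat set \<Rightarrow> ('k mat \<Rightarrow> 'k) set" where
  "dual_space K L = {\<xi> \<in> L \<rightarrow>\<^sub>E K.
     (\<forall>x\<in>L. \<forall>y\<in>L. \<xi> (x + y) = \<xi> x + \<xi> y) \<and>
     (\<forall>c\<in>K. \<forall>x\<in>L. \<xi> (c \<cdot>\<^sub>m x) = c * \<xi> x)}"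

text \<open>Here \<open>Ad(g)\<^sup>-\<^sup>1\<close> is written as \<open>Ad(g\<^sup>-\<^sup>1)\<close>.\<close>

definition coAd ::
  "'k::field mat monoid \<Rightarrow> 'k mat set \<Rightarrow> 'k mat \<Rightarrow> ('k mat \<Rightarrow> 'k) \<Rightarrow> 'k mat \<Rightarrow> 'k" where
  "coAd G L g \<xi> = (\<lambda>x\<in>L. \<xi> (Ad G (inv\<^bsub>G\<^esub> g) x))"

inductive_set poly_funs :: "nat \<Rightarrow> ('k::field mat \<Rightarrow> 'k) set" for N where
  const: "(\<lambda>A. c) \<in> poly_funs N"
| coord: "i < N \<Longrightarrow> j < N \<Longrightarrow> (\<lambda>A. A $$ (i, j)) \<in> poly_funs N"
| add: "f \<in> poly_funs N \<Longrightarrow> h \<in> poly_funs N \<Longrightarrow> (\<lambda>A. f A + h A) \<in> poly_funs N"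
| mult: "f \<in> poly_funs N \<Longrightarrow> h \<in> poly_funs N \<Longrightarrow> (\<lambda>A. f A * h A) \<in> poly_funs N"

text \<open>
  This is the closure in \<open>\<gg>\<ll>(V)\<close>; for subsets of the linear subspace \<open>\<oo>(V)\<close> it agrees with the
  closure in that subspace.
\<close>

definition zariski_closure :: "nat \<Rightarrow> 'k::field mat set \<Rightarrow> 'k mat set" where
  "zariski_closure N S = {A \<in> carrier_mat N N.
     \<forall>f\<in>poly_funs N. (\<forall>Y\<in>S. f Y = 0) \<longrightarrow> f A = 0}"

text \<open>
  The tangent space at \<open>1\<close> of a closed subgroup \<open>H\<close> of \<open>GL\<^sub>N\<close>: all \<open>A\<close> such that, for every
  polynomial function \<open>f\<close> vanishing on \<open>H\<close>, the differential of \<open>f\<close> at \<open>1\<close> kills \<open>A\<close>.  That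
  differential is the linear coefficient of the polynomial \<open>t \<mapsto> f (1 + t A)\<close>, which is uniquely
  determined because \<open>k\<close> is infinite (the definition is only meant for infinite \<open>k\<close>).
\<close>

definition lie_algebra_of :: "nat \<Rightarrow> 'k::field mat set \<Rightarrow> 'k mat set" where
  "lie_algebra_of N H = {A \<in> carrier_mat N N.
     \<forall>f\<in>poly_funs N. (\<forall>h\<in>H. f h = 0) \<longrightarrow>
       (\<forall>p. (\<forall>t. f (1\<^sub>m N + t \<cdot>\<^sub>m A) = poly p t) \<longrightarrow> coeff p 1 = 0)}"

text \<open>
  The Borel subgroup attached to a hyperbolic basis, namely the stabiliser of the complete flag
  \<open>V\<^sub>1 \<subset> \<dots> \<subset> V\<^sub>n\<close> of totally singular subspaces \<open>V\<^sub>m = \<langle>e\<^sub>1, \<dots>, e\<^sub>m\<rangle>\<close>.  The stabiliser of \<open>V\<^sub>n\<close> is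
  a parabolic subgroup of the identity component \<open>SO(V)\<close>, so no determinant-like (Dickson)
  condition is needed.  Over an algebraically closed field every Borel subgroup arises in this way.
\<close>

definition singular_flag :: "nat \<Rightarrow> 'k::field mat \<Rightarrow> nat \<Rightarrow> 'k vec set" where
  "singular_flag n P m = {P *\<^sub>v v | v. v \<in> carrier_vec (2 * n) \<and> (\<forall>i. m \<le> i \<and> i < 2 * n \<longrightarrow> v $ i = 0)}"

definition borel_subgroup :: "nat \<Rightarrow> ('k::field vec \<Rightarrow> 'k) \<Rightarrow> 'k mat \<Rightarrow> 'k mat set" where
  "borel_subgroup n \<alpha> P = {g \<in> carrier (orthogonal_group n \<alpha>).
     \<forall>m\<le>n. \<forall>v\<in>singular_flag n P m. g *\<^sub>v v \<in> singular_flag n P m}"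

definition nilpotent_elements :: "nat \<Rightarrow> ('k::field vec \<Rightarrow> 'k) \<Rightarrow> 'k mat set" where
  "nilpotent_elements n \<alpha> = {x \<in> orthogonal_lie n \<alpha>.
     0\<^sub>m (2 * n) (2 * n) \<in>
       zariski_closure (2 * n) (orbit (orthogonal_group n \<alpha>) (Ad (orthogonal_group n \<alpha>)) x)}"

text \<open>\<open>P\<close> selects the fixed Borel subgroup.\<close>

definition nilpotent_functionals ::
  "nat \<Rightarrow> ('k::field vec \<Rightarrow> 'k) \<Rightarrow> 'k mat \<Rightarrow> ('k mat \<Rightarrow> 'k) set" where
  "nilpotent_functionals n \<alpha> P = {\<xi> \<in> dual_space UNIV (orthogonal_lie n \<alpha>).
     \<exists>g\<in>carrier (orthogonal_group n \<alpha>). \<forall>x\<in>lie_algebra_of (2 * n) (borel_subgroup n \<alpha> P).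
       coAd (orthogonal_group n \<alpha>) (orthogonal_lie n \<alpha>) g \<xi> x = 0}"

definition frobenius :: "nat \<Rightarrow> 'k::field mat \<Rightarrow> 'k mat" where
  "frobenius q A = map_mat (\<lambda>a. a ^ q) A"

text \<open>
  The entrywise Frobenius map is split for \<open>(V, \<alpha>)\<close>: the form has Witt index \<open>n\<close> over \<open>\<FF>\<^sub>q\<close>,
  i.e. there is a hyperbolic basis consisting of \<open>\<FF>\<^sub>q\<close>-rational vectors.  The elements of \<open>G\<close>
  that are diagonal in such a basis form a maximal torus on which Frobenius is \<open>t \<mapsto> t\<^sup>q\<close>.
\<close>

definition split_frobenius :: "nat \<Rightarrow> nat \<Rightarrow> ('k::field vec \<Rightarrow> 'k) \<Rightarrow> bool" where
  "split_frobenius q n \<alpha> \<longleftrightarrow> (\<exists>P. hyperbolic_basis n \<alpha> P \<and> frobenius q P = P)"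

definition rational_group :: "nat \<Rightarrow> nat \<Rightarrow> ('k::field vec \<Rightarrow> 'k) \<Rightarrow> 'k mat monoid" where
  "rational_group q n \<alpha> = (orthogonal_group n \<alpha>)
     \<lparr>carrier := {g \<in> carrier (orthogonal_group n \<alpha>). frobenius q g = g}\<rparr>"

definition rational_lie :: "nat \<Rightarrow> nat \<Rightarrow> ('k::field vec \<Rightarrow> 'k) \<Rightarrow> 'k mat set" where
  "rational_lie q n \<alpha> = {x \<in> orthogonal_lie n \<alpha>. frobenius q x = x}"

definition rational_nilpotents :: "nat \<Rightarrow> nat \<Rightarrow> ('k::field vec \<Rightarrow> 'k) \<Rightarrow> 'k mat set" where
  "rational_nilpotents q n \<alpha> = rational_lie q n \<alpha> \<inter> nilpotent_elements n \<alpha>"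

text \<open>
  The \<open>\<FF>\<^sub>q\<close>-dual of \<open>\<gg>(\<FF>\<^sub>q)\<close>.  An element of it is nilpotent if its \<open>k\<close>-linear extension to \<open>\<gg>\<close>
  (unique, since \<open>\<gg>(\<FF>\<^sub>q)\<close> spans \<open>\<gg>\<close> over \<open>k\<close>) is nilpotent.
\<close>

definition rational_dual :: "nat \<Rightarrow> nat \<Rightarrow> ('k::field vec \<Rightarrow> 'k) \<Rightarrow> ('k mat \<Rightarrow> 'k) set" where
  "rational_dual q n \<alpha> = dual_space {a. a ^ q = a} (rational_lie q n \<alpha>)"

definition rational_nilpotent_functionals ::
  "nat \<Rightarrow> nat \<Rightarrow> ('k::field vec \<Rightarrow> 'k) \<Rightarrow> 'k mat \<Rightarrow> ('k mat \<Rightarrow> 'k) set" where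
  "rational_nilpotent_functionals q n \<alpha> P = {\<psi> \<in> rational_dual q n \<alpha>.
     \<exists>\<xi>\<in>nilpotent_functionals n \<alpha> P. \<forall>x\<in>rational_lie q n \<alpha>. \<xi> x = \<psi> x}"

end

theory Submission
  imports Defs "Jordan_Normal_Form.Char_Poly"
begin

no_notation fps_nth (infixl "$" 75)

text \<open>
  Write \<open>W\<^sup>*\<close> for the adjoint of \<open>W\<close> with respect to the polar form \<open>\<beta>\<close>.  Up to the identification of \<open>x\<close>
  with the bilinear form \<open>\<beta>(x v, w)\<close>, the Lie algebra \<open>\<gg>\<close> is the space of alternating forms on \<open>V\<close>, its dual
  is the exterior square of \<open>V\<close>, and \<open>\<beta>\<close> identifies \<open>V\<close> with its dual; so \<open>\<gg>\<close> and its dual are isomorphic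
  as modules for the orthogonal group.  Concretely, every element of \<open>\<gg>\<close> has the form \<open>W + W\<^sup>*\<close>, and in
  characteristic 2 the trace \<open>tr (x W)\<close> depends, for \<open>x \<in> \<gg>\<close>, only on \<open>W + W\<^sup>*\<close> and not on \<open>W\<close>.  Therefore
  \<open>x \<mapsto> (W + W\<^sup>* \<mapsto> tr (x W))\<close> is a well-defined equivariant linear map from \<open>\<gg>\<close> to its dual
  (\<open>tpair_half_add_adj\<close>, \<open>tpair_half_conj\<close>).  It is bijective over every ring of scalars over which a
  hyperbolic basis exists (\<open>bij_trace_functional\<close>), in particular over \<open>\<FF>\<^sub>q\<close>, where the split Frobenius map
  provides a rational hyperbolic basis.

  It remains to see that this bijection matches the two notions of nilpotency.  In hyperbolic coordinates
  the Lie algebra \<open>\<bb>\<close> of the Borel subgroup consists of the \<open>y \<in> \<gg>\<close> that stabilise the flag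
  \<open>V\<^sub>1 \<subset> \<dots> \<subset> V\<^sub>n\<close> (\<open>lie_algebra_of_borel\<close>), and its annihilator under the pairing consists of the
  \<open>y \<in> \<gg>\<close> that map each \<open>V\<^sub>m\<close> into \<open>V\<^bsub>m-1\<^esub>\<close> (\<open>std_nilrad_eq_perp\<close>).  So a functional is nilpotent if and
  only if the corresponding element of \<open>\<gg>\<close> shifts the flag of some hyperbolic basis in this way.  The
  nilpotent elements of \<open>\<gg>\<close> have the same description (\<open>nilpotent_elements_iff\<close>): a
  one-parameter torus contracts such an element to 0, and conversely, if 0 lies in the orbit closure of
  \<open>x\<close>, then \<open>x\<close> has the characteristic polynomial of 0, hence is a nilpotent matrix, and a flag is built
  one step at a time.  In each step \<open>x\<close> induces an alternating form on the even-dimensional space \<open>V\<^sub>m\<^sup>\<bottom> / V\<^sub>m\<close>, whose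
  radical has even dimension and is not zero; so it has dimension at least 2, and over an algebraically
  closed field it contains a nonzero singular vector, which an orthogonal transformation moves to the
  next basis vector.

  An equivariant bijection between two sets induces a bijection between their orbits
  (\<open>card_orbits_bij\<close>).
\<close>

section \<open>Hyperbolic coordinates\<close>

text \<open>
  The index of the basis vector that is paired with the \<open>i\<close>-th one: \<open>e\<^sub>i\<close> and \<open>f\<^sub>i\<close> have indices \<open>i\<close> and
  \<open>n + i\<close>, counted from 0.
\<close>

definition opp :: "nat \<Rightarrow> nat \<Rightarrow> nat" where
  "opp n i = (if i < n then n + i else i - n)"

lemma opp_less [simp]: "i < 2 * n \<Longrightarrow> opp n i < 2 * n"
  by (auto simp: opp_def)

lemma opp_opp [simp]: "i < 2 * n \<Longrightarrow> opp n (opp n i) = i"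
  by (auto simp: opp_def)

lemma opp_neq [simp]: "i < 2 * n \<Longrightarrow> opp n i \<noteq> i" "i < 2 * n \<Longrightarrow> i \<noteq> opp n i"
  by (auto simp: opp_def split: if_splits)

lemma opp_eq_iff [simp]: "i < 2 * n \<Longrightarrow> j < 2 * n \<Longrightarrow> opp n i = opp n j \<longleftrightarrow> i = j"
  by (auto simp: opp_def split: if_splits)

lemma opp_eq_swap: "i < 2 * n \<Longrightarrow> j < 2 * n \<Longrightarrow> i = opp n j \<longleftrightarrow> opp n i = j"
  by (auto simp: opp_def split: if_splits)

lemma bij_opp: "bij_betw (opp n) {..<2 * n} {..<2 * n}"
  by (rule bij_betw_byWitness[where f' = "opp n"]) auto

lemma sum_opp: "(\<Sum>i<2 * n. f (opp n i)) = (\<Sum>i<2 * n. f i)"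
  by (rule sum.reindex_bij_betw[OF bij_opp])

lemma sum_pairs_opp:
  "(\<Sum>i<2 * n. \<Sum>j<2 * n. f (opp n j) (opp n i)) = (\<Sum>i<2 * n. \<Sum>j<2 * n. f i j)"
proof -
  have "(\<Sum>i<2 * n. \<Sum>j<2 * n. f (opp n j) (opp n i)) = (\<Sum>i<2 * n. \<Sum>j<2 * n. f j (opp n i))"
    by (rule sum.cong[OF refl]) (rule sum_opp)
  also have "\<dots> = (\<Sum>i<2 * n. \<Sum>j<2 * n. f j i)"
    by (rule sum_opp)
  also have "\<dots> = (\<Sum>i<2 * n. \<Sum>j<2 * n. f i j)"
    by (rule sum.swap)
  finally show ?thesis .
qed

text \<open>
  On matrix entries the adjoint acts by the involution \<open>(i, j) \<mapsto> (opp n j, opp n i)\<close>, whose fixed points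
  are the pairs \<open>(i, opp n i)\<close>.  Of the two members of any other orbit exactly one satisfies
  \<open>i < opp n j\<close>, so a double sum folds onto these representatives.
\<close>

lemma sum_half:
  fixes f :: "nat \<Rightarrow> nat \<Rightarrow> 'a::comm_monoid_add"
  assumes "\<And>i. i < 2 * n \<Longrightarrow> f i (opp n i) = 0"
  shows "(\<Sum>i<2 * n. \<Sum>j<2 * n. if i < opp n j then f i j + f (opp n j) (opp n i) else 0)
       = (\<Sum>i<2 * n. \<Sum>j<2 * n. f i j)"
proof -
  have "(\<Sum>i<2 * n. \<Sum>j<2 * n. if i < opp n j then f i j + f (opp n j) (opp n i) else 0)
    = (\<Sum>i<2 * n. \<Sum>j<2 * n. (if i < opp n j then f i j else 0))
      + (\<Sum>i<2 * n. \<Sum>j<2 * n. if i < opp n j then f (opp n j) (opp n i) else 0)"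
    by (auto simp: sum.distrib[symmetric] intro!: sum.cong)
  also have "(\<Sum>i<2 * n. \<Sum>j<2 * n. if i < opp n j then f (opp n j) (opp n i) else 0)
    = (\<Sum>i<2 * n. \<Sum>j<2 * n. if opp n j < i then f i j else 0)"
    by (subst sum_pairs_opp[symmetric]) (auto intro!: sum.cong)
  finally show ?thesis
    by (auto simp: sum.distrib[symmetric] not_less assms opp_eq_swap intro!: sum.cong)
qed

text \<open>
  The adjoint with respect to the standard hyperbolic form \<open>hbil\<close>.
\<close>

definition std_adj :: "nat \<Rightarrow> 'k mat \<Rightarrow> 'k mat" where
  "std_adj n Y = mat (2 * n) (2 * n) (\<lambda>(i, j). Y $$ (opp n j, opp n i))"

text \<open>
  A choice of \<open>W\<close> with \<open>Y = W + W\<^sup>*\<close>: it keeps one entry from every orbit of the adjoint involution.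
\<close>

definition std_half :: "nat \<Rightarrow> 'k::zero mat \<Rightarrow> 'k mat" where
  "std_half n Y = mat (2 * n) (2 * n) (\<lambda>(i, j). if i < opp n j then Y $$ (i, j) else 0)"

text \<open>
  The orthogonal Lie algebra in hyperbolic coordinates: the second condition says that the symmetric
  form \<open>\<beta>(Y v, w)\<close> has zero diagonal, which does not follow from self-adjointness in characteristic 2.
\<close>

definition std_lie :: "nat \<Rightarrow> 'k::zero mat set" where
  "std_lie n = {Y \<in> carrier_mat (2 * n) (2 * n). std_adj n Y = Y \<and> (\<forall>i<2 * n. Y $$ (opp n i, i) = 0)}"

definition hform :: "nat \<Rightarrow> 'k::field vec \<Rightarrow> 'k" where
  "hform n v = (\<Sum>i<n. v $ i * v $ (n + i))"

definition hbil :: "nat \<Rightarrow> 'k::field vec \<Rightarrow> 'k vec \<Rightarrow> 'k" where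
  "hbil n v w = (\<Sum>i<2 * n. v $ i * w $ (opp n i))"

text \<open>
  A hyperbolic basis together with its inverse matrix, since most formulas below conjugate by it.
  For \<open>\<alpha> = hform n\<close> such a pair is an element of the orthogonal group in hyperbolic coordinates
  together with its inverse.
\<close>

definition hyp_frame :: "nat \<Rightarrow> ('k::field vec \<Rightarrow> 'k) \<Rightarrow> 'k mat \<Rightarrow> 'k mat \<Rightarrow> bool" where
  "hyp_frame n \<alpha> P P' \<longleftrightarrow> P \<in> carrier_mat (2 * n) (2 * n) \<and> P' \<in> carrier_mat (2 * n) (2 * n) \<and>
     P * P' = 1\<^sub>m (2 * n) \<and> P' * P = 1\<^sub>m (2 * n) \<and> (\<forall>v\<in>carrier_vec (2 * n). \<alpha> (P *\<^sub>v v) = hform n v)"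

text \<open>
  The trace of \<open>A B\<close>.
\<close>

definition tpair :: "nat \<Rightarrow> 'k::field mat \<Rightarrow> 'k mat \<Rightarrow> 'k" where
  "tpair N A B = (\<Sum>i<N. \<Sum>j<N. A $$ (i, j) * B $$ (j, i))"

lemma std_adj_carrier [simp]: "std_adj n Y \<in> carrier_mat (2 * n) (2 * n)"
  by (simp add: std_adj_def)

lemma std_adj_dim [simp]: "dim_row (std_adj n Y) = 2 * n" "dim_col (std_adj n Y) = 2 * n"
  by (simp_all add: std_adj_def)

lemma std_adj_index [simp]:
  "i < 2 * n \<Longrightarrow> j < 2 * n \<Longrightarrow> std_adj n Y $$ (i, j) = Y $$ (opp n j, opp n i)"
  by (simp add: std_adj_def)

lemma std_half_carrier [simp]: "std_half n Y \<in> carrier_mat (2 * n) (2 * n)"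
  by (simp add: std_half_def)

lemma std_half_dim [simp]: "dim_row (std_half n Y) = 2 * n" "dim_col (std_half n Y) = 2 * n"
  by (simp_all add: std_half_def)

lemma std_half_index [simp]:
  "i < 2 * n \<Longrightarrow> j < 2 * n \<Longrightarrow> std_half n Y $$ (i, j) = (if i < opp n j then Y $$ (i, j) else 0)"
  by (simp add: std_half_def)

lemma std_lieD:
  assumes "Y \<in> std_lie n"
  shows "Y \<in> carrier_mat (2 * n) (2 * n)" "std_adj n Y = Y"
    "\<And>i. i < 2 * n \<Longrightarrow> Y $$ (opp n i, i) = 0"
    "\<And>i j. i < 2 * n \<Longrightarrow> j < 2 * n \<Longrightarrow> Y $$ (opp n j, opp n i) = Y $$ (i, j)"
    "\<And>i. i < 2 * n \<Longrightarrow> Y $$ (i, opp n i) = 0"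
proof -
  show *: "Y \<in> carrier_mat (2 * n) (2 * n)" "std_adj n Y = Y"
    "\<And>i. i < 2 * n \<Longrightarrow> Y $$ (opp n i, i) = 0"
    using assms by (auto simp: std_lie_def)
  show "Y $$ (opp n j, opp n i) = Y $$ (i, j)" if "i < 2 * n" "j < 2 * n" for i j
    using std_adj_index[OF that, of Y] *(2) by simp
  show "Y $$ (i, opp n i) = 0" if "i < 2 * n" for i
    using *(3)[of "opp n i"] that by simp
qed

lemma std_adj_mult:
  fixes A B :: "'k::comm_semiring_0 mat"
  assumes "A \<in> carrier_mat (2 * n) (2 * n)" "B \<in> carrier_mat (2 * n) (2 * n)"
  shows "std_adj n (A * B) = std_adj n B * std_adj n A"
proof (rule eq_matI)
  fix i j assume "i < dim_row (std_adj n B * std_adj n A)" "j < dim_col (std_adj n B * std_adj n A)"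
  then have ij: "i < 2 * n" "j < 2 * n" by auto
  have "std_adj n (A * B) $$ (i, j) = (\<Sum>k<2 * n. A $$ (opp n j, k) * B $$ (k, opp n i))"
    using ij assms by (simp add: scalar_prod_def lessThan_atLeast0)
  also have "\<dots> = (\<Sum>k<2 * n. A $$ (opp n j, opp n k) * B $$ (opp n k, opp n i))"
    by (rule sum_opp[symmetric])
  also have "\<dots> = (std_adj n B * std_adj n A) $$ (i, j)"
    using ij by (auto simp: scalar_prod_def lessThan_atLeast0 mult.commute intro!: sum.cong)
  finally show "std_adj n (A * B) $$ (i, j) = (std_adj n B * std_adj n A) $$ (i, j)" .
qed auto

lemma std_adj_add:
  fixes A B :: "'k::comm_semiring_0 mat"
  assumes "A \<in> carrier_mat (2 * n) (2 * n)" "B \<in> carrier_mat (2 * n) (2 * n)"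
  shows "std_adj n (A + B) = std_adj n A + std_adj n B"
  using assms by (intro eq_matI) auto

lemma std_adj_std_adj [simp]: "A \<in> carrier_mat (2 * n) (2 * n) \<Longrightarrow> std_adj n (std_adj n A) = A"
  by (intro eq_matI) auto

lemma std_lie_eq_half:
  fixes Y :: "'k::field mat"
  assumes "Y \<in> std_lie n"
  shows "Y = std_half n Y + std_adj n (std_half n Y)"
proof (rule eq_matI)
  note * = std_lieD[OF assms]
  fix i j assume "i < dim_row (std_half n Y + std_adj n (std_half n Y))"
    "j < dim_col (std_half n Y + std_adj n (std_half n Y))"
  then have ij: "i < 2 * n" "j < 2 * n" by auto
  consider "i < opp n j" | "opp n j < i" | "i = opp n j" by linarith
  then show "Y $$ (i, j) = (std_half n Y + std_adj n (std_half n Y)) $$ (i, j)"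
    by cases (use ij * in auto)
qed (use std_lieD(1)[OF assms] in auto)

lemma tpair_commute: "tpair N A B = tpair N B A"
  unfolding tpair_def by (subst sum.swap) (simp add: mult.commute)

lemma tpair_mult:
  assumes "A \<in> carrier_mat N N" "B \<in> carrier_mat N N" "C \<in> carrier_mat N N"
  shows "tpair N (A * B) C = tpair N A (B * C)"
proof -
  have "tpair N (A * B) C = (\<Sum>i<N. \<Sum>j<N. \<Sum>k<N. A $$ (i, k) * B $$ (k, j) * C $$ (j, i))"
    using assms by (simp add: tpair_def scalar_prod_def lessThan_atLeast0 sum_distrib_right)
  also have "\<dots> = (\<Sum>i<N. \<Sum>k<N. \<Sum>j<N. A $$ (i, k) * B $$ (k, j) * C $$ (j, i))"
    by (rule sum.cong[OF refl]) (rule sum.swap)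
  also have "\<dots> = tpair N A (B * C)"
    using assms by (simp add: tpair_def scalar_prod_def lessThan_atLeast0 sum_distrib_left mult.assoc)
  finally show ?thesis .
qed

lemma tpair_conj:
  assumes "A \<in> carrier_mat N N" "B \<in> carrier_mat N N" "g \<in> carrier_mat N N" "h \<in> carrier_mat N N"
  shows "tpair N (g * A * h) B = tpair N A (h * B * g)"
proof -
  have "tpair N (g * A * h) B = tpair N g (A * (h * B))"
    using assms by (simp add: tpair_mult assoc_mult_mat[of _ N N _ N _ N])
  also have "\<dots> = tpair N (A * (h * B)) g"
    by (rule tpair_commute)
  also have "\<dots> = tpair N A (h * B * g)"
    using assms by (simp add: tpair_mult)
  finally show ?thesis .
qed

lemma tpair_add_right:
  assumes "B \<in> carrier_mat N N" "C \<in> carrier_mat N N"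
  shows "tpair N A (B + C) = tpair N A B + tpair N A C"
  using assms by (simp add: tpair_def distrib_left sum.distrib)

lemma tpair_smult_right:
  assumes "B \<in> carrier_mat N N"
  shows "tpair N A (c \<cdot>\<^sub>m B) = c * tpair N A B"
  using assms by (simp add: tpair_def sum_distrib_left mult_ac)

definition unit_mat :: "nat \<Rightarrow> nat \<Rightarrow> nat \<Rightarrow> 'k::zero_neq_one mat" where
  "unit_mat N i j = mat N N (\<lambda>(k, l). if k = i \<and> l = j then 1 else 0)"

lemma unit_mat_carrier [simp]: "unit_mat N i j \<in> carrier_mat N N"
  by (simp add: unit_mat_def)

lemma unit_mat_dim [simp]: "dim_row (unit_mat N i j) = N" "dim_col (unit_mat N i j) = N"
  by (simp_all add: unit_mat_def)

lemma unit_mat_index [simp]: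
  "k < N \<Longrightarrow> l < N \<Longrightarrow> unit_mat N i j $$ (k, l) = (if k = i \<and> l = j then 1 else 0)"
  by (simp add: unit_mat_def)

lemma tpair_unit_mat:
  assumes "i < N" "j < N"
  shows "tpair N A (unit_mat N j i) = A $$ (i, j)"
proof -
  have "tpair N A (unit_mat N j i) = (\<Sum>k<N. \<Sum>l<N. if k = i then if l = j then A $$ (k, l) else 0 else 0)"
    unfolding tpair_def by (auto intro!: sum.cong)
  also have "\<dots> = (\<Sum>k<N. if k = i then \<Sum>l<N. if l = j then A $$ (k, l) else 0 else 0)"
    by (rule sum.cong[OF refl]) simp
  also have "\<dots> = A $$ (i, j)" using assms by (simp add: sum.delta)
  finally show ?thesis .
qed

lemma unit_vec_index: "i < N \<Longrightarrow> unit_vec N j $ i = (if i = j then 1 else 0)"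
  by (simp add: unit_vec_def)

lemma mult_mat_unit_vec:
  fixes A :: "'k::semiring_1 mat"
  assumes "A \<in> carrier_mat N N" "i < N" "j < N"
  shows "(A *\<^sub>v unit_vec N j) $ i = A $$ (i, j)"
  using assms by (simp add: scalar_prod_def unit_vec_def if_distrib cong: if_cong)

lemma hbil_eq: "hbil n v w = (\<Sum>i<n. v $ i * w $ (n + i) + v $ (n + i) * w $ i)"
proof -
  have "{..<2 * n} = {..<n} \<union> {n..<2 * n}" by auto
  then have "hbil n v w = (\<Sum>i<n. v $ i * w $ (opp n i)) + (\<Sum>i=n..<2 * n. v $ i * w $ (opp n i))"
    by (simp add: hbil_def sum.union_disjoint ivl_disj_int)
  also have "(\<Sum>i=n..<2 * n. v $ i * w $ (opp n i)) = (\<Sum>i<n. v $ (n + i) * w $ i)"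
    by (rule sum.reindex_bij_witness[of _ "\<lambda>i. n + i" "\<lambda>i. i - n"]) (auto simp: opp_def)
  also have "(\<Sum>i<n. v $ i * w $ (opp n i)) = (\<Sum>i<n. v $ i * w $ (n + i))"
    by (simp add: opp_def)
  finally show ?thesis by (simp add: sum.distrib)
qed

lemma hform_add:
  assumes "v \<in> carrier_vec (2 * n)" "w \<in> carrier_vec (2 * n)"
  shows "hform n (v + w) = hform n v + hform n w + hbil n v w"
proof -
  have "hform n (v + w) = (\<Sum>i<n. (v $ i + w $ i) * (v $ (n + i) + w $ (n + i)))"
    using assms by (simp add: hform_def)
  also have "\<dots> = hform n v + hform n w + hbil n v w"
    by (simp add: hform_def hbil_eq sum.distrib[symmetric] algebra_simps)
  finally show ?thesis .
qed

lemma hform_smult: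
  assumes "v \<in> carrier_vec (2 * n)"
  shows "hform n (c \<cdot>\<^sub>v v) = c\<^sup>2 * hform n v"
  using assms by (auto simp: hform_def sum_distrib_left power2_eq_square intro!: sum.cong)

lemma hbil_commute: "hbil n v w = hbil n w v"
  by (simp add: hbil_eq add.commute mult.commute)

lemma hbil_add_left:
  assumes "u \<in> carrier_vec (2 * n)" "v \<in> carrier_vec (2 * n)"
  shows "hbil n (u + v) w = hbil n u w + hbil n v w"
  using assms by (simp add: hbil_def sum.distrib distrib_right)

lemma hbil_smult_left:
  assumes "v \<in> carrier_vec (2 * n)"
  shows "hbil n (c \<cdot>\<^sub>v v) w = c * hbil n v w"
  using assms by (simp add: hbil_def sum_distrib_left mult.assoc)

lemma hbil_add_right:
  assumes "u \<in> carrier_vec (2 * n)" "v \<in> carrier_vec (2 * n)"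
  shows "hbil n w (u + v) = hbil n w u + hbil n w v"
  using hbil_add_left[OF assms] by (simp add: hbil_commute)

lemma hbil_smult_right:
  assumes "v \<in> carrier_vec (2 * n)"
  shows "hbil n w (c \<cdot>\<^sub>v v) = c * hbil n w v"
  using hbil_smult_left[OF assms] by (simp add: hbil_commute)

lemma hbil_unit_right:
  assumes "j < 2 * n"
  shows "hbil n v (unit_vec (2 * n) j) = v $ (opp n j)"
proof -
  have "hbil n v (unit_vec (2 * n) j) = (\<Sum>i<2 * n. if i = opp n j then v $ i else 0)"
    unfolding hbil_def using assms by (intro sum.cong) (auto simp: unit_vec_index opp_eq_swap)
  also have "\<dots> = v $ (opp n j)" using assms by simp
  finally show ?thesis .
qed

lemma hbil_unit_left:
  assumes "j < 2 * n"
  shows "hbil n (unit_vec (2 * n) j) v = v $ (opp n j)"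
  using hbil_unit_right[OF assms] by (simp add: hbil_commute)

lemma hform_unit:
  assumes "j < 2 * n"
  shows "hform n (unit_vec (2 * n) j) = (0::'k::field)"
  unfolding hform_def using assms by (intro sum.neutral) (auto simp: unit_vec_index)

lemma hyp_frameD:
  assumes "hyp_frame n \<alpha> P P'"
  shows "P \<in> carrier_mat (2 * n) (2 * n)" "P' \<in> carrier_mat (2 * n) (2 * n)"
    "P * P' = 1\<^sub>m (2 * n)" "P' * P = 1\<^sub>m (2 * n)"
    "\<And>v. v \<in> carrier_vec (2 * n) \<Longrightarrow> \<alpha> (P *\<^sub>v v) = hform n v"
  using assms by (auto simp: hyp_frame_def)

lemma mult_square_carrier [simp]:
  "A \<in> carrier_mat N N \<Longrightarrow> B \<in> carrier_mat N N \<Longrightarrow> A * B \<in> carrier_mat N N"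
  by (rule mult_carrier_mat)

lemma smult_mat_mult_vec:
  fixes A :: "'k::field mat"
  assumes "A \<in> carrier_mat N N" "v \<in> carrier_vec N"
  shows "(c \<cdot>\<^sub>m A) *\<^sub>v v = c \<cdot>\<^sub>v (A *\<^sub>v v)"
  using assms by (intro eq_vecI) (auto simp: scalar_prod_def sum_distrib_left mult.assoc)

lemma mult_cancel_left:
  fixes A :: "'k::semiring_1 mat"
  assumes "A \<in> carrier_mat N N" "B \<in> carrier_mat N N" "A * B = 1\<^sub>m N" "C \<in> carrier_mat N N"
  shows "A * (B * C) = C"
  using assms by (simp add: assoc_mult_mat[symmetric, of A N N B N C N])

lemma mult_vec_cancel_left:
  fixes A :: "'k::comm_semiring_1 mat"
  assumes "A \<in> carrier_mat N N" "B \<in> carrier_mat N N" "A * B = 1\<^sub>m N" "v \<in> carrier_vec N"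
  shows "A *\<^sub>v (B *\<^sub>v v) = v"
  using assms by (simp add: assoc_mult_mat_vec[symmetric, of A N N B N v])

lemma hyp_frame_polar:
  assumes "hyp_frame n \<alpha> P P'" "v \<in> carrier_vec (2 * n)" "w \<in> carrier_vec (2 * n)"
  shows "polar_form \<alpha> (P *\<^sub>v v) (P *\<^sub>v w) = hbil n v w"
proof -
  note P = hyp_frameD[OF assms(1)]
  have "P *\<^sub>v v + P *\<^sub>v w = P *\<^sub>v (v + w)"
    using P assms(2,3) by (simp add: mult_add_distrib_mat_vec[of _ "2*n" "2*n"])
  then show ?thesis
    using P assms(2,3) by (simp add: polar_form_def hform_add)
qed

lemma hform_polar:
  assumes "v \<in> carrier_vec (2 * n)" "w \<in> carrier_vec (2 * n)"
  shows "polar_form (hform n) v w = hbil n v w"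
  using assms by (simp add: polar_form_def hform_add)

text \<open>
  An isometry of the quadratic form preserves its polar form, which for matrices means that its
  adjoint is a left inverse.
\<close>

lemma hyp_frame_inverse_eq:
  assumes "hyp_frame n (hform n) h h'"
  shows "h' = std_adj n h"
proof -
  note h = hyp_frameD[OF assms]
  let ?N = "2 * n"
  have *: "hbil n (h *\<^sub>v v) (h *\<^sub>v w) = hbil n v w" if "v \<in> carrier_vec ?N" "w \<in> carrier_vec ?N" for v w
    using hyp_frame_polar[OF assms that] hform_polar[of "h *\<^sub>v v" n "h *\<^sub>v w"] h that by auto
  have "std_adj n h * h = 1\<^sub>m ?N"
  proof (rule eq_matI)
    fix i j assume "i < dim_row (1\<^sub>m ?N :: 'a mat)" "j < dim_col (1\<^sub>m ?N :: 'a mat)"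
    then have ij: "i < ?N" "j < ?N" by auto
    have "(std_adj n h * h) $$ (i, j) = (\<Sum>k<?N. h $$ (opp n k, opp n i) * h $$ (k, j))"
      using ij h by (auto simp: scalar_prod_def lessThan_atLeast0 intro!: sum.cong)
    also have "\<dots> = hbil n (h *\<^sub>v unit_vec ?N j) (h *\<^sub>v unit_vec ?N (opp n i))"
      unfolding hbil_def
    proof (rule sum.cong[OF refl])
      fix k assume "k \<in> {..<?N}"
      then have "(h *\<^sub>v unit_vec ?N j) $ k = h $$ (k, j)"
        "(h *\<^sub>v unit_vec ?N (opp n i)) $ opp n k = h $$ (opp n k, opp n i)"
        using ij h(1) by (auto simp: mult_mat_unit_vec[of h ?N] simp del: index_mult_mat_vec)
      then show "h $$ (opp n k, opp n i) * h $$ (k, j)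
          = (h *\<^sub>v unit_vec ?N j) $ k * (h *\<^sub>v unit_vec ?N (opp n i)) $ opp n k"
        by (simp only: mult.commute)
    qed
    also have "\<dots> = hbil n (unit_vec ?N j) (unit_vec ?N (opp n i))"
      using ij by (intro *) auto
    also have "\<dots> = 1\<^sub>m ?N $$ (i, j)"
      using ij by (subst hbil_unit_right) (auto simp: unit_vec_index)
    finally show "(std_adj n h * h) $$ (i, j) = 1\<^sub>m ?N $$ (i, j)" .
  qed (use h in auto)
  then have "std_adj n h * (h * h') = h'"
    using h by (intro mult_cancel_left[of _ ?N]) auto
  then show ?thesis using h by simp
qed

lemma hyp_frame_trans:
  assumes "hyp_frame n \<alpha> P P'" "hyp_frame n (hform n) h h'"
  shows "hyp_frame n \<alpha> (P * h) (h' * P')"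
proof -
  note P = hyp_frameD[OF assms(1)] and h = hyp_frameD[OF assms(2)]
  show ?thesis
    unfolding hyp_frame_def using P h
    by (auto simp: assoc_mult_mat[of _ "2*n" "2*n" _ "2*n" _ "2*n"] mult_cancel_left[of _ "2*n"])
qed

text \<open>
  Any two hyperbolic bases differ by an isometry.
\<close>

lemma hyp_frame_rel:
  assumes "hyp_frame n \<alpha> P P'" "hyp_frame n \<alpha> R R'"
  shows "hyp_frame n (hform n) (P' * R) (R' * P)"
proof -
  note P = hyp_frameD[OF assms(1)] and R = hyp_frameD[OF assms(2)]
  have "hform n (P' *\<^sub>v (R *\<^sub>v v)) = hform n v" if "v \<in> carrier_vec (2 * n)" for v
    using P(5)[of "P' *\<^sub>v (R *\<^sub>v v)"] P(1-4) R that
    by (simp add: mult_vec_cancel_left[of _ "2*n"])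
  then show ?thesis
    unfolding hyp_frame_def using P R
    by (auto simp: assoc_mult_mat[of _ "2*n" "2*n" _ "2*n" _ "2*n"] mult_cancel_left[of _ "2*n"])
qed

lemma hyp_frame_sym:
  assumes "hyp_frame n (hform n) h h'"
  shows "hyp_frame n (hform n) h' h"
proof -
  have "hyp_frame n (hform n) (1\<^sub>m (2 * n)) (1\<^sub>m (2 * n))" by (simp add: hyp_frame_def)
  from hyp_frame_rel[OF assms this] show ?thesis using hyp_frameD[OF assms] by simp
qed

lemma hyperbolic_basis_iff: "hyperbolic_basis n \<alpha> P \<longleftrightarrow> (\<exists>P'. hyp_frame n \<alpha> P P')"
proof
  assume *: "hyperbolic_basis n \<alpha> P"
  then have P: "P \<in> carrier_mat (2 * n) (2 * n)" by (simp add: hyperbolic_basis_def)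
  from * obtain P' where P': "P * P' = 1\<^sub>m (dim_row P)" "P' * P = 1\<^sub>m (dim_row P')"
    by (auto simp: hyperbolic_basis_def invertible_mat_def inverts_mat_def)
  have "dim_col P' = 2 * n" using arg_cong[OF P'(1), of dim_col] P by simp
  moreover have "dim_row P' = 2 * n" using arg_cong[OF P'(2), of dim_col] P by simp
  ultimately show "\<exists>P'. hyp_frame n \<alpha> P P'"
    using P P' * by (intro exI[of _ P']) (auto simp: hyp_frame_def hyperbolic_basis_def hform_def)
next
  assume "\<exists>P'. hyp_frame n \<alpha> P P'"
  then show "hyperbolic_basis n \<alpha> P"
    by (auto simp: hyp_frame_def hyperbolic_basis_def hform_def invertible_mat_def inverts_mat_def)
qed

lemma unit_mat_mult_vec:
  assumes "(v :: 'k::field vec) \<in> carrier_vec N" "i < N" "j < N"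
  shows "unit_mat N i j *\<^sub>v v = v $ j \<cdot>\<^sub>v unit_vec N i"
proof (rule eq_vecI)
  fix k assume "k < dim_vec (v $ j \<cdot>\<^sub>v unit_vec N i)"
  then have k: "k < N" by simp
  then have "(unit_mat N i j *\<^sub>v v) $ k = (\<Sum>l<N. (if k = i \<and> l = j then 1 else 0) * v $ l)"
    using assms by (simp add: scalar_prod_def lessThan_atLeast0)
  also have "\<dots> = (\<Sum>l<N. if l = j then (if k = i then v $ l else 0) else 0)"
    by (rule sum.cong) auto
  also have "\<dots> = (v $ j \<cdot>\<^sub>v unit_vec N i) $ k"
    using assms k by (simp add: unit_vec_index)
  finally show "(unit_mat N i j *\<^sub>v v) $ k = (v $ j \<cdot>\<^sub>v unit_vec N i) $ k" .
qed auto

lemma mat_eqI_mult_vec: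
  assumes "A \<in> carrier_mat N N" "B \<in> carrier_mat N N"
    and "\<And>v. v \<in> carrier_vec N \<Longrightarrow> A *\<^sub>v v = B *\<^sub>v (v :: 'k::field vec)"
  shows "A = B"
proof (rule eq_matI)
  fix i j assume "i < dim_row B" "j < dim_col B"
  then have "i < N" "j < N" using assms by auto
  then show "A $$ (i, j) = B $$ (i, j)"
    using assms(3)[of "unit_vec N j"] mult_mat_unit_vec[OF assms(1), of i j] mult_mat_unit_vec[OF assms(2), of i j]
    by simp
qed (use assms in auto)

lemma frame_conj_cancel:
  assumes "hyp_frame n \<alpha> (P :: 'k::field mat) P'" "Y \<in> carrier_mat (2 * n) (2 * n)"
  shows "P' * (P * Y * P') * P = Y" "P * (P' * Y * P) * P' = Y"
  using hyp_frameD[OF assms(1)] assms(2)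
  by (simp_all add: assoc_mult_mat[of _ "2*n" "2*n" _ "2*n" _ "2*n"] mult_cancel_left[of _ "2*n"])

lemma frame_conj_add:
  assumes "hyp_frame n \<alpha> (P :: 'k::field mat) P'" "A \<in> carrier_mat (2 * n) (2 * n)" "B \<in> carrier_mat (2 * n) (2 * n)"
  shows "P * (A + B) * P' = P * A * P' + P * B * P'" "P' * (A + B) * P = P' * A * P + P' * B * P"
  using hyp_frameD[OF assms(1)] assms(2,3)
  by (simp_all add: mult_add_distrib_mat[of _ "2*n" "2*n" _ "2*n"] add_mult_distrib_mat[of _ "2*n" "2*n" _ _ "2*n"])

lemma frame_conj_smult:
  assumes "hyp_frame n \<alpha> (P :: 'k::field mat) P'" "A \<in> carrier_mat (2 * n) (2 * n)"
  shows "P * (c \<cdot>\<^sub>m A) * P' = c \<cdot>\<^sub>m (P * A * P')" "P' * (c \<cdot>\<^sub>m A) * P = c \<cdot>\<^sub>m (P' * A * P)"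
  using hyp_frameD[OF assms(1)] assms(2)
  by (simp_all add: mult_smult_distrib[of _ "2*n" "2*n" _ "2*n"] mult_smult_assoc_mat[of _ "2*n" "2*n" _ "2*n"])

lemma std_lie_add:
  assumes "(A :: 'k::field mat) \<in> std_lie n" "B \<in> std_lie n"
  shows "A + B \<in> std_lie n"
  using std_lieD[OF assms(1)] std_lieD[OF assms(2)] by (auto simp: std_lie_def std_adj_add)

lemma std_lie_smult:
  assumes "(A :: 'k::field mat) \<in> std_lie n"
  shows "c \<cdot>\<^sub>m A \<in> std_lie n"
  using std_lieD[OF assms] by (auto simp: std_lie_def intro!: eq_matI)

lemma std_half_add:
  assumes "A \<in> carrier_mat (2 * n) (2 * n)" "(B :: 'k::field mat) \<in> carrier_mat (2 * n) (2 * n)"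
  shows "std_half n (A + B) = std_half n A + std_half n B"
  using assms by (intro eq_matI) auto

lemma std_half_smult:
  assumes "(A :: 'k::field mat) \<in> carrier_mat (2 * n) (2 * n)"
  shows "std_half n (c \<cdot>\<^sub>m A) = c \<cdot>\<^sub>m std_half n A"
  using assms by (intro eq_matI) auto

lemma orthogonal_group_carrier_iff:
  assumes P: "hyp_frame n \<alpha> P P'"
  shows "g \<in> carrier (orthogonal_group n \<alpha>) \<longleftrightarrow> (\<exists>h h'. hyp_frame n (hform n) h h' \<and> g = P * h * P')"
proof
  note P = P hyp_frameD[OF P]
  assume "g \<in> carrier (orthogonal_group n \<alpha>)"
  then have g: "g \<in> carrier_mat (2 * n) (2 * n)" "invertible_mat g"
    "\<And>v. v \<in> carrier_vec (2 * n) \<Longrightarrow> \<alpha> (g *\<^sub>v v) = \<alpha> v"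
    by (auto simp: orthogonal_group_def)
  from g(2) obtain k where k: "g * k = 1\<^sub>m (dim_row g)" "k * g = 1\<^sub>m (dim_row k)"
    by (auto simp: invertible_mat_def inverts_mat_def)
  have "dim_col k = 2 * n" using arg_cong[OF k(1), of dim_col] g by simp
  moreover have "dim_row k = 2 * n" using arg_cong[OF k(2), of dim_col] g by simp
  ultimately have k: "k \<in> carrier_mat (2 * n) (2 * n)" "g * k = 1\<^sub>m (2 * n)" "k * g = 1\<^sub>m (2 * n)"
    using g k by auto
  have "hyp_frame n \<alpha> (g * P) (P' * k)"
    using P g k by (auto simp: hyp_frame_def assoc_mult_mat[of _ "2*n" "2*n" _ "2*n" _ "2*n"] mult_cancel_left[of _ "2*n"])
  from hyp_frame_rel[OF P(1) this] P g
  show "\<exists>h h'. hyp_frame n (hform n) h h' \<and> g = P * h * P'"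
    by (intro exI[of _ "P' * (g * P)"] exI[of _ "P' * k * P"])
     (auto simp: assoc_mult_mat[of _ "2*n" "2*n" _ "2*n" _ "2*n"] mult_cancel_left[of _ "2*n"])
next
  assume "\<exists>h h'. hyp_frame n (hform n) h h' \<and> g = P * h * P'"
  then obtain h h' where h: "hyp_frame n (hform n) h h'" and g: "g = P * h * P'" by blast
  note P = hyp_frameD[OF P] and h = hyp_frameD[OF h]
  have "g * (P * h' * P') = 1\<^sub>m (2 * n)" "(P * h' * P') * g = 1\<^sub>m (2 * n)"
    using P h by (auto simp: g assoc_mult_mat[of _ "2*n" "2*n" _ "2*n" _ "2*n"] mult_cancel_left[of _ "2*n"])
  then have "invertible_mat g"
    using P h by (auto simp: g invertible_mat_def inverts_mat_def intro!: exI[of _ "P * h' * P'"])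
  moreover have "\<alpha> (g *\<^sub>v v) = \<alpha> v" if "v \<in> carrier_vec (2 * n)" for v
    using that P(1-4) h P(5)[of "h *\<^sub>v (P' *\<^sub>v v)"] P(5)[of "P' *\<^sub>v v"]
    by (simp add: g assoc_mult_mat_vec[of _ "2*n" "2*n" _ "2*n"] mult_vec_cancel_left[of _ "2*n"])
  ultimately show "g \<in> carrier (orthogonal_group n \<alpha>)"
    using P h by (simp add: orthogonal_group_def g)
qed

lemma singular_flagI:
  assumes "w \<in> carrier_vec (2 * n)" "\<And>i. m \<le> i \<Longrightarrow> i < 2 * n \<Longrightarrow> w $ i = 0"
  shows "P *\<^sub>v w \<in> singular_flag n P m"
  using assms by (auto simp: singular_flag_def)

lemma borel_subgroup_iff:
  assumes P: "hyp_frame n \<alpha> P P'" and h: "hyp_frame n (hform n) h h'"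
  shows "P * h * P' \<in> borel_subgroup n \<alpha> P \<longleftrightarrow> (\<forall>j<n. \<forall>i<2 * n. j < i \<longrightarrow> h $$ (i, j) = 0)"
proof -
  note PD = hyp_frameD[OF P] and hD = hyp_frameD[OF h]
  have act: "(P * h * P') *\<^sub>v (P *\<^sub>v v) = P *\<^sub>v (h *\<^sub>v v)" if "v \<in> carrier_vec (2 * n)" for v
    using PD hD that by (simp add: assoc_mult_mat_vec[of _ "2*n" "2*n" _ "2*n"] mult_vec_cancel_left[of _ "2*n"])
  show ?thesis
  proof
    assume B: "P * h * P' \<in> borel_subgroup n \<alpha> P"
    show "\<forall>j<n. \<forall>i<2 * n. j < i \<longrightarrow> h $$ (i, j) = 0"
    proof (intro allI impI)
      fix i j assume ij: "j < n" "i < 2 * n" "j < i"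
      let ?b = "unit_vec (2 * n) j :: 'a vec"
      have "P *\<^sub>v ?b \<in> singular_flag n P (Suc j)"
        using ij by (intro singular_flagI) auto
      with B ij have "P *\<^sub>v (h *\<^sub>v ?b) \<in> singular_flag n P (Suc j)"
        unfolding borel_subgroup_def by (auto simp: act[symmetric])
      then obtain v where v: "v \<in> carrier_vec (2 * n)" "\<And>i. Suc j \<le> i \<Longrightarrow> i < 2 * n \<Longrightarrow> v $ i = 0"
        "P *\<^sub>v (h *\<^sub>v ?b) = P *\<^sub>v v"
        by (auto simp: singular_flag_def)
      have "h *\<^sub>v ?b = v"
        using arg_cong[OF v(3), of "\<lambda>v. P' *\<^sub>v v"] v(1) PD hD by (simp add: mult_vec_cancel_left[of _ "2*n"])
      then show "h $$ (i, j) = 0"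
        using v(2)[of i] ij mult_mat_unit_vec[OF hD(1), of i j] by simp
    qed
  next
    assume *: "\<forall>j<n. \<forall>i<2 * n. j < i \<longrightarrow> h $$ (i, j) = 0"
    have "(P * h * P') *\<^sub>v x \<in> singular_flag n P m" if m: "m \<le> n" and x: "x \<in> singular_flag n P m" for m x
    proof -
      from x obtain v where v: "x = P *\<^sub>v v" "v \<in> carrier_vec (2 * n)" "\<And>i. m \<le> i \<Longrightarrow> i < 2 * n \<Longrightarrow> v $ i = 0"
        by (auto simp: singular_flag_def)
      have "(h *\<^sub>v v) $ i = 0" if "m \<le> i" "i < 2 * n" for i
      proof -
        have "(h *\<^sub>v v) $ i = (\<Sum>j<2 * n. h $$ (i, j) * v $ j)"
          using hD v that by (simp add: scalar_prod_def lessThan_atLeast0)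
        also have "\<dots> = 0"
        proof (intro sum.neutral ballI)
          fix j assume "j \<in> {..<2 * n}"
          then show "h $$ (i, j) * v $ j = 0"
            using * v(3)[of j] that m by (cases "j < m") auto
        qed
        finally show ?thesis .
      qed
      then show ?thesis
        unfolding v(1) act[OF v(2)] using hD v(2) by (intro singular_flagI) auto
    qed
    moreover have "P * h * P' \<in> carrier (orthogonal_group n \<alpha>)"
      using P h by (auto simp: orthogonal_group_carrier_iff[OF P])
    ultimately show "P * h * P' \<in> borel_subgroup n \<alpha> P"
      by (simp add: borel_subgroup_def)
  qed
qed

lemma mat_diag_frame:
  assumes "\<And>i. i < 2 * n \<Longrightarrow> d i * d (opp n i) = (1::'k::field)"
  shows "hyp_frame n (hform n) (mat_diag (2 * n) d) (mat_diag (2 * n) (\<lambda>i. d (opp n i)))"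
proof -
  have "mat_diag (2 * n) d * mat_diag (2 * n) (\<lambda>i. d (opp n i)) = 1\<^sub>m (2 * n)"
    "mat_diag (2 * n) (\<lambda>i. d (opp n i)) * mat_diag (2 * n) d = 1\<^sub>m (2 * n)"
    using assms by (auto simp: mat_diag_diag mult.commute intro!: eq_matI) (auto simp: mat_diag_def)
  moreover have "hform n (mat_diag (2 * n) d *\<^sub>v v) = hform n v" if v: "v \<in> carrier_vec (2 * n)" for v
  proof -
    have *: "(mat_diag (2 * n) d *\<^sub>v v) $ i = d i * v $ i" if "i < 2 * n" for i
      using that v by (simp add: mat_diag_def scalar_prod_def if_distrib[of "\<lambda>x. x * _"] cong: if_cong)
    have "(mat_diag (2 * n) d *\<^sub>v v) $ i * (mat_diag (2 * n) d *\<^sub>v v) $ (n + i) = v $ i * v $ (n + i)"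
      if "i < n" for i
    proof -
      have "(mat_diag (2 * n) d *\<^sub>v v) $ i * (mat_diag (2 * n) d *\<^sub>v v) $ (n + i)
          = (d i * d (opp n i)) * (v $ i * v $ (n + i))"
        unfolding *[OF less_trans[OF that]] using that *[of i] *[of "n + i"] by (simp only: opp_def) simp
      then show ?thesis using assms[of i] that by simp
    qed
    then show ?thesis by (simp add: hform_def)
  qed
  ultimately show ?thesis by (simp add: hyp_frame_def)
qed

text \<open>
  Stated for an arbitrary monoid of matrices because the inverse is formed in the full orthogonal group
  and in its group of rational points.
\<close>

lemma inv_matrix_group:
  assumes ops: "\<And>a b. a \<otimes>\<^bsub>G\<^esub> b = a * b" "\<one>\<^bsub>G\<^esub> = 1\<^sub>m N" "carrier G \<subseteq> carrier_mat N N"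
    and g: "g \<in> carrier_mat N N" and k: "k \<in> carrier G"
    and gk: "g * k = 1\<^sub>m N" "k * g = (1\<^sub>m N :: 'k::field mat)"
  shows "inv\<^bsub>G\<^esub> g = k"
  unfolding m_inv_def
proof (rule the_equality)
  show "k \<in> carrier G \<and> g \<otimes>\<^bsub>G\<^esub> k = \<one>\<^bsub>G\<^esub> \<and> k \<otimes>\<^bsub>G\<^esub> g = \<one>\<^bsub>G\<^esub>"
    using k gk by (simp add: ops)
next
  fix y assume "y \<in> carrier G \<and> g \<otimes>\<^bsub>G\<^esub> y = \<one>\<^bsub>G\<^esub> \<and> y \<otimes>\<^bsub>G\<^esub> g = \<one>\<^bsub>G\<^esub>"
  then have y: "y \<in> carrier_mat N N" "g * y = 1\<^sub>m N" using ops by auto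
  have kc: "k \<in> carrier_mat N N" using k ops(3) by blast
  have "k * (g * y) = y" using mult_cancel_left[OF kc g gk(2) y(1)] .
  then show "y = k" using y kc by simp
qed

lemma frame_conj_inverse:
  assumes "hyp_frame n \<alpha> P P'" "hyp_frame n (hform n) h h'"
  shows "(P * h * P') * (P * h' * P') = 1\<^sub>m (2 * n)" "(P * h' * P') * (P * h * P') = 1\<^sub>m (2 * n)"
  using hyp_frameD[OF assms(1)] hyp_frameD[OF assms(2)]
  by (simp_all add: assoc_mult_mat[of _ "2*n" "2*n" _ "2*n" _ "2*n"] mult_cancel_left[of _ "2*n"])

lemma inv_orthogonal_group:
  assumes P: "hyp_frame n \<alpha> P P'" and h: "hyp_frame n (hform n) h h'"
  shows "inv\<^bsub>orthogonal_group n \<alpha>\<^esub> (P * h * P') = P * h' * P'"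
proof (rule inv_matrix_group)
  show "P * h' * P' \<in> carrier (orthogonal_group n \<alpha>)"
    using hyp_frame_sym[OF h] by (auto simp: orthogonal_group_carrier_iff[OF P])
qed (use frame_conj_inverse[OF P h] hyp_frameD[OF P] hyp_frameD[OF h] in \<open>auto simp: orthogonal_group_def\<close>)

lemma inv_rational_group:
  assumes P: "hyp_frame n \<alpha> P P'" and h: "hyp_frame n (hform n) h h'"
    and fixed: "frobenius q (P * h' * P') = P * h' * P'"
  shows "inv\<^bsub>rational_group q n \<alpha>\<^esub> (P * h * P') = P * h' * P'"
proof (rule inv_matrix_group)
  show "P * h' * P' \<in> carrier (rational_group q n \<alpha>)"
    using hyp_frame_sym[OF h] fixed by (auto simp: rational_group_def orthogonal_group_carrier_iff[OF P])
qed (use frame_conj_inverse[OF P h] hyp_frameD[OF P] hyp_frameD[OF h]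
    in \<open>auto simp: rational_group_def orthogonal_group_def\<close>)

section \<open>The invariant pairing in characteristic two\<close>

text \<open>
  The type argument only serves to fix the field.
\<close>

locale char_two =
  fixes type_of_scalars :: "'k::field itself"
  assumes CHAR_2: "CHAR('k) = 2"
begin

lemma uminus_eq [simp]: "- x = (x::'k)"
  by (rule uminus_CHAR_2[OF CHAR_2])

lemma add_self [simp]: "x + x = (0::'k)"
  using add.right_inverse[of x] by simp

lemma two_eq_0 [simp]: "(2 :: 'k) = 0"
  by (metis add_self one_add_one)

lemma add_self_left [simp]: "x + (x + y) = (y::'k)"
  by (simp add: add.assoc[symmetric])

lemma add_self_both [simp]: "x + y + x = (y::'k)"
  by (metis add.commute add_self_left)

lemma eq_iff_add_eq_0: "x = y \<longleftrightarrow> x + y = (0::'k)"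
  using eq_neg_iff_add_eq_0[of x y] by simp

text \<open>
  The terms for \<open>(i, j)\<close> and \<open>(j, i)\<close> cancel.
\<close>

lemma sum_symmetric_alternating:
  assumes "finite I"
    and "\<And>i j. i \<in> I \<Longrightarrow> j \<in> I \<Longrightarrow> f i j = f j i" "\<And>i. i \<in> I \<Longrightarrow> f i i = 0"
  shows "(\<Sum>i\<in>I. \<Sum>j\<in>I. f i j) = (0::'k)"
  using assms
proof (induction I)
  case (insert a I)
  have "(\<Sum>i\<in>insert a I. \<Sum>j\<in>insert a I. f i j)
      = f a a + (\<Sum>j\<in>I. f a j) + ((\<Sum>i\<in>I. f i a) + (\<Sum>i\<in>I. \<Sum>j\<in>I. f i j))"
    using insert.hyps by (simp add: sum.distrib)
  also have "(\<Sum>i\<in>I. f i a) = (\<Sum>j\<in>I. f a j)"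
    using insert.prems(1) by (intro sum.cong) auto
  also have "(\<Sum>i\<in>I. \<Sum>j\<in>I. f i j) = 0"
    using insert by simp
  finally show ?case using insert.prems by simp
qed simp

lemma std_lie_iff:
  assumes Y: "(Y :: 'k mat) \<in> carrier_mat (2 * n) (2 * n)"
  shows "Y \<in> std_lie n \<longleftrightarrow> (\<forall>v\<in>carrier_vec (2 * n). hbil n (Y *\<^sub>v v) v = 0)"
proof
  assume L: "Y \<in> std_lie n"
  note D = std_lieD[OF L]
  show "\<forall>v\<in>carrier_vec (2 * n). hbil n (Y *\<^sub>v v) v = 0"
  proof
    fix v :: "'k vec" assume v: "v \<in> carrier_vec (2 * n)"
    have "hbil n (Y *\<^sub>v v) v = hbil n v (Y *\<^sub>v v)"
      by (rule hbil_commute)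
    also have "\<dots> = (\<Sum>i<2 * n. \<Sum>j<2 * n. Y $$ (opp n i, j) * v $ i * v $ j)"
    proof -
      have "(Y *\<^sub>v v) $ opp n i = (\<Sum>j<2 * n. Y $$ (opp n i, j) * v $ j)" if "i < 2 * n" for i
        using Y v that by (simp add: scalar_prod_def lessThan_atLeast0)
      then show ?thesis
        unfolding hbil_def by (intro sum.cong) (auto simp: sum_distrib_left mult_ac)
    qed
    also have "\<dots> = 0"
    proof (rule sum_symmetric_alternating)
      fix i j assume ij: "i \<in> {..<2 * n}" "j \<in> {..<2 * n}"
      then have "Y $$ (opp n i, j) = Y $$ (opp n j, i)"
        using D(4)[of "opp n i" j] by simp
      then show "Y $$ (opp n i, j) * v $ i * v $ j = Y $$ (opp n j, i) * v $ j * v $ i"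
        by simp
    qed (use D in auto)
    finally show "hbil n (Y *\<^sub>v v) v = 0" .
  qed
next
  assume *: "\<forall>v\<in>carrier_vec (2 * n). hbil n (Y *\<^sub>v v) v = 0"
  have u: "hbil n (Y *\<^sub>v unit_vec (2 * n) j) (unit_vec (2 * n) i) = Y $$ (opp n i, j)"
    if "i < 2 * n" "j < 2 * n" for i j
    using that by (simp add: hbil_unit_right mult_mat_unit_vec[OF Y] del: index_mult_mat_vec)
  have diag: "Y $$ (opp n i, i) = 0" if "i < 2 * n" for i
    using *[rule_format, of "unit_vec (2 * n) i"] u[of i i] that by simp
  have "Y $$ (opp n j, opp n i) = Y $$ (i, j)" if ij: "i < 2 * n" "j < 2 * n" for i j
  proof -
    let ?a = "unit_vec (2 * n) (opp n i) :: 'k vec" and ?b = "unit_vec (2 * n) j :: 'k vec"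
    have "0 = hbil n (Y *\<^sub>v (?a + ?b)) (?a + ?b)"
      using * by simp
    also have "\<dots> = Y $$ (i, j) + Y $$ (opp n j, opp n i)"
      using Y ij u[of "opp n i" "opp n i"] u[of j j] u[of "opp n i" j] u[of j "opp n i"] diag[of "opp n i"] diag[of j]
      by (simp add: mult_add_distrib_mat_vec[OF Y] hbil_add_left hbil_add_right)
    finally show ?thesis
      using eq_iff_add_eq_0[of "Y $$ (i, j)" "Y $$ (opp n j, opp n i)"] by simp
  qed
  then have "std_adj n Y = Y"
    using Y by (intro eq_matI) auto
  with Y diag show "Y \<in> std_lie n"
    by (simp add: std_lie_def)
qed

text \<open>
  The diagonal condition holds because the two summands contribute the same entry twice.
\<close>

lemma std_lie_add_adj:
  assumes "(W :: 'k mat) \<in> carrier_mat (2 * n) (2 * n)"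
  shows "W + std_adj n W \<in> std_lie n"
  using assms by (auto simp: std_lie_def std_adj_add comm_add_mat[of _ "2 * n" "2 * n"])

text \<open>
  This makes the pairing well defined: \<open>tr (Z W)\<close> depends only on \<open>W + W\<^sup>*\<close>.  The entries of \<open>Z\<close> are constant
  on the orbits of the adjoint involution and vanish at its fixed points, so \<open>sum_half\<close> collects
  the entries of \<open>W\<close> into those of \<open>W + W\<^sup>*\<close>.
\<close>

lemma tpair_half_add_adj:
  assumes Z: "(Z :: 'k mat) \<in> std_lie n" and W: "W \<in> carrier_mat (2 * n) (2 * n)"
  shows "tpair (2 * n) Z (std_half n (W + std_adj n W)) = tpair (2 * n) Z W"
proof -
  note D = std_lieD[OF Z]
  have "tpair (2 * n) Z (std_half n (W + std_adj n W))
    = tpair (2 * n) (std_half n (W + std_adj n W)) Z"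
    by (rule tpair_commute)
  also have "\<dots> = (\<Sum>i<2 * n. \<Sum>j<2 * n. if i < opp n j
      then W $$ (i, j) * Z $$ (j, i) + W $$ (opp n j, opp n i) * Z $$ (opp n i, opp n j) else 0)"
    unfolding tpair_def using W D(4) by (intro sum.cong) (auto simp: distrib_right)
  also have "\<dots> = tpair (2 * n) W Z"
    unfolding tpair_def using D by (intro sum_half) auto
  also have "\<dots> = tpair (2 * n) Z W"
    by (rule tpair_commute)
  finally show ?thesis .
qed

text \<open>
  Conjugation by an isometry commutes with taking adjoints.
\<close>

lemma conj_add_adj:
  assumes h: "hyp_frame n (hform n) h h'" and W: "(W :: 'k mat) \<in> carrier_mat (2 * n) (2 * n)"
  shows "h * (W + std_adj n W) * h' = h * W * h' + std_adj n (h * W * h')"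
proof -
  note H = hyp_frameD[OF h]
  have "std_adj n h' = h"
    using hyp_frame_inverse_eq[OF h] H by simp
  then have "std_adj n (h * W * h') = h * std_adj n W * h'"
    using H W hyp_frame_inverse_eq[OF h]
    by (simp add: std_adj_mult assoc_mult_mat[of _ "2*n" "2*n" _ "2*n" _ "2*n"])
  then show ?thesis
    using H W by (simp add: mult_add_distrib_mat[of _ "2*n" "2*n"] add_mult_distrib_mat[of _ "2*n" "2*n"])
qed

lemma std_lie_conj:
  assumes h: "hyp_frame n (hform n) h h'" and Y: "(Y :: 'k mat) \<in> std_lie n"
  shows "h * Y * h' \<in> std_lie n"
  using conj_add_adj[OF h std_half_carrier, of Y] std_lie_eq_half[OF Y, symmetric] std_lie_add_adj[of "h * std_half n Y * h'" n]
    hyp_frameD[OF h] by simp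

text \<open>
  Invariance of the pairing.  Conjugation does not commute with \<open>std_half\<close>, but \<open>h Y h'\<close> is still
  \<open>W + W\<^sup>*\<close> for the conjugate \<open>W\<close> of \<open>std_half n Y\<close>, and the choice of \<open>W\<close> does not matter.
\<close>

lemma tpair_half_conj:
  assumes h: "hyp_frame n (hform n) h h'" and Z: "(Z :: 'k mat) \<in> std_lie n" and Y: "Y \<in> std_lie n"
  shows "tpair (2 * n) Z (std_half n (h * Y * h')) = tpair (2 * n) (h' * Z * h) (std_half n Y)"
proof -
  note H = hyp_frameD[OF h]
  have "tpair (2 * n) Z (std_half n (h * Y * h')) = tpair (2 * n) Z (h * std_half n Y * h')"
    using conj_add_adj[OF h std_half_carrier, of Y] std_lie_eq_half[OF Y, symmetric]
      tpair_half_add_adj[OF Z, of "h * std_half n Y * h'"] H by simp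
  also have "\<dots> = tpair (2 * n) (h' * Z * h) (std_half n Y)"
    using H std_lieD[OF Z] by (intro tpair_conj[symmetric]) auto
  finally show ?thesis .
qed

text \<open>
  The elements that stabilise the flag spanned by \<open>e\<^sub>1, \<dots>, e\<^sub>n\<close>.  Only the first \<open>n\<close> columns are
  constrained; self-adjointness determines the remaining entries that have to vanish.
\<close>

definition std_borel :: "nat \<Rightarrow> 'k mat set" where
  "std_borel n = {Y \<in> std_lie n. \<forall>j<n. \<forall>i<2 * n. j < i \<longrightarrow> Y $$ (i, j) = 0}"

text \<open>
  The elements that map each step of the flag into the previous one.
\<close>

definition std_nilrad :: "nat \<Rightarrow> 'k mat set" where
  "std_nilrad n = {Y \<in> std_lie n. \<forall>j<n. \<forall>i<2 * n. j \<le> i \<longrightarrow> Y $$ (i, j) = 0}"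

lemma unit_mat_adj:
  assumes "i < 2 * n" "j < 2 * n"
  shows "std_adj n (unit_mat (2 * n) i j :: 'k mat) = unit_mat (2 * n) (opp n j) (opp n i)"
  using assms by (intro eq_matI) (auto simp: opp_eq_swap)

text \<open>
  These elements detect the entries that have to vanish in \<open>std_nilrad\<close>.
\<close>

lemma unit_mat_std_borel:
  assumes "j < n" "j \<le> i" "i < 2 * n"
  shows "unit_mat (2 * n) j i + std_adj n (unit_mat (2 * n) j i) \<in> std_borel n"
proof -
  let ?E = "unit_mat (2 * n) j i :: 'k mat"
  have "(?E + std_adj n ?E) $$ (k, l) = 0" if "l < n" "k < 2 * n" "l < k" for k l
    using assms that by (simp add: unit_mat_adj) (auto simp: opp_def)
  then show ?thesis by (simp add: std_borel_def std_lie_add_adj)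
qed

text \<open>
  The pairing couples root spaces of opposite weight and is nondegenerate on the diagonal torus, so the
  annihilator of the nonnegative part is the positive part.  In entries: no product
  \<open>Z $$ (i, j) * std_half n Y $$ (j, i)\<close> survives, and the elements of \<open>unit_mat_std_borel\<close> recover the
  entries of \<open>Z\<close>.
\<close>

lemma std_nilrad_eq_perp:
  assumes Z: "(Z :: 'k mat) \<in> std_lie n"
  shows "Z \<in> std_nilrad n \<longleftrightarrow> (\<forall>Y\<in>std_borel n. tpair (2 * n) Z (std_half n Y) = 0)"
proof (intro iffI ballI)
  fix Y :: "'k mat" assume XN: "Z \<in> std_nilrad n" and Y: "Y \<in> std_borel n"
  have "Z $$ (i, j) * std_half n Y $$ (j, i) = 0" if ij: "i < 2 * n" "j < 2 * n" for i j
  proof (cases "j < opp n i \<and> i < j")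
    case True
    then have "i < n" by (auto simp: opp_def split: if_splits)
    then show ?thesis using ij Y True by (simp add: std_borel_def)
  next
    case False
    show ?thesis
    proof (cases "j < opp n i")
      case True
      with False ij have "j < n \<and> j \<le> i" by (auto simp: opp_def split: if_splits)
      then show ?thesis using XN ij by (simp add: std_nilrad_def)
    qed (use ij in simp)
  qed
  then show "tpair (2 * n) Z (std_half n Y) = 0"
    unfolding tpair_def by (intro sum.neutral ballI) auto
next
  assume *: "\<forall>Y\<in>std_borel n. tpair (2 * n) Z (std_half n Y) = 0"
  have "Z $$ (i, j) = 0" if "j < n" "i < 2 * n" "j \<le> i" for i j
    using *[rule_format, OF unit_mat_std_borel, of j i] that
    by (simp add: tpair_half_add_adj[OF Z] tpair_unit_mat)
  with Z show "Z \<in> std_nilrad n" by (simp add: std_nilrad_def)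
qed

end

section \<open>Polynomial functions along curves\<close>

lemma poly_funs_sum:
  assumes "finite I" "\<And>i. i \<in> I \<Longrightarrow> f i \<in> poly_funs N"
  shows "(\<lambda>A. \<Sum>i\<in>I. f i A) \<in> poly_funs N"
  using assms by (induction I) (auto intro: poly_funs.intros)

lemma poly_funs_prod:
  assumes "finite I" "\<And>i. i \<in> I \<Longrightarrow> f i \<in> poly_funs N"
  shows "(\<lambda>A. \<Prod>i\<in>I. f i A) \<in> poly_funs N"
  using assms by (induction I) (auto intro: poly_funs.intros)

definition conj_entry :: "nat \<Rightarrow> 'k::semiring_0 mat \<Rightarrow> 'k mat \<Rightarrow> nat \<Rightarrow> nat \<Rightarrow> 'k mat \<Rightarrow> 'k" where
  "conj_entry N P P' i j A = (\<Sum>k<N. \<Sum>l<N. P $$ (i, k) * A $$ (k, l) * P' $$ (l, j))"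

lemma conj_entry:
  assumes "P \<in> carrier_mat N N" "P' \<in> carrier_mat N N" "A \<in> carrier_mat N N" "i < N" "j < N"
  shows "conj_entry N P P' i j A = (P * A * P') $$ (i, j)"
  using assms by (simp add: conj_entry_def scalar_prod_def lessThan_atLeast0 sum_distrib_left mult.assoc)

lemma conj_entry_poly_funs: "conj_entry N P P' i j \<in> poly_funs N"
proof -
  have "(\<lambda>A. \<Sum>k<N. \<Sum>l<N. P $$ (i, k) * A $$ (k, l) * P' $$ (l, j)) \<in> poly_funs N"
    by (intro poly_funs_sum poly_funs.mult poly_funs.const poly_funs.coord) auto
  then show ?thesis by (simp add: conj_entry_def[abs_def])
qed

text \<open>
  The first-order expansion \<open>a + b s\<close> at \<open>s = 0\<close> of a rational function whose only possible pole is
  \<open>s = -1\<close>; it is read off after clearing the denominator \<open>(1 + s)\<^sup>m\<close>.  Such denominators occur for the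
  torus, whose curves through 1 have entries \<open>1 + s\<close> and \<open>1 / (1 + s)\<close>.
\<close>

definition jet :: "('k::field \<Rightarrow> 'k) \<Rightarrow> 'k \<Rightarrow> 'k \<Rightarrow> bool" where
  "jet \<phi> a b \<longleftrightarrow> (\<exists>m p. (\<forall>s. 1 + s \<noteq> 0 \<longrightarrow> (1 + s) ^ m * \<phi> s = poly p s) \<and>
     coeff p 0 = a \<and> coeff p 1 = of_nat m * a + b)"

lemma coeff_mult_1:
  fixes p q :: "'k::comm_semiring_0 poly"
  shows "coeff (p * q) 1 = coeff p 0 * coeff q 1 + coeff p 1 * coeff q 0"
  by (simp add: coeff_mult)

lemma coeff_linear_power:
  fixes m :: nat
  shows "coeff ([:1, 1:] ^ m :: 'k::comm_ring_1 poly) 0 = 1"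
    "coeff ([:1, 1:] ^ m :: 'k::comm_ring_1 poly) 1 = of_nat m"
proof -
  show *: "coeff ([:1, 1:] ^ m :: 'k poly) 0 = 1" for m
    by (induction m) (auto simp: coeff_mult)
  show "coeff ([:1, 1:] ^ m :: 'k poly) 1 = of_nat m"
    using * by (induction m) (auto simp: coeff_mult_1 coeff_mult simp del: One_nat_def, simp)
qed

lemma jet_poly: "jet (poly p) (coeff p 0) (coeff p 1)"
  unfolding jet_def by (rule exI[of _ 0], rule exI[of _ p]) simp

lemma jet_const: "jet (\<lambda>_. c) c 0"
proof -
  have "poly [:c:] = (\<lambda>_. c)" by auto
  with jet_poly[of "[:c:]"] show ?thesis by simp
qed

lemma jet_add:
  assumes "jet \<phi> a b" "jet \<psi> a' b'"
  shows "jet (\<lambda>s. \<phi> s + \<psi> s) (a + a') (b + b')"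
proof -
  from assms(1) obtain m p where p: "\<And>s. 1 + s \<noteq> 0 \<Longrightarrow> (1 + s) ^ m * \<phi> s = poly p s"
    "coeff p 0 = a" "coeff p 1 = of_nat m * a + b" unfolding jet_def by blast
  from assms(2) obtain m' p' where p': "\<And>s. 1 + s \<noteq> 0 \<Longrightarrow> (1 + s) ^ m' * \<psi> s = poly p' s"
    "coeff p' 0 = a'" "coeff p' 1 = of_nat m' * a' + b'" unfolding jet_def by blast
  let ?q = "[:1, 1:] ^ m' * p + [:1, 1:] ^ m * p'"
  have "(1 + s) ^ (m + m') * (\<phi> s + \<psi> s) = poly ?q s" if "1 + s \<noteq> 0" for s
    using p(1)[OF that, symmetric] p'(1)[OF that, symmetric]
    by (simp add: power_add algebra_simps)
  moreover have "coeff ?q 0 = a + a'"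
    by (simp add: coeff_mult coeff_linear_power p p')
  moreover have "coeff ?q 1 = of_nat (m + m') * (a + a') + (b + b')"
    unfolding coeff_add coeff_mult_1 coeff_linear_power p p' by (simp add: algebra_simps)
  ultimately show ?thesis unfolding jet_def by blast
qed

lemma jet_mult:
  assumes "jet \<phi> a b" "jet \<psi> a' b'"
  shows "jet (\<lambda>s. \<phi> s * \<psi> s) (a * a') (a * b' + b * a')"
proof -
  from assms(1) obtain m p where p: "\<And>s. 1 + s \<noteq> 0 \<Longrightarrow> (1 + s) ^ m * \<phi> s = poly p s"
    "coeff p 0 = a" "coeff p 1 = of_nat m * a + b" unfolding jet_def by blast
  from assms(2) obtain m' p' where p': "\<And>s. 1 + s \<noteq> 0 \<Longrightarrow> (1 + s) ^ m' * \<psi> s = poly p' s"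
    "coeff p' 0 = a'" "coeff p' 1 = of_nat m' * a' + b'" unfolding jet_def by blast
  have "(1 + s) ^ (m + m') * (\<phi> s * \<psi> s) = poly (p * p') s" if "1 + s \<noteq> 0" for s
    using p(1)[OF that, symmetric] p'(1)[OF that, symmetric]
    by (simp add: power_add algebra_simps)
  moreover have "coeff (p * p') 0 = a * a'"
    by (simp add: coeff_mult p p')
  moreover have "coeff (p * p') 1 = of_nat (m + m') * (a * a') + (a * b' + b * a')"
    unfolding coeff_mult_1 p p' by (simp add: algebra_simps)
  ultimately show ?thesis unfolding jet_def by blast
qed

lemma jet_cmult: "jet \<phi> a b \<Longrightarrow> jet (\<lambda>s. c * \<phi> s) (c * a) (c * b)"
  using jet_mult[OF jet_const[of c]] by simp

lemma jet_sum:
  assumes "finite I" "\<And>i. i \<in> I \<Longrightarrow> jet (\<phi> i) (a i) (b i)"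
  shows "jet (\<lambda>s. \<Sum>i\<in>I. \<phi> i s) (\<Sum>i\<in>I. a i) (\<Sum>i\<in>I. b i)"
  using assms by (induction I) (auto intro: jet_add jet_const)

lemma jet_affine: "jet (\<lambda>s. a + s * b) a b"
proof -
  have "poly [:a, b:] = (\<lambda>s. a + s * b)" by auto
  with jet_poly[of "[:a, b:]"] show ?thesis by simp
qed

lemma jet_inverse: "jet (\<lambda>s. inverse (1 + s)) 1 (- 1)"
  unfolding jet_def by (rule exI[of _ 1], rule exI[of _ 1]) simp

lemma poly_eqI_infinite:
  fixes p q :: "'k::field poly"
  assumes "infinite (UNIV :: 'k set)" "finite S" "\<And>s. s \<notin> S \<Longrightarrow> poly p s = poly q s"
  shows "p = q"
proof (rule ccontr)
  assume "p \<noteq> q"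
  then have "finite {s. poly (p - q) s = 0}" by (intro poly_roots_finite) simp
  moreover have "UNIV \<subseteq> {s. poly (p - q) s = 0} \<union> S" using assms(3) by auto
  ultimately show False using assms(1,2) finite_subset by blast
qed

lemma jet_unique:
  fixes a b :: "'k::field"
  assumes inf: "infinite (UNIV :: 'k set)"
    and "jet \<phi> a b" "jet \<psi> a' b'" and eq: "\<And>s. 1 + s \<noteq> 0 \<Longrightarrow> \<phi> s = \<psi> s"
  shows "b = b'"
proof -
  from assms(2) obtain m p where p: "\<And>s. 1 + s \<noteq> 0 \<Longrightarrow> (1 + s) ^ m * \<phi> s = poly p s"
    "coeff p 0 = a" "coeff p 1 = of_nat m * a + b" unfolding jet_def by blast
  from assms(3) obtain m' p' where p': "\<And>s. 1 + s \<noteq> 0 \<Longrightarrow> (1 + s) ^ m' * \<psi> s = poly p' s"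
    "coeff p' 0 = a'" "coeff p' 1 = of_nat m' * a' + b'" unfolding jet_def by blast
  have *: "[:1, 1:] ^ m' * p = [:1, 1:] ^ m * p'"
  proof (rule poly_eqI_infinite[OF inf, of "{- 1}"])
    fix s :: 'k assume "s \<notin> {- 1}"
    then have "1 + s \<noteq> 0" by (simp add: add_eq_0_iff)
    from p(1)[OF this, symmetric] p'(1)[OF this, symmetric] eq[OF this]
    show "poly ([:1, 1:] ^ m' * p) s = poly ([:1, 1:] ^ m * p') s" by simp
  qed simp
  have a: "a = a'"
    using arg_cong[OF *, of "\<lambda>p. coeff p 0"] by (simp add: coeff_mult coeff_linear_power p p')
  show ?thesis
    using arg_cong[OF *, of "\<lambda>p. coeff p 1"] a
    unfolding coeff_mult_1 coeff_linear_power p p' by (simp add: algebra_simps)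
qed

text \<open>
  The chain rule: the matrix \<open>c\<close> is the differential at the identity of the function \<open>f\<close>, written in
  the coordinates given by \<open>P\<close>, and it does not depend on the curve \<open>M\<close>.
\<close>

lemma poly_fun_jet:
  assumes "f \<in> poly_funs N" "P \<in> carrier_mat N N" "P' \<in> carrier_mat N N"
  shows "\<exists>c. \<forall>M D. (\<forall>s. M s \<in> carrier_mat N N) \<and>
     (\<forall>i<N. \<forall>j<N. jet (\<lambda>s. M s $$ (i, j)) (1\<^sub>m N $$ (i, j)) (D i j)) \<longrightarrow>
     jet (\<lambda>s. f (P * M s * P')) (f (P * 1\<^sub>m N * P')) (\<Sum>i<N. \<Sum>j<N. c i j * D i j)"
  using assms(1)
proof induction
  case (const c)
  show ?case by (rule exI[of _ "\<lambda>_ _. 0"]) (auto intro: jet_const)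
next
  case (coord i j)
  show ?case
  proof (intro exI allI impI, elim conjE)
    fix M :: "'a \<Rightarrow> 'a mat" and D :: "nat \<Rightarrow> nat \<Rightarrow> 'a" assume M: "\<forall>s. M s \<in> carrier_mat N N"
      and J: "\<forall>i<N. \<forall>j<N. jet (\<lambda>s. M s $$ (i, j)) (1\<^sub>m N $$ (i, j)) (D i j)"
    have "jet (\<lambda>s. \<Sum>k<N. \<Sum>l<N. (P $$ (i, k) * P' $$ (l, j)) * M s $$ (k, l))
        (\<Sum>k<N. \<Sum>l<N. (P $$ (i, k) * P' $$ (l, j)) * 1\<^sub>m N $$ (k, l))
        (\<Sum>k<N. \<Sum>l<N. (P $$ (i, k) * P' $$ (l, j)) * D k l)"
      using J by (intro jet_sum jet_cmult) auto
    moreover have "(P * A * P') $$ (i, j) = (\<Sum>k<N. \<Sum>l<N. (P $$ (i, k) * P' $$ (l, j)) * A $$ (k, l))"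
      if "A \<in> carrier_mat N N" for A
      using conj_entry[OF assms(2,3) that coord] by (simp add: conj_entry_def mult_ac)
    ultimately show "jet (\<lambda>s. (P * M s * P') $$ (i, j)) ((P * 1\<^sub>m N * P') $$ (i, j))
        (\<Sum>k<N. \<Sum>l<N. (P $$ (i, k) * P' $$ (l, j)) * D k l)"
      using M by simp
  qed
next
  case (add f h)
  from add.IH(1) obtain c where c: "\<And>M D. (\<forall>s. M s \<in> carrier_mat N N) \<Longrightarrow>
     (\<forall>i<N. \<forall>j<N. jet (\<lambda>s. M s $$ (i, j)) (1\<^sub>m N $$ (i, j)) (D i j)) \<Longrightarrow>
     jet (\<lambda>s. f (P * M s * P')) (f (P * 1\<^sub>m N * P')) (\<Sum>i<N. \<Sum>j<N. c i j * D i j)" by blast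
  from add.IH(2) obtain d where d: "\<And>M D. (\<forall>s. M s \<in> carrier_mat N N) \<Longrightarrow>
     (\<forall>i<N. \<forall>j<N. jet (\<lambda>s. M s $$ (i, j)) (1\<^sub>m N $$ (i, j)) (D i j)) \<Longrightarrow>
     jet (\<lambda>s. h (P * M s * P')) (h (P * 1\<^sub>m N * P')) (\<Sum>i<N. \<Sum>j<N. d i j * D i j)" by blast
  show ?case
  proof (rule exI[of _ "\<lambda>i j. c i j + d i j"], intro allI impI, elim conjE)
    fix M :: "'a \<Rightarrow> 'a mat" and D :: "nat \<Rightarrow> nat \<Rightarrow> 'a" assume M: "\<forall>s. M s \<in> carrier_mat N N"
      and J: "\<forall>i<N. \<forall>j<N. jet (\<lambda>s. M s $$ (i, j)) (1\<^sub>m N $$ (i, j)) (D i j)"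
    show "jet (\<lambda>s. f (P * M s * P') + h (P * M s * P')) (f (P * 1\<^sub>m N * P') + h (P * 1\<^sub>m N * P'))
        (\<Sum>i<N. \<Sum>j<N. (c i j + d i j) * D i j)"
      using jet_add[OF c[OF M J] d[OF M J]] by (simp add: sum.distrib distrib_right)
  qed
next
  case (mult f h)
  from mult.IH(1) obtain c where c: "\<And>M D. (\<forall>s. M s \<in> carrier_mat N N) \<Longrightarrow>
     (\<forall>i<N. \<forall>j<N. jet (\<lambda>s. M s $$ (i, j)) (1\<^sub>m N $$ (i, j)) (D i j)) \<Longrightarrow>
     jet (\<lambda>s. f (P * M s * P')) (f (P * 1\<^sub>m N * P')) (\<Sum>i<N. \<Sum>j<N. c i j * D i j)" by blast
  from mult.IH(2) obtain d where d: "\<And>M D. (\<forall>s. M s \<in> carrier_mat N N) \<Longrightarrow>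
     (\<forall>i<N. \<forall>j<N. jet (\<lambda>s. M s $$ (i, j)) (1\<^sub>m N $$ (i, j)) (D i j)) \<Longrightarrow>
     jet (\<lambda>s. h (P * M s * P')) (h (P * 1\<^sub>m N * P')) (\<Sum>i<N. \<Sum>j<N. d i j * D i j)" by blast
  let ?a = "f (P * 1\<^sub>m N * P')" and ?b = "h (P * 1\<^sub>m N * P')"
  show ?case
  proof (rule exI[of _ "\<lambda>i j. ?a * d i j + c i j * ?b"], intro allI impI, elim conjE)
    fix M :: "'a \<Rightarrow> 'a mat" and D :: "nat \<Rightarrow> nat \<Rightarrow> 'a" assume M: "\<forall>s. M s \<in> carrier_mat N N"
      and J: "\<forall>i<N. \<forall>j<N. jet (\<lambda>s. M s $$ (i, j)) (1\<^sub>m N $$ (i, j)) (D i j)"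
    have "(\<Sum>i<N. \<Sum>j<N. (?a * d i j + c i j * ?b) * D i j)
        = ?a * (\<Sum>i<N. \<Sum>j<N. d i j * D i j) + (\<Sum>i<N. \<Sum>j<N. c i j * D i j) * ?b"
      by (simp add: sum.distrib[symmetric] sum_distrib_left sum_distrib_right algebra_simps)
    then show "jet (\<lambda>s. f (P * M s * P') * h (P * M s * P')) (?a * ?b)
        (\<Sum>i<N. \<Sum>j<N. (?a * d i j + c i j * ?b) * D i j)"
      using jet_mult[OF c[OF M J] d[OF M J]] by simp
  qed
qed

section \<open>The Lie algebra of a Borel subgroup\<close>

text \<open>
  Otherwise adding 1 to the product of all \<open>x - a\<close> would give a polynomial without roots.
\<close>

lemma infinite_UNIV_alg_closed: "infinite (UNIV :: 'k::alg_closed_field set)"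
proof
  assume fin: "finite (UNIV :: 'k set)"
  let ?p = "(\<Prod>a\<in>UNIV. [:- a, 1:]) + 1 :: 'k poly"
  have "degree (\<Prod>a\<in>(UNIV :: 'k set). [:- a, 1:]) = (\<Sum>a\<in>(UNIV :: 'k set). 1)"
    by (subst degree_prod_eq_sum_degree) auto
  also have "\<dots> > 0" using fin by (simp add: finite_UNIV_card_ge_0)
  finally have "degree ?p > 0" by (simp add: degree_add_eq_left)
  then obtain x where "poly ?p x = 0" using alg_closed_imp_poly_has_root by blast
  moreover have "poly ?p x = 1"
    using fin by (simp add: poly_prod)
  ultimately show False by simp
qed

context char_two
begin

text \<open>
  The condition \<open>\<beta>(x v, v) = 0\<close> in hyperbolic coordinates is \<open>std_lie_iff\<close>.
\<close>

lemma orthogonal_lie_iff: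
  assumes P: "hyp_frame n \<alpha> (P :: 'k mat) P'"
  shows "x \<in> orthogonal_lie n \<alpha> \<longleftrightarrow> (\<exists>Y\<in>std_lie n. x = P * Y * P')"
proof -
  note PD = hyp_frameD[OF P]
  have conv: "P * Y * P' \<in> orthogonal_lie n \<alpha> \<longleftrightarrow> Y \<in> std_lie n" if Y: "Y \<in> carrier_mat (2 * n) (2 * n)" for Y
  proof -
    have *: "polar_form \<alpha> ((P * Y * P') *\<^sub>v (P *\<^sub>v v)) (P *\<^sub>v v) = hbil n (Y *\<^sub>v v) v"
      if "v \<in> carrier_vec (2 * n)" for v
      using PD Y that hyp_frame_polar[OF P, of "Y *\<^sub>v v" v]
      by (simp add: assoc_mult_mat_vec[of _ "2*n" "2*n" _ "2*n"] mult_vec_cancel_left[of _ "2*n"])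
    have "(\<forall>v\<in>carrier_vec (2 * n). polar_form \<alpha> ((P * Y * P') *\<^sub>v v) v = 0)
        \<longleftrightarrow> (\<forall>v\<in>carrier_vec (2 * n). hbil n (Y *\<^sub>v v) v = 0)" (is "?l \<longleftrightarrow> ?r")
    proof
      assume ?l
      then show ?r using * PD by (metis mult_mat_vec_carrier)
    next
      assume r: ?r
      show ?l
      proof
        fix v :: "'k vec" assume v: "v \<in> carrier_vec (2 * n)"
        then have "v = P *\<^sub>v (P' *\<^sub>v v)" using PD by (simp add: mult_vec_cancel_left[of _ "2*n"])
        then show "polar_form \<alpha> ((P * Y * P') *\<^sub>v v) v = 0"
          using *[of "P' *\<^sub>v v"] r PD v by (metis mult_mat_vec_carrier)
      qed
    qed
    then show ?thesis
      using PD Y by (simp add: orthogonal_lie_def std_lie_iff)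
  qed
  show ?thesis
  proof
    assume x: "x \<in> orthogonal_lie n \<alpha>"
    then have "x \<in> carrier_mat (2 * n) (2 * n)" by (simp add: orthogonal_lie_def)
    then have "P * (P' * x * P) * P' = x" "P' * x * P \<in> carrier_mat (2 * n) (2 * n)"
      using PD by (auto simp: assoc_mult_mat[of _ "2*n" "2*n" _ "2*n" _ "2*n"] mult_cancel_left[of _ "2*n"])
    then show "\<exists>Y\<in>std_lie n. x = P * Y * P'"
      using conv[of "P' * x * P"] x by metis
  next
    assume "\<exists>Y\<in>std_lie n. x = P * Y * P'"
    then show "x \<in> orthogonal_lie n \<alpha>" using conv std_lieD(1) by blast
  qed
qed

text \<open>
  Root subgroups: \<open>E\<^sup>2 = 0\<close> and all values of \<open>E\<close> are singular, so \<open>1 + t E\<close> is an involution that preserves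
  the quadratic form for every \<open>t\<close>.
\<close>

lemma root_frame:
  fixes t :: 'k
  assumes ij: "i < 2 * n" "j < 2 * n" "i \<noteq> j" "i \<noteq> opp n j"
  defines "E \<equiv> unit_mat (2 * n) i j + std_adj n (unit_mat (2 * n) i j)"
  shows "hyp_frame n (hform n) (1\<^sub>m (2 * n) + t \<cdot>\<^sub>m E) (1\<^sub>m (2 * n) + t \<cdot>\<^sub>m E)"
proof -
  let ?N = "2 * n"
  let ?h = "1\<^sub>m ?N + t \<cdot>\<^sub>m E"
  have E: "E \<in> std_lie n" "E \<in> carrier_mat ?N ?N"
    unfolding E_def by (auto intro: std_lie_add_adj)
  have oij: "opp n i \<noteq> j" using ij by (metis opp_opp)
  have Ev: "E *\<^sub>v v = v $ j \<cdot>\<^sub>v unit_vec ?N i + v $ (opp n i) \<cdot>\<^sub>v unit_vec ?N (opp n j)"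
    if "v \<in> carrier_vec ?N" for v
    using that ij by (simp add: E_def unit_mat_adj unit_mat_mult_vec add_mult_distrib_mat_vec[of _ ?N ?N])
  have EE: "E *\<^sub>v (E *\<^sub>v v) = 0\<^sub>v ?N" if "v \<in> carrier_vec ?N" for v
  proof -
    have "(E *\<^sub>v v) $ j = 0" "(E *\<^sub>v v) $ opp n i = 0"
      using that ij oij by (auto simp: Ev unit_vec_index)
    then show ?thesis using that E ij by (subst Ev) (auto intro!: eq_vecI)
  qed
  have hv: "?h *\<^sub>v v = v + t \<cdot>\<^sub>v (E *\<^sub>v v)" if "v \<in> carrier_vec ?N" for v
    using that E by (simp add: add_mult_distrib_mat_vec[of _ ?N ?N] smult_mat_mult_vec[of _ ?N])
  have hh: "?h * ?h = 1\<^sub>m ?N"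
  proof (rule mat_eqI_mult_vec)
    fix v :: "'k vec" assume v: "v \<in> carrier_vec ?N"
    have "(?h * ?h) *\<^sub>v v = v + t \<cdot>\<^sub>v (E *\<^sub>v v) + t \<cdot>\<^sub>v (E *\<^sub>v (v + t \<cdot>\<^sub>v (E *\<^sub>v v)))"
      using v E by (simp add: assoc_mult_mat_vec[of _ ?N ?N _ ?N] hv)
    also have "E *\<^sub>v (v + t \<cdot>\<^sub>v (E *\<^sub>v v)) = E *\<^sub>v v + t \<cdot>\<^sub>v (E *\<^sub>v (E *\<^sub>v v))"
      using v E by (simp add: mult_add_distrib_mat_vec[of _ ?N ?N] mult_mat_vec[of _ ?N ?N])
    also have "v + t \<cdot>\<^sub>v (E *\<^sub>v v) + t \<cdot>\<^sub>v (E *\<^sub>v v + t \<cdot>\<^sub>v (E *\<^sub>v (E *\<^sub>v v))) = v"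
      using v E by (intro eq_vecI) (auto simp: EE add.assoc simp del: index_mult_mat_vec)
    finally show "(?h * ?h) *\<^sub>v v = 1\<^sub>m ?N *\<^sub>v v" using v by simp
  qed (use E in auto)
  have "hform n (?h *\<^sub>v v) = hform n v" if v: "v \<in> carrier_vec ?N" for v
  proof -
    have "hform n (E *\<^sub>v v) = 0"
      using v ij by (simp add: Ev hform_add hform_smult hform_unit hbil_smult_left hbil_smult_right
          hbil_unit_right unit_vec_index)
    moreover have "hbil n (E *\<^sub>v v) v = 0"
      using std_lie_iff[OF E(2)] E(1) v by blast
    then have "hbil n v (E *\<^sub>v v) = 0" by (simp add: hbil_commute)
    ultimately show ?thesis
      using v E by (simp add: hv hform_add hform_smult hbil_smult_right)
  qed
  then show ?thesis using hh E by (simp add: hyp_frame_def)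
qed

end

locale char_two_closed = char_two type_of_scalars
  for type_of_scalars :: "'k::alg_closed_field itself"
begin

text \<open>
  Differentiate equations that hold on the Borel subgroup: the vanishing of the entries below the
  diagonal in the first \<open>n\<close> columns, and \<open>\<alpha>(g w) = \<alpha>(w)\<close>, whose derivative at 1 is \<open>\<beta>(A w, w) = 0\<close>.
\<close>

lemma lie_algebra_of_borel_subset:
  assumes P: "hyp_frame n \<alpha> (P :: 'k mat) P'" and A: "A \<in> lie_algebra_of (2 * n) (borel_subgroup n \<alpha> P)"
  shows "\<exists>Y\<in>std_borel n. A = P * Y * P'"
proof -
  let ?N = "2 * n"
  note PD = hyp_frameD[OF P]
  from A have Ac: "A \<in> carrier_mat ?N ?N" by (simp add: lie_algebra_of_def)
  have tangent: "coeff p 1 = 0" if "f \<in> poly_funs ?N" "\<And>g. g \<in> borel_subgroup n \<alpha> P \<Longrightarrow> f g = 0"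
    "\<And>t. f (1\<^sub>m ?N + t \<cdot>\<^sub>m A) = poly p t" for f p
    using A that unfolding lie_algebra_of_def by blast
  define Y where "Y = P' * A * P"
  have Y: "Y \<in> carrier_mat ?N ?N" "A = P * Y * P'"
    using PD Ac by (auto simp: Y_def assoc_mult_mat[of _ ?N ?N _ ?N _ ?N] mult_cancel_left[of _ ?N])
  have line: "P' * (1\<^sub>m ?N + t \<cdot>\<^sub>m A) * P = 1\<^sub>m ?N + t \<cdot>\<^sub>m Y" for t
    using PD Ac by (simp add: Y_def mult_add_distrib_mat[of _ ?N ?N _ ?N] add_mult_distrib_mat[of _ ?N ?N _ _ ?N]
        mult_smult_distrib[of _ ?N ?N _ ?N] mult_smult_assoc_mat[of _ ?N ?N _ ?N])
  have borelD: "\<exists>h h'. hyp_frame n (hform n) h h' \<and> g = P * h * P' \<and> P' * g * P = h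
      \<and> (\<forall>j<n. \<forall>i<?N. j < i \<longrightarrow> h $$ (i, j) = 0)" if g: "g \<in> borel_subgroup n \<alpha> P" for g
  proof -
    from g have "g \<in> carrier (orthogonal_group n \<alpha>)" by (simp add: borel_subgroup_def)
    then obtain h h' where h: "hyp_frame n (hform n) h h'" "g = P * h * P'"
      using orthogonal_group_carrier_iff[OF P] by blast
    have "P' * g * P = h"
      using PD hyp_frameD[OF h(1)] by (simp add: h(2) assoc_mult_mat[of _ ?N ?N _ ?N _ ?N] mult_cancel_left[of _ ?N])
    moreover have "\<forall>j<n. \<forall>i<?N. j < i \<longrightarrow> h $$ (i, j) = 0"
      using borel_subgroup_iff[OF P h(1)] g h(2) by simp
    ultimately show ?thesis using h by (intro exI[of _ h] exI[of _ h']) simp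
  qed
  have upper: "Y $$ (i, j) = 0" if ij: "j < n" "i < ?N" "j < i" for i j
  proof -
    have "coeff [:0, Y $$ (i, j):] 1 = 0"
    proof (rule tangent[OF conj_entry_poly_funs[of ?N P' P i j]])
      fix g assume "g \<in> borel_subgroup n \<alpha> P"
      then obtain h h' where h: "hyp_frame n (hform n) h h'" "g = P * h * P'" "P' * g * P = h"
        "\<forall>j<n. \<forall>i<?N. j < i \<longrightarrow> h $$ (i, j) = 0" using borelD by metis
      then show "conj_entry ?N P' P i j g = 0"
        using ij PD hyp_frameD[OF h(1)] by (subst conj_entry) auto
    next
      fix t show "conj_entry ?N P' P i j (1\<^sub>m ?N + t \<cdot>\<^sub>m A) = poly [:0, Y $$ (i, j):] t"
        using ij PD Ac Y(1) conj_entry[of P' ?N P "1\<^sub>m ?N + t \<cdot>\<^sub>m A" i j] by (simp only: line) simp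
    qed
    then show ?thesis by simp
  qed
  have "hbil n (Y *\<^sub>v w) w = 0" if w: "w \<in> carrier_vec ?N" for w
  proof -
    let ?c = "\<lambda>i A. \<Sum>l<?N. conj_entry ?N P' P i l A * w $ l"
    let ?f = "\<lambda>A. (\<Sum>i<n. ?c i A * ?c (n + i) A) + hform n w"
    have c: "?c i B = ((P' * B * P) *\<^sub>v w) $ i" if "B \<in> carrier_mat ?N ?N" "i < ?N" for i B
    proof -
      have "?c i B = (\<Sum>l<?N. (P' * B * P) $$ (i, l) * w $ l)"
        using that PD by (intro sum.cong) (auto simp: conj_entry simp del: index_mult_mat)
      also have "\<dots> = ((P' * B * P) *\<^sub>v w) $ i"
        using that PD w by (simp add: scalar_prod_def[of _ w] lessThan_atLeast0 del: index_mult_mat(1))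
      finally show ?thesis .
    qed
    have f: "?f B = hform n ((P' * B * P) *\<^sub>v w) + hform n w" if "B \<in> carrier_mat ?N ?N" for B
      unfolding hform_def using that by (simp add: c)
    have "coeff [:0, hbil n (Y *\<^sub>v w) w, hform n (Y *\<^sub>v w):] 1 = 0"
    proof (rule tangent[of ?f])
      show "?f \<in> poly_funs ?N"
        by (intro poly_funs.add poly_funs_sum poly_funs.mult poly_funs.const conj_entry_poly_funs) auto
    next
      fix g assume "g \<in> borel_subgroup n \<alpha> P"
      then obtain h h' where h: "hyp_frame n (hform n) h h'" "g = P * h * P'" "P' * g * P = h"
        using borelD by metis
      have "g \<in> carrier_mat ?N ?N" using h(2) PD hyp_frameD[OF h(1)] by simp
      from f[OF this] show "?f g = 0"
        using h(3) hyp_frameD(5)[OF h(1) w] by simp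
    next
      fix t
      have "(1\<^sub>m ?N + t \<cdot>\<^sub>m Y) *\<^sub>v w = w + t \<cdot>\<^sub>v (Y *\<^sub>v w)"
        using w Y by (simp add: add_mult_distrib_mat_vec[of _ ?N ?N] smult_mat_mult_vec[of _ ?N])
      then have "?f (1\<^sub>m ?N + t \<cdot>\<^sub>m A) = hform n (w + t \<cdot>\<^sub>v (Y *\<^sub>v w)) + hform n w"
        using f[of "1\<^sub>m ?N + t \<cdot>\<^sub>m A"] Ac by (simp add: line)
      also have "\<dots> = t\<^sup>2 * hform n (Y *\<^sub>v w) + t * hbil n (Y *\<^sub>v w) w"
      proof -
        have "hform n (w + t \<cdot>\<^sub>v (Y *\<^sub>v w)) = hform n w + (t\<^sup>2 * hform n (Y *\<^sub>v w) + t * hbil n (Y *\<^sub>v w) w)"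
          using w Y(1) by (simp add: hform_add hform_smult hbil_smult_right hbil_commute[of n w "Y *\<^sub>v w"])
        then show ?thesis by (simp only: add_self_both)
      qed
      finally show "?f (1\<^sub>m ?N + t \<cdot>\<^sub>m A) = poly [:0, hbil n (Y *\<^sub>v w) w, hform n (Y *\<^sub>v w):] t"
        by (simp add: power2_eq_square algebra_simps)
    qed
    then show ?thesis by simp
  qed
  then have "Y \<in> std_lie n" using std_lie_iff[OF Y(1)] by blast
  with upper Y(2) show ?thesis by (auto simp: std_borel_def)
qed

end

context char_two_closed
begin

text \<open>
  The first assumption says that the linear form with coefficients \<open>c\<close> vanishes on the tangent vectors of
  all curves through 1 in the Borel subgroup.  It is applied to the root subgroups and, for \<open>i = j\<close>, to
  the one-dimensional tori; their tangent vectors \<open>E + E\<^sup>*\<close> span \<open>std_borel n\<close>.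
\<close>

lemma borel_curves_tangent:
  assumes vanish: "\<And>M D. (\<forall>s. M s \<in> carrier_mat (2 * n) (2 * n)) \<Longrightarrow>
      (\<forall>s. 1 + s \<noteq> 0 \<longrightarrow> (\<exists>h'. hyp_frame n (hform n) (M s) h') \<and>
        (\<forall>j<n. \<forall>i<2 * n. j < i \<longrightarrow> M s $$ (i, j) = 0)) \<Longrightarrow>
      (\<forall>i<2 * n. \<forall>j<2 * n. jet (\<lambda>s. M s $$ (i, j)) (1\<^sub>m (2 * n) $$ (i, j)) (D i j)) \<Longrightarrow>
      (\<Sum>i<2 * n. \<Sum>j<2 * n. c i j * D i j) = 0"
    and ij: "i < 2 * n" "j < 2 * n" "i < opp n j" "\<not> (j < n \<and> j < i)"
  shows "c i j + c (opp n j) (opp n i) = (0 :: 'k)"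
proof -
  let ?N = "2 * n"
  let ?E = "unit_mat ?N i j + std_adj n (unit_mat ?N i j) :: 'k mat"
  have dbl: "(\<Sum>k<?N. \<Sum>l<?N. c k l * (if k = a \<and> l = b then 1 else 0)) = c a b" if "a < ?N" "b < ?N" for a b
  proof -
    have "(\<Sum>k<?N. \<Sum>l<?N. c k l * (if k = a \<and> l = b then 1 else 0))
      = (\<Sum>k<?N. if k = a then \<Sum>l<?N. if l = b then c k l else 0 else 0)"
      by (rule sum.cong[OF refl]) (auto simp: if_distrib cong: if_cong)
    also have "\<dots> = c a b" using that by simp
    finally show ?thesis .
  qed
  have E: "(\<Sum>k<?N. \<Sum>l<?N. c k l * ?E $$ (k, l)) = c i j + c (opp n j) (opp n i)"
  proof -
    have "(\<Sum>k<?N. \<Sum>l<?N. c k l * ?E $$ (k, l))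
      = (\<Sum>k<?N. \<Sum>l<?N. c k l * (if k = i \<and> l = j then 1 else 0))
        + (\<Sum>k<?N. \<Sum>l<?N. c k l * (if k = opp n j \<and> l = opp n i then 1 else 0))"
      using ij by (simp add: unit_mat_adj distrib_left sum.distrib)
    then show ?thesis using dbl[of i j] dbl[of "opp n j" "opp n i"] ij by simp
  qed
  show ?thesis
  proof (cases "i = j")
    case False
    let ?M = "\<lambda>s. 1\<^sub>m ?N + s \<cdot>\<^sub>m ?E"
    have ne: "i \<noteq> opp n j" using ij by simp
    have "(\<Sum>k<?N. \<Sum>l<?N. c k l * ?E $$ (k, l)) = 0"
    proof (rule vanish[of ?M], goal_cases)
      case 1 show ?case by simp
    next
      case 2
      have "?M s $$ (k, l) = 0" if "l < n" "k < ?N" "l < k" for s k l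
        using that ij by (simp add: unit_mat_adj) (auto simp: opp_def split: if_splits)
      then show ?case using root_frame[OF ij(1,2) False ne] by blast
    next
      case 3
      show ?case
      proof (intro allI impI)
        fix k l assume kl: "k < ?N" "l < ?N"
        then have "(\<lambda>s. ?M s $$ (k, l)) = (\<lambda>s. 1\<^sub>m ?N $$ (k, l) + s * ?E $$ (k, l))"
          by auto
        then show "jet (\<lambda>s. ?M s $$ (k, l)) (1\<^sub>m ?N $$ (k, l)) (?E $$ (k, l))"
          by (simp only: jet_affine)
      qed
    qed
    then show ?thesis using E by simp
  next
    case True
    with ij have i: "i < n" by (auto simp: opp_def split: if_splits)
    let ?d = "\<lambda>s k. if k = i then 1 + s else if k = opp n i then inverse (1 + s) else (1 :: 'k)"
    let ?M = "\<lambda>s. mat_diag ?N (?d s)"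
    have "(\<Sum>k<?N. \<Sum>l<?N. c k l * ?E $$ (k, l)) = 0"
    proof (rule vanish[of ?M], goal_cases)
      case 1 show ?case by simp
    next
      case 2
      have "hyp_frame n (hform n) (?M s) (mat_diag ?N (\<lambda>k. ?d s (opp n k)))" if "1 + s \<noteq> 0" for s
        using that ij by (intro mat_diag_frame) (auto simp: opp_eq_swap)
      moreover have "?M s $$ (k, l) = 0" if "l < n" "k < ?N" "l < k" for s k l
        using that by (simp add: mat_diag_def)
      ultimately show ?case by blast
    next
      case 3
      show ?case
      proof (intro allI impI)
        fix k l assume kl: "k < ?N" "l < ?N"
        have inv: "jet (\<lambda>s. inverse (1 + s)) 1 (1 :: 'k)" using jet_inverse[where ?'a = 'k] by simp
        have lin: "jet (\<lambda>s. 1 + s) 1 (1 :: 'k)"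
          using jet_affine[of 1 1] by simp
        consider "k \<noteq> l" | "k = l" "k = i" | "k = l" "k = opp n i" | "k = l" "k \<noteq> i" "k \<noteq> opp n i" by blast
        then show "jet (\<lambda>s. ?M s $$ (k, l)) (1\<^sub>m ?N $$ (k, l)) (?E $$ (k, l))"
          by cases (use kl ij True inv lin in \<open>auto simp: mat_diag_def unit_mat_adj intro: jet_const\<close>)
      qed
    qed
    then show ?thesis using E by simp
  qed
qed

text \<open>
  A polynomial function that vanishes on the Borel subgroup has a differential \<open>c\<close> that vanishes on the tangent
  vectors of \<open>borel_curves_tangent\<close>.  Folding the sum of \<open>c i j * Y $$ (i, j)\<close> by \<open>sum_half\<close> expresses its value at
  \<open>Y\<close> through the values at these vectors.
\<close>

lemma lie_algebra_of_borel_superset: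
  assumes P: "hyp_frame n \<alpha> (P :: 'k mat) P'" and Y: "Y \<in> std_borel n"
  shows "P * Y * P' \<in> lie_algebra_of (2 * n) (borel_subgroup n \<alpha> P)"
proof -
  let ?N = "2 * n"
  note PD = hyp_frameD[OF P]
  have YL: "Y \<in> std_lie n" using Y by (simp add: std_borel_def)
  note YD = std_lieD[OF YL]
  have "coeff p 1 = 0"
    if f: "f \<in> poly_funs ?N" "\<And>g. g \<in> borel_subgroup n \<alpha> P \<Longrightarrow> f g = 0"
      and p: "\<And>t. f (1\<^sub>m ?N + t \<cdot>\<^sub>m (P * Y * P')) = poly p t" for f p
  proof -
    obtain c where c: "\<And>M D. (\<forall>s. M s \<in> carrier_mat ?N ?N) \<Longrightarrow>
       (\<forall>i<?N. \<forall>j<?N. jet (\<lambda>s. M s $$ (i, j)) (1\<^sub>m ?N $$ (i, j)) (D i j)) \<Longrightarrow>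
       jet (\<lambda>s. f (P * M s * P')) (f (P * 1\<^sub>m ?N * P')) (\<Sum>i<?N. \<Sum>j<?N. c i j * D i j)"
      using poly_fun_jet[OF f(1) PD(1,2)] by blast
    have vanish: "(\<Sum>i<?N. \<Sum>j<?N. c i j * D i j) = 0"
      if M: "\<forall>s. M s \<in> carrier_mat ?N ?N"
        "\<forall>s. 1 + s \<noteq> 0 \<longrightarrow> (\<exists>h'. hyp_frame n (hform n) (M s) h') \<and>
          (\<forall>j<n. \<forall>i<?N. j < i \<longrightarrow> M s $$ (i, j) = 0)"
        "\<forall>i<?N. \<forall>j<?N. jet (\<lambda>s. M s $$ (i, j)) (1\<^sub>m ?N $$ (i, j)) (D i j)" for M D
    proof (rule jet_unique[OF infinite_UNIV_alg_closed c[OF M(1,3)] jet_const[of 0]])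
      fix s :: 'k assume s: "1 + s \<noteq> 0"
      with M(2) obtain h' where h: "hyp_frame n (hform n) (M s) h'" by blast
      show "f (P * M s * P') = 0"
        using borel_subgroup_iff[OF P h] M(2) s by (intro f(2)) blast
    qed
    have "coeff p 1 = (\<Sum>i<?N. \<Sum>j<?N. c i j * Y $$ (i, j))"
    proof (rule jet_unique[OF infinite_UNIV_alg_closed jet_poly[of p] c])
      let ?M = "\<lambda>s. 1\<^sub>m ?N + s \<cdot>\<^sub>m Y"
      show "\<forall>s. ?M s \<in> carrier_mat ?N ?N" using YD by simp
      show "\<forall>i<?N. \<forall>j<?N. jet (\<lambda>s. ?M s $$ (i, j)) (1\<^sub>m ?N $$ (i, j)) (Y $$ (i, j))"
      proof (intro allI impI)
        fix k l assume kl: "k < ?N" "l < ?N"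
        then have "(\<lambda>s. ?M s $$ (k, l)) = (\<lambda>s. 1\<^sub>m ?N $$ (k, l) + s * Y $$ (k, l))"
          using YD(1) by auto
        then show "jet (\<lambda>s. ?M s $$ (k, l)) (1\<^sub>m ?N $$ (k, l)) (Y $$ (k, l))"
          by (simp only: jet_affine)
      qed
      fix s
      have "P * ?M s * P' = 1\<^sub>m ?N + s \<cdot>\<^sub>m (P * Y * P')"
        using PD YD(1) by (simp add: mult_add_distrib_mat[of _ ?N ?N _ ?N] add_mult_distrib_mat[of _ ?N ?N _ _ ?N]
            mult_smult_distrib[of _ ?N ?N _ ?N] mult_smult_assoc_mat[of _ ?N ?N _ ?N])
      then show "poly p s = f (P * ?M s * P')" using p by simp
    qed
    also have "\<dots> = (\<Sum>i<?N. \<Sum>j<?N. if i < opp n j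
        then c i j * Y $$ (i, j) + c (opp n j) (opp n i) * Y $$ (opp n j, opp n i) else 0)"
      using YD by (intro sum_half[symmetric]) auto
    also have "\<dots> = 0"
    proof (intro sum.neutral ballI)
      fix i j assume "i \<in> {..<?N}" "j \<in> {..<?N}"
      then have ij: "i < ?N" "j < ?N" by auto
      have "c i j * Y $$ (i, j) + c (opp n j) (opp n i) * Y $$ (opp n j, opp n i) = 0" if "i < opp n j"
      proof (cases "j < n \<and> j < i")
        case True
        then show ?thesis using Y YD(4)[OF ij] ij by (simp add: std_borel_def)
      next
        case False
        have "c i j * Y $$ (i, j) + c (opp n j) (opp n i) * Y $$ (opp n j, opp n i)
          = (c i j + c (opp n j) (opp n i)) * Y $$ (i, j)"
          using YD(4)[OF ij] by (simp add: distrib_right)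
        also have "c i j + c (opp n j) (opp n i) = 0"
          by (rule borel_curves_tangent[OF vanish ij that False])
        finally show ?thesis by simp
      qed
      then show "(if i < opp n j then c i j * Y $$ (i, j) + c (opp n j) (opp n i) * Y $$ (opp n j, opp n i) else 0) = 0"
        by simp
    qed
    finally show ?thesis .
  qed
  then show ?thesis
    using PD YD(1) unfolding lie_algebra_of_def by auto
qed

lemma lie_algebra_of_borel:
  assumes P: "hyp_frame n \<alpha> (P :: 'k mat) P'"
  shows "lie_algebra_of (2 * n) (borel_subgroup n \<alpha> P) = (\<lambda>Y. P * Y * P') ` std_borel n"
  using lie_algebra_of_borel_subset[OF P] lie_algebra_of_borel_superset[OF P] by blast

end

section \<open>Orbit closures containing zero\<close>

lemma poly_char_poly:
  fixes A :: "'k::field mat"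
  assumes "A \<in> carrier_mat N N"
  shows "poly (char_poly A) c = det (mat N N (\<lambda>(i, j). (if i = j then c else 0) + (-1) * A $$ (i, j)))"
  unfolding char_poly_def
  by (rule poly_det_cong[of _ N]) (use assms in \<open>auto simp: char_poly_matrix_def\<close>)

text \<open>
  By the Leibniz formula for the determinant.
\<close>

lemma char_poly_value_poly_fun:
  fixes c :: "'k::field"
  shows "\<exists>f\<in>poly_funs N. \<forall>A\<in>carrier_mat N N. f A = poly (char_poly A) c"
proof (intro bexI ballI)
  let ?f = "\<lambda>A. \<Sum>p\<in>{p. p permutes {0..<N}}. signof p *
    (\<Prod>i\<in>{0..<N}. (if i = p i then c else 0) + (-1) * A $$ (i, p i))"
  show "?f \<in> poly_funs N"
    by (intro poly_funs_sum poly_funs.mult poly_funs_prod poly_funs.add poly_funs.const poly_funs.coord)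
      (auto simp: finite_permutations permutes_in_image dest!: permutes_in_image[where x = "_ :: nat"])
  fix A :: "'k mat" assume "A \<in> carrier_mat N N"
  then show "?f A = poly (char_poly A) c"
    unfolding poly_char_poly[OF \<open>A \<in> carrier_mat N N\<close>]
    by (subst det_def'[of _ N]) (auto intro!: sum.cong prod.cong simp: permutes_in_image dest: permutes_in_image)
qed

lemma char_poly_zero: "char_poly (0\<^sub>m N N :: 'k::field mat) = monom 1 N"
proof -
  have "char_poly (0\<^sub>m N N :: 'k mat) = (\<Prod>a\<leftarrow>diag_mat (0\<^sub>m N N :: 'k mat). [:- a, 1:])"
    by (rule char_poly_upper_triangular[of _ N]) auto
  also have "diag_mat (0\<^sub>m N N :: 'k mat) = replicate N 0"
    by (auto simp: diag_mat_def map_replicate_const[symmetric] intro!: nth_equalityI)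
  also have "(\<Prod>a\<leftarrow>replicate N 0. [:- a, 1:]) = (monom 1 N :: 'k poly)"
    by (induction N) (auto simp: monom_altdef)
  finally show ?thesis .
qed

text \<open>
  The case of the Cayley--Hamilton theorem that is needed.  Comparing coefficients in
  \<open>B (t - x) = t\<^sup>N\<close>, where \<open>B\<close> is the adjugate of \<open>t - x\<close>, the coefficient matrices \<open>C k\<close> of \<open>B\<close> satisfy
  \<open>C k = C (k + 1) x\<close> for \<open>k + 1 \<noteq> N\<close>, and \<open>C (N - 1) = 1\<close> if \<open>N > 0\<close>.  So \<open>C 0\<close> is the power of \<open>x\<close> with exponent \<open>N - 1\<close>, and the
  constant coefficient gives \<open>C 0 * x = 0\<close>.
\<close>

lemma nilpotent_if_char_poly_monom:
  fixes x :: "'k::field mat"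
  assumes x: "x \<in> carrier_mat N N" and char: "char_poly x = monom 1 N"
  shows "x ^\<^sub>m N = 0\<^sub>m N N"
proof (cases "N = 0")
  case True
  then show ?thesis using x by (intro eq_matI) auto
next
  case False
  define M where "M = char_poly_matrix x"
  define B where "B = adj_mat M"
  have M: "M \<in> carrier_mat N N" using x by (simp add: M_def)
  have B: "B \<in> carrier_mat N N" "B * M = monom 1 N \<cdot>\<^sub>m 1\<^sub>m N"
    using adj_mat[OF M] char by (auto simp: B_def M_def char_poly_def)
  have M_index: "M $$ (i, j) = [:- x $$ (i, j), if i = j then 1 else 0:]" if "i < N" "j < N" for i j
    using that x by (auto simp: M_def char_poly_matrix_def)
  define C where "C k = map_mat (\<lambda>p. coeff p k) B" for k
  have C: "C k \<in> carrier_mat N N" for k using B by (simp add: C_def)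
  have entry: "(\<Sum>l<N. B $$ (i, l) * M $$ (l, j)) = (if i = j then monom 1 N else 0)"
    if "i < N" "j < N" for i j
  proof -
    have "(\<Sum>l<N. B $$ (i, l) * M $$ (l, j)) = (B * M) $$ (i, j)"
      using that B(1) M by (simp add: scalar_prod_def lessThan_atLeast0)
    then show ?thesis using that by (simp add: B(2))
  qed
  have rec: "C k = C (Suc k) * x + (if Suc k = N then 1\<^sub>m N else 0\<^sub>m N N)" for k
  proof (rule eq_matI)
    fix i j assume "i < dim_row (C (Suc k) * x + (if Suc k = N then 1\<^sub>m N else 0\<^sub>m N N))"
      "j < dim_col (C (Suc k) * x + (if Suc k = N then 1\<^sub>m N else 0\<^sub>m N N))"
    then have ij: "i < N" "j < N" by (auto split: if_splits)
    have *: "coeff (B $$ (i, l) * M $$ (l, j)) (Suc k)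
        = (if l = j then coeff (B $$ (i, l)) k else 0) - coeff (B $$ (i, l)) (Suc k) * x $$ (l, j)" if "l < N" for l
      using that ij M_index[of l j] by (simp add: mult.commute[of "B $$ (i, l)"])
    have "(if i = j \<and> Suc k = N then 1 else 0) = coeff (\<Sum>l<N. B $$ (i, l) * M $$ (l, j)) (Suc k)"
      using ij by (simp add: entry)
    also have "\<dots> = (\<Sum>l<N. (if l = j then coeff (B $$ (i, l)) k else 0)) - (\<Sum>l<N. coeff (B $$ (i, l)) (Suc k) * x $$ (l, j))"
      unfolding coeff_sum sum_subtractf[symmetric] using * by (intro sum.cong) auto
    also have "\<dots> = C k $$ (i, j) - (C (Suc k) * x) $$ (i, j)"
      using ij B(1) x C[of "Suc k"] by (simp add: scalar_prod_def lessThan_atLeast0 C_def)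
    finally show "C k $$ (i, j) = (C (Suc k) * x + (if Suc k = N then 1\<^sub>m N else 0\<^sub>m N N)) $$ (i, j)"
      using ij x C by (auto simp: algebra_simps split: if_splits)
  qed (use C x in auto)
  have base: "C 0 * x = 0\<^sub>m N N"
  proof (rule eq_matI)
    fix i j assume "i < dim_row (0\<^sub>m N N :: 'k mat)" "j < dim_col (0\<^sub>m N N :: 'k mat)"
    then have ij: "i < N" "j < N" by auto
    have *: "coeff (B $$ (i, l) * M $$ (l, j)) 0 = - (coeff (B $$ (i, l)) 0 * x $$ (l, j))" if "l < N" for l
      using that ij M_index[of l j] by (simp add: mult.commute[of "B $$ (i, l)"])
    have "0 = coeff (\<Sum>l<N. B $$ (i, l) * M $$ (l, j)) 0"
      using ij False by (simp add: entry)
    also have "\<dots> = - (\<Sum>l<N. coeff (B $$ (i, l)) 0 * x $$ (l, j))"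
      unfolding coeff_sum sum_negf[symmetric] using * by (intro sum.cong) auto
    also have "\<dots> = - ((C 0 * x) $$ (i, j))"
      using ij B(1) x by (simp add: scalar_prod_def lessThan_atLeast0 C_def)
    finally show "(C 0 * x) $$ (i, j) = 0\<^sub>m N N $$ (i, j)" using ij by simp
  qed (use C x in auto)
  have high: "C k = 0\<^sub>m N N" if "k \<ge> N" for k
  proof -
    \<comment> \<open>A bound for all degrees in \<open>B\<close>; below it, \<open>rec\<close> propagates the vanishing down to \<open>N\<close>.\<close>
    define K where "K = Suc (\<Sum>i<N. \<Sum>j<N. degree (B $$ (i, j)))"
    have zero: "C l = 0\<^sub>m N N" if "l \<ge> K" for l
    proof (rule eq_matI)
      fix i j assume "i < dim_row (0\<^sub>m N N :: 'k mat)" "j < dim_col (0\<^sub>m N N :: 'k mat)"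
      then have ij: "i < N" "j < N" by auto
      have "degree (B $$ (i, j)) \<le> (\<Sum>j<N. degree (B $$ (i, j)))"
        using ij by (intro member_le_sum) auto
      also have "\<dots> \<le> (\<Sum>i<N. \<Sum>j<N. degree (B $$ (i, j)))"
        using ij by (intro member_le_sum) auto
      finally have "degree (B $$ (i, j)) < l" using that by (simp add: K_def)
      then show "C l $$ (i, j) = 0\<^sub>m N N $$ (i, j)"
        using ij B(1) by (simp add: C_def coeff_eq_0)
    qed (use B in \<open>auto simp: C_def\<close>)
    show ?thesis
    proof (cases "k \<ge> K")
      case False
      then have "k \<le> K" by simp
      then show ?thesis using \<open>k \<ge> N\<close>
      proof (induction k rule: inc_induct)
        case (step k)
        then show ?case using rec[of k] x by simp
      qed (simp add: zero)
    qed (simp add: zero)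
  qed
  have "C (N - Suc m) = x ^\<^sub>m m" if "m < N" for m
    using that
  proof (induction m)
    case 0
    then show ?case using rec[of "N - 1"] high[of N] x by simp
  next
    case (Suc m)
    then have "Suc (N - Suc (Suc m)) = N - Suc m" "Suc (N - Suc (Suc m)) \<noteq> N" by auto
    then show ?case using rec[of "N - Suc (Suc m)"] Suc x by simp
  qed
  from this[of "N - 1"] base False show ?thesis
    by (metis Suc_diff_1 Suc_pred' diff_less diff_self_eq_0 less_numeral_extra(1) not_gr_zero pow_mat.simps(2))
qed

text \<open>
  The values of the characteristic polynomial are polynomial functions that are constant on
  similarity classes, so they take the same value at \<open>x\<close> and at 0.
\<close>

lemma nilpotent_if_zero_in_closure:
  fixes x :: "'k::alg_closed_field mat"
  assumes x: "x \<in> carrier_mat N N"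
    and cl: "0\<^sub>m N N \<in> zariski_closure N S" and sim: "\<And>y. y \<in> S \<Longrightarrow> similar_mat y x"
  shows "x ^\<^sub>m N = 0\<^sub>m N N"
proof (rule nilpotent_if_char_poly_monom[OF x])
  have "poly (char_poly x) c = poly (monom 1 N) c" for c
  proof -
    obtain f where f: "f \<in> poly_funs N" "\<And>A. A \<in> carrier_mat N N \<Longrightarrow> f A = poly (char_poly A) c"
      using char_poly_value_poly_fun[of N c] by blast
    let ?f = "\<lambda>A. f A + - poly (char_poly x) c"
    have F: "?f \<in> poly_funs N" using f by (intro poly_funs.add poly_funs.const)
    have V: "?f y = 0" if y: "y \<in> S" for y
    proof -
      obtain m B Q where "{y, x, B, Q} \<subseteq> carrier_mat m m"
        using similar_matD[OF sim[OF y]] by blast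
      then have "y \<in> carrier_mat N N" using x by auto
      then show ?thesis using f(2) char_poly_similar[OF sim[OF y]] by simp
    qed
    have closed: "g (0\<^sub>m N N) = 0" if "g \<in> poly_funs N" "\<And>y. y \<in> S \<Longrightarrow> g y = 0" for g
      using cl that by (simp add: zariski_closure_def)
    have "?f (0\<^sub>m N N) = 0" by (rule closed[of ?f, OF F V])
    then show ?thesis using f(2)[of "0\<^sub>m N N"] by (simp add: char_poly_zero)
  qed
  then show "char_poly x = monom 1 N"
    by (intro poly_eqI_infinite[OF infinite_UNIV_alg_closed, of "{}"]) auto
qed

lemma poly_fun_curve:
  fixes M :: "'k::field \<Rightarrow> 'k mat"
  assumes "f \<in> poly_funs N" "\<And>i j. i < N \<Longrightarrow> j < N \<Longrightarrow> \<exists>p. \<forall>s. M s $$ (i, j) = poly p s"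
  shows "\<exists>p. \<forall>s. f (M s) = poly p s"
  using assms(1)
proof induction
  case (const c)
  show ?case by (rule exI[of _ "[:c:]"]) simp
next
  case (coord i j)
  then show ?case by (rule assms(2))
next
  case (add f h)
  then obtain p r where "\<forall>s. f (M s) = poly p s" "\<forall>s. h (M s) = poly r s" by blast
  then show ?case by (intro exI[of _ "p + r"]) simp
next
  case (mult f h)
  then obtain p r where "\<forall>s. f (M s) = poly p s" "\<forall>s. h (M s) = poly r s" by blast
  then show ?case by (intro exI[of _ "p * r"]) simp
qed

lemma similar_Ad:
  assumes P: "hyp_frame n \<alpha> P P'" and g: "g \<in> carrier (orthogonal_group n \<alpha>)"
    and x: "x \<in> carrier_mat (2 * n) (2 * n)"
  shows "similar_mat (Ad (orthogonal_group n \<alpha>) g x) x"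
proof -
  obtain h h' where h: "hyp_frame n (hform n) h h'" and g: "g = P * h * P'"
    using g orthogonal_group_carrier_iff[OF P] by blast
  note PD = hyp_frameD[OF P] and hD = hyp_frameD[OF h]
  let ?k = "P * h' * P'" and ?N = "2 * n"
  have "g * ?k = 1\<^sub>m ?N" "?k * g = 1\<^sub>m ?N"
    using PD hD by (auto simp: g assoc_mult_mat[of _ ?N ?N _ ?N _ ?N] mult_cancel_left[of _ ?N])
  then have "similar_mat_wit (g * x * ?k) x g ?k"
    using PD hD x g by (auto simp: similar_mat_wit_def Let_def)
  then show ?thesis
    by (auto simp: Ad_def g inv_orthogonal_group[OF P h] similar_mat_def)
qed

context char_two
begin

text \<open>
  The one-parameter torus that acts on \<open>e\<^sub>1, \<dots>, e\<^sub>n\<close> with weights \<open>n, \<dots>, 1\<close> and on \<open>f\<^sub>1, \<dots>, f\<^sub>n\<close> with the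
  opposite weights.  All entries that may be nonzero on \<open>std_nilrad n\<close> have positive weight.
\<close>

lemma exists_grading_conj:
  assumes A: "(A :: 'k mat) \<in> std_nilrad n"
  shows "\<exists>d. (\<forall>i<2 * n. \<forall>j<2 * n. A $$ (i, j) \<noteq> 0 \<longrightarrow> 0 < d i j) \<and>
    (\<forall>s\<noteq>0. \<exists>h h'. hyp_frame n (hform n) h h' \<and>
      h * A * h' = mat (2 * n) (2 * n) (\<lambda>(i, j). A $$ (i, j) * s ^ d i j))"
proof -
  let ?N = "2 * n"
  have L: "A \<in> std_lie n" using A by (simp add: std_nilrad_def)
  note D = std_lieD[OF L]
  \<comment> \<open>Indices start at 0, so \<open>e\<^sub>1\<close> has index 0 and weight \<open>n\<close>.\<close>
  define w where "w i = (if i < n then int n - int i else int i - 2 * int n)" for i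
  have w: "w j < w i" if ij: "i < ?N" "j < ?N" and ne: "A $$ (i, j) \<noteq> 0" for i j
  proof -
    consider "j < n" | "n \<le> j" "i < n" | "n \<le> j" "n \<le> i" by linarith
    then show ?thesis
    proof cases
      case 1
      then have "i < j" using A ij ne by (force simp: std_nilrad_def not_less)
      then show ?thesis using 1 by (simp add: w_def)
    next
      case 2
      then show ?thesis using ij by (simp add: w_def)
    next
      case 3
      have "A $$ (j - n, i - n) \<noteq> 0" using D(4)[OF ij] ne 3 by (simp add: opp_def)
      moreover have "i - n < n" "j - n < ?N" using ij 3 by auto
      ultimately have "j - n < i - n"
        using A by (cases "i - n \<le> j - n") (simp_all add: std_nilrad_def)
      then show ?thesis using 3 by (simp add: w_def)
    qed
  qed
  have w_opp: "w (opp n i) = - w i" if "i < ?N" for i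
    using that by (auto simp: w_def opp_def)
  have "\<exists>h h'. hyp_frame n (hform n) h h' \<and>
      h * A * h' = mat ?N ?N (\<lambda>(i, j). A $$ (i, j) * s ^ nat (w i - w j))" if s: "s \<noteq> 0" for s :: 'k
  proof (intro exI conjI)
    let ?d = "\<lambda>i. s powi w i"
    show "hyp_frame n (hform n) (mat_diag ?N ?d) (mat_diag ?N (\<lambda>i. ?d (opp n i)))"
      using s by (intro mat_diag_frame) (simp add: w_opp power_int_minus)
    show "mat_diag ?N ?d * A * mat_diag ?N (\<lambda>i. ?d (opp n i)) = mat ?N ?N (\<lambda>(i, j). A $$ (i, j) * s ^ nat (w i - w j))"
    proof (rule eq_matI)
      fix i j assume "i < dim_row (mat ?N ?N (\<lambda>(i, j). A $$ (i, j) * s ^ nat (w i - w j)))"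
        "j < dim_col (mat ?N ?N (\<lambda>(i, j). A $$ (i, j) * s ^ nat (w i - w j)))"
      then have ij: "i < ?N" "j < ?N" by auto
      have "(mat_diag ?N ?d * A * mat_diag ?N (\<lambda>i. ?d (opp n i))) $$ (i, j)
          = s powi w i * A $$ (i, j) * s powi (- w j)"
        using ij D(1) by (simp add: mat_diag_mult_left[of A ?N ?N] mat_diag_mult_right[of _ ?N ?N] w_opp)
      also have "\<dots> = A $$ (i, j) * s powi (w i - w j)"
        using s by (simp add: power_int_diff power_int_minus field_simps)
      also have "\<dots> = A $$ (i, j) * s ^ nat (w i - w j)"
        using w[OF ij] by (cases "A $$ (i, j) = 0") (auto simp: power_int_def)
      finally show "(mat_diag ?N ?d * A * mat_diag ?N (\<lambda>i. ?d (opp n i))) $$ (i, j)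
          = mat ?N ?N (\<lambda>(i, j). A $$ (i, j) * s ^ nat (w i - w j)) $$ (i, j)"
        using ij by simp
    qed (auto simp: mat_diag_def)
  qed
  then show ?thesis using w by (intro exI[of _ "\<lambda>i j. nat (w i - w j)"]) auto
qed

end

context char_two_closed
begin

text \<open>
  The torus of \<open>exists_grading_conj\<close> contracts the element to 0: along it a polynomial function is a
  polynomial in \<open>s\<close>, and if it vanishes for all \<open>s \<noteq> 0\<close>, then it vanishes at \<open>s = 0\<close>.
\<close>

lemma nilpotent_if_std_nilrad:
  assumes R: "hyp_frame n \<alpha> (R :: 'k mat) R'" and A: "A \<in> std_nilrad n"
  shows "R * A * R' \<in> nilpotent_elements n \<alpha>"
proof -
  let ?N = "2 * n" and ?G = "orthogonal_group n \<alpha>" and ?x = "R * A * R'"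
  note RD = hyp_frameD[OF R]
  have L: "A \<in> std_lie n" using A by (simp add: std_nilrad_def)
  note D = std_lieD[OF L]
  obtain d where d: "\<And>i j. i < ?N \<Longrightarrow> j < ?N \<Longrightarrow> A $$ (i, j) \<noteq> 0 \<Longrightarrow> 0 < d i j"
    "\<And>s. s \<noteq> 0 \<Longrightarrow> \<exists>h h'. hyp_frame n (hform n) h h' \<and>
      h * A * h' = mat ?N ?N (\<lambda>(i, j). A $$ (i, j) * s ^ d i j)"
    using exists_grading_conj[OF A] by blast
  define M where "M s = mat ?N ?N (\<lambda>(i, j). A $$ (i, j) * s ^ d i j)" for s
  have M: "M s \<in> carrier_mat ?N ?N" for s by (simp add: M_def)
  have M0: "M 0 = 0\<^sub>m ?N ?N"
    using d(1) by (intro eq_matI) (force simp: M_def power_0_left)+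
  have "0\<^sub>m ?N ?N \<in> zariski_closure ?N (orbit ?G (Ad ?G) ?x)"
    unfolding zariski_closure_def
  proof (intro CollectI conjI ballI impI)
    fix f assume f: "f \<in> poly_funs ?N" and van: "\<forall>y\<in>orbit ?G (Ad ?G) ?x. f y = 0"
    have "\<exists>p. \<forall>s. f (R * M s * R') = poly p s"
    proof (rule poly_fun_curve[OF f])
      fix i j assume ij: "i < ?N" "j < ?N"
      have "(R * M s * R') $$ (i, j)
          = poly (\<Sum>k<?N. \<Sum>l<?N. smult (R $$ (i, k) * A $$ (k, l) * R' $$ (l, j)) (monom 1 (d k l))) s" for s
      proof -
        have "(R * M s * R') $$ (i, j) = conj_entry ?N R R' i j (M s)"
          by (rule conj_entry[symmetric]) (use RD M ij in auto)
        then show ?thesis by (simp add: conj_entry_def M_def poly_sum poly_monom mult_ac)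
      qed
      then show "\<exists>p. \<forall>s. (R * M s * R') $$ (i, j) = poly p s" by blast
    qed
    then obtain p where p: "\<And>s. f (R * M s * R') = poly p s" by blast
    have "poly p s = 0" if s: "s \<noteq> 0" for s
    proof -
      obtain h h' where h: "hyp_frame n (hform n) h h'" "h * A * h' = M s"
        using d(2)[OF s] by (auto simp: M_def)
      note hD = hyp_frameD[OF h(1)]
      have "R * h * R' \<in> carrier ?G"
        using h(1) orthogonal_group_carrier_iff[OF R] by blast
      then have "Ad ?G (R * h * R') ?x \<in> orbit ?G (Ad ?G) ?x"
        by (auto simp: orbit_def)
      moreover have "Ad ?G (R * h * R') ?x = R * M s * R'"
        unfolding Ad_def inv_orthogonal_group[OF R h(1)] h(2)[symmetric]
        using RD hD D(1) by (simp add: assoc_mult_mat[of _ ?N ?N _ ?N _ ?N] mult_cancel_left[of _ ?N])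
      ultimately show ?thesis using van p by metis
    qed
    then have "p = 0"
      by (intro poly_eqI_infinite[OF infinite_UNIV_alg_closed, of "{0}"]) auto
    then have "f (R * M 0 * R') = 0" by (simp add: p)
    then show "f (0\<^sub>m ?N ?N) = 0" using RD by (simp add: M0)
  qed simp
  moreover have "?x \<in> orthogonal_lie n \<alpha>" using L orthogonal_lie_iff[OF R] by blast
  ultimately show ?thesis by (simp add: nilpotent_elements_def)
qed

end

section \<open>Alternating matrices, reflections and singular vectors\<close>

context char_two
begin

text \<open>
  Split off a hyperbolic plane: for \<open>S a b \<noteq> 0\<close> the Schur complement \<open>T\<close> of the block with indices \<open>a\<close> and \<open>b\<close>
  is again symmetric with zero diagonal, and a kernel vector of \<open>T\<close> extends uniquely to one of \<open>S\<close>.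
\<close>

lemma alternating_odd_kernel:
  fixes S :: "nat \<Rightarrow> nat \<Rightarrow> 'k"
  assumes "finite I" "odd (card I)"
    and "\<And>i j. i \<in> I \<Longrightarrow> j \<in> I \<Longrightarrow> S i j = S j i" "\<And>i. i \<in> I \<Longrightarrow> S i i = 0"
  shows "\<exists>w. (\<exists>i\<in>I. w i \<noteq> 0) \<and> (\<forall>i\<in>I. (\<Sum>j\<in>I. S i j * w j) = 0)"
  using assms
proof (induction "card I" arbitrary: I S rule: less_induct)
  case less
  show ?case
  proof (cases "\<forall>i\<in>I. \<forall>j\<in>I. S i j = 0")
    case True
    moreover have "I \<noteq> {}" using less.prems(2) by auto
    ultimately show ?thesis by (intro exI[of _ "\<lambda>_. 1"]) auto
  next
    case False
    then obtain a b where ab: "a \<in> I" "b \<in> I" "S a b \<noteq> 0" by blast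
    have ne: "a \<noteq> b" using ab less.prems(4) by auto
    have ba: "S b a = S a b" using less.prems(3) ab by simp
    define J where "J = I - {a, b}"
    have J: "finite J" "I = insert a (insert b J)" "a \<notin> J" "b \<notin> J" "J \<subseteq> I"
      using less.prems(1) ab by (auto simp: J_def)
    have card: "card I = Suc (Suc (card J))" using J ne by simp
    define T where "T i j = S i j + (S i a * S b j + S i b * S a j) / S a b" for i j
    have "\<exists>w. (\<exists>i\<in>J. w i \<noteq> 0) \<and> (\<forall>i\<in>J. (\<Sum>j\<in>J. T i j * w j) = 0)"
    proof (rule less.hyps)
      show "card J < card I" "odd (card J)" using card less.prems(2) by auto
      have sym: "S i j = S j i" if "i \<in> I" "j \<in> I" for i j using less.prems(3) that by simp
      show "T i j = T j i" if "i \<in> J" "j \<in> J" for i j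
        unfolding T_def using that J sym[of i j] sym[of i a] sym[of b j] sym[of i b] sym[of a j]
        by (simp add: add.commute mult.commute)
      show "T i i = 0" if "i \<in> J" for i
        unfolding T_def using that J less.prems(4)[of i] sym[of i a] sym[of i b]
        by (simp add: mult.commute[of "S a i"])
    qed (use J in auto)
    then obtain w where w: "\<exists>i\<in>J. w i \<noteq> 0" "\<And>i. i \<in> J \<Longrightarrow> (\<Sum>j\<in>J. T i j * w j) = 0" by blast
    let ?A = "\<Sum>j\<in>J. S a j * w j" and ?B = "\<Sum>j\<in>J. S b j * w j"
    let ?w = "\<lambda>j. if j = a then ?B / S a b else if j = b then ?A / S a b else w j"
    have expand: "(\<Sum>j\<in>I. S i j * ?w j) = S i a * (?B / S a b) + (S i b * (?A / S a b) + (\<Sum>j\<in>J. S i j * w j))" for i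
    proof -
      have "(\<Sum>j\<in>J. S i j * ?w j) = (\<Sum>j\<in>J. S i j * w j)" using J by (intro sum.cong) auto
      then show ?thesis using J ne by simp
    qed
    have "(\<Sum>j\<in>I. S i j * ?w j) = 0" if i: "i \<in> I" for i
    proof -
      consider "i = a" | "i = b" | "i \<in> J" using i J by blast
      then show ?thesis
      proof cases
        case 1
        then show ?thesis unfolding expand using ab less.prems(4)[of a] by simp
      next
        case 2
        then show ?thesis unfolding expand using ab ba less.prems(4)[of b] by simp
      next
        case 3
        have "(\<Sum>j\<in>J. T i j * w j) = (\<Sum>j\<in>J. S i j * w j) + (S i a * (?B / S a b) + S i b * (?A / S a b))"
          by (simp add: T_def distrib_right add_divide_distrib sum.distrib sum_distrib_left sum_divide_distrib mult.assoc)
        then show ?thesis unfolding expand using w(2)[OF 3] by (simp add: ac_simps)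
      qed
    qed
    moreover from w(1) obtain i where "i \<in> J" "w i \<noteq> 0" by blast
    then have "i \<in> I" "?w i \<noteq> 0" using J by auto
    ultimately show ?thesis by (intro exI[of _ ?w] conjI ballI bexI[of _ i])
  qed
qed

text \<open>
  Deleting the index \<open>a\<close> leaves an odd number of indices and therefore a kernel vector \<open>w\<close> with \<open>w a = 0\<close>.
  It satisfies all equations except possibly the one with index \<open>a\<close>, and that one follows by
  pairing with the given kernel vector \<open>v\<close>, because \<open>v a \<noteq> 0\<close>.
\<close>

lemma alternating_second_kernel:
  fixes S :: "nat \<Rightarrow> nat \<Rightarrow> 'k"
  assumes I: "finite I" "even (card I)"
    and sym: "\<And>i j. i \<in> I \<Longrightarrow> j \<in> I \<Longrightarrow> S i j = S j i" and diag: "\<And>i. i \<in> I \<Longrightarrow> S i i = 0"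
    and v: "\<And>i. i \<in> I \<Longrightarrow> (\<Sum>j\<in>I. S i j * v j) = 0" and a: "a \<in> I" "v a \<noteq> 0"
  shows "\<exists>w. w a = 0 \<and> (\<exists>i\<in>I. w i \<noteq> 0) \<and> (\<forall>i\<in>I. (\<Sum>j\<in>I. S i j * w j) = 0)"
proof -
  define J where "J = I - {a}"
  have J: "finite J" "I = insert a J" "a \<notin> J" using I a by (auto simp: J_def)
  have "odd (card J)" using I(2) J by simp
  have "\<exists>w. (\<exists>i\<in>J. w i \<noteq> 0) \<and> (\<forall>i\<in>J. (\<Sum>j\<in>J. S i j * w j) = 0)"
  proof (rule alternating_odd_kernel[OF J(1) \<open>odd (card J)\<close>])
    show "S i j = S j i" if "i \<in> J" "j \<in> J" for i j by (rule sym) (use that J in auto)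
    show "S i i = 0" if "i \<in> J" for i by (rule diag) (use that J in auto)
  qed
  then obtain w0 where w0: "\<exists>i\<in>J. w0 i \<noteq> 0" "\<And>i. i \<in> J \<Longrightarrow> (\<Sum>j\<in>J. S i j * w0 j) = 0" by blast
  define w where "w = w0(a := 0)"
  have wJ: "(\<Sum>j\<in>I. S i j * w j) = (\<Sum>j\<in>J. S i j * w0 j)" for i
    using J by (auto simp: w_def intro!: sum.cong)
  have "0 = (\<Sum>i\<in>I. (\<Sum>j\<in>I. S i j * v j) * w i)"
    using v by simp
  also have "\<dots> = (\<Sum>i\<in>I. \<Sum>j\<in>I. S i j * v j * w i)"
    by (simp add: sum_distrib_right)
  also have "\<dots> = (\<Sum>j\<in>I. \<Sum>i\<in>I. S i j * v j * w i)"
    by (rule sum.swap)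
  also have "\<dots> = (\<Sum>j\<in>I. v j * (\<Sum>i\<in>I. S j i * w i))"
  proof (rule sum.cong[OF refl])
    fix j assume j: "j \<in> I"
    have "S i j * v j * w i = v j * (S j i * w i)" if "i \<in> I" for i
      using sym[OF j that] by (simp add: mult_ac)
    then show "(\<Sum>i\<in>I. S i j * v j * w i) = v j * (\<Sum>i\<in>I. S j i * w i)"
      unfolding sum_distrib_left by (rule sum.cong[OF refl])
  qed
  also have "\<dots> = (\<Sum>j\<in>I. if j = a then v a * (\<Sum>i\<in>I. S a i * w i) else 0)"
  proof (rule sum.cong[OF refl])
    fix j assume j: "j \<in> I"
    show "v j * (\<Sum>i\<in>I. S j i * w i) = (if j = a then v a * (\<Sum>i\<in>I. S a i * w i) else 0)"
    proof (cases "j = a")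
      case False
      with j J have "j \<in> J" by auto
      then show ?thesis using False w0(2) wJ by simp
    qed simp
  qed
  also have "\<dots> = v a * (\<Sum>i\<in>I. S a i * w i)"
    using I a by simp
  finally have "(\<Sum>i\<in>I. S a i * w i) = 0" using a by simp
  then have "(\<Sum>j\<in>I. S i j * w j) = 0" if "i \<in> I" for i
    using that J w0(2)[of i] wJ[of i] by auto
  moreover have "\<exists>i\<in>I. w i \<noteq> 0" using w0(1) J by (auto simp: w_def)
  ultimately show ?thesis by (intro exI[of _ w]) (auto simp: w_def)
qed

lemma hbil_self [simp]: "hbil n v v = (0 :: 'k)"
  by (simp add: hbil_eq mult.commute[of "v $ (n + _)"])

text \<open>
  The orthogonal reflection \<open>v \<mapsto> v + (\<beta>(v, u) / \<alpha>(u)) u\<close>.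
\<close>

definition reflection :: "nat \<Rightarrow> 'k vec \<Rightarrow> 'k mat" where
  "reflection n u = mat (2 * n) (2 * n) (\<lambda>(i, j). (if i = j then 1 else 0) + u $ i * u $ (opp n j) / hform n u)"

lemma reflection_carrier [simp]: "reflection n u \<in> carrier_mat (2 * n) (2 * n)"
  by (simp add: reflection_def)

lemma reflection_apply:
  assumes "u \<in> carrier_vec (2 * n)" "v \<in> carrier_vec (2 * n)"
  shows "reflection n u *\<^sub>v v = v + (hbil n v u / hform n u) \<cdot>\<^sub>v u"
proof (rule eq_vecI)
  fix i assume "i < dim_vec (v + (hbil n v u / hform n u) \<cdot>\<^sub>v u)"
  then have i: "i < 2 * n" using assms by simp
  have "(reflection n u *\<^sub>v v) $ i
    = (\<Sum>j<2 * n. ((if i = j then 1 else 0) + u $ i * u $ (opp n j) / hform n u) * v $ j)"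
    using i assms by (simp add: reflection_def scalar_prod_def lessThan_atLeast0)
  also have "\<dots> = (\<Sum>j<2 * n. (if i = j then v $ j else 0)) + (\<Sum>j<2 * n. v $ j * u $ (opp n j) * (u $ i / hform n u))"
    unfolding sum.distrib[symmetric] by (rule sum.cong) (auto simp: distrib_right)
  also have "\<dots> = v $ i + hbil n v u * (u $ i / hform n u)"
    using i by (simp add: hbil_def sum_distrib_right sum_divide_distrib)
  finally show "(reflection n u *\<^sub>v v) $ i = (v + (hbil n v u / hform n u) \<cdot>\<^sub>v u) $ i"
    using i assms by simp
qed (use assms in \<open>simp add: reflection_def\<close>)

lemma reflection_frame:
  assumes u: "u \<in> carrier_vec (2 * n)" "hform n u \<noteq> 0"
  shows "hyp_frame n (hform n) (reflection n u) (reflection n u)"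
proof -
  let ?r = "reflection n u" and ?N = "2 * n"
  have "?r * ?r = 1\<^sub>m ?N"
  proof (rule mat_eqI_mult_vec)
    fix v :: "'k vec" assume v: "v \<in> carrier_vec ?N"
    have "(?r * ?r) *\<^sub>v v = ?r *\<^sub>v (v + (hbil n v u / hform n u) \<cdot>\<^sub>v u)"
      using u v by (simp add: assoc_mult_mat_vec[of _ ?N ?N _ ?N] reflection_apply)
    also have "\<dots> = v + (hbil n v u / hform n u) \<cdot>\<^sub>v u + (hbil n v u / hform n u) \<cdot>\<^sub>v u"
      using u v by (subst reflection_apply) (auto simp: hbil_add_left hbil_smult_left)
    also have "\<dots> = v" using u v by (intro eq_vecI) (auto simp: add.assoc)
    finally show "(?r * ?r) *\<^sub>v v = 1\<^sub>m ?N *\<^sub>v v" using v by simp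
  qed auto
  moreover have "hform n (?r *\<^sub>v v) = hform n v" if v: "v \<in> carrier_vec ?N" for v
    using u v by (simp add: reflection_apply hform_add hform_smult hbil_smult_right power2_eq_square)
  ultimately show ?thesis by (simp add: hyp_frame_def)
qed

text \<open>
  Here \<open>\<alpha>(w + z) = \<beta>(w, z)\<close>, so the coefficient in the reflection is 1.
\<close>

lemma reflection_swap:
  assumes "w \<in> carrier_vec (2 * n)" "z \<in> carrier_vec (2 * n)"
    and "hform n w = 0" "hform n z = 0" "hbil n w z \<noteq> 0"
  shows "hform n (w + z) \<noteq> 0" "reflection n (w + z) *\<^sub>v w = z" "reflection n (w + z) *\<^sub>v z = w"
proof -
  have q: "hform n (w + z) = hbil n w z" using assms by (simp add: hform_add)
  then show "hform n (w + z) \<noteq> 0" using assms by simp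
  have "w + 1 \<cdot>\<^sub>v (w + z) = z" "z + 1 \<cdot>\<^sub>v (w + z) = w"
    using assms(1,2) by (intro eq_vecI; simp add: add.left_commute)+
  then show "reflection n (w + z) *\<^sub>v w = z" "reflection n (w + z) *\<^sub>v z = w"
    using assms by (simp_all add: reflection_apply q hbil_add_right hbil_commute[of n z w])
qed

text \<open>
  Witt's theorem for a single vector.  If \<open>w\<close> is not orthogonal to the \<open>m\<close>-th basis vector, one
  reflection exchanges the two; otherwise one goes through a singular vector \<open>z\<close> that is orthogonal to neither of them.
  Both reflections are in vectors orthogonal to the earlier basis vectors and fix these.
\<close>

lemma singular_vector_transport:
  assumes m: "m < n" and w: "(w :: 'k vec) \<in> carrier_vec (2 * n)" "hform n w = 0" "w \<noteq> 0\<^sub>v (2 * n)"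
    and supp: "\<And>i. i < m \<Longrightarrow> w $ i = 0" "\<And>i. i < m \<Longrightarrow> w $ (n + i) = 0"
  shows "\<exists>h h'. hyp_frame n (hform n) h h' \<and> h *\<^sub>v unit_vec (2 * n) m = w \<and>
    (\<forall>j<m. h *\<^sub>v unit_vec (2 * n) j = unit_vec (2 * n) j)"
proof -
  let ?N = "2 * n"
  let ?b = "\<lambda>i. unit_vec ?N i :: 'k vec"
  have fix_low: "reflection n u *\<^sub>v ?b j = ?b j"
    if "u \<in> carrier_vec ?N" "j < m" "\<And>i. i < m \<Longrightarrow> u $ (n + i) = 0" for u j
    using that m by (simp add: reflection_apply hbil_unit_left opp_def) (auto intro!: eq_vecI)
  show ?thesis
  proof (cases "w $ (n + m) = 0")
    case False
    let ?r = "reflection n (w + ?b m)"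
    have *: "hbil n w (?b m) \<noteq> 0" using False m by (simp add: hbil_unit_right opp_def)
    note sw = reflection_swap[OF w(1) _ w(2) hform_unit *]
    have "hyp_frame n (hform n) ?r ?r"
      using sw(1) m w by (intro reflection_frame) auto
    moreover have "?r *\<^sub>v ?b m = w" using sw(3) m by simp
    moreover have "?r *\<^sub>v ?b j = ?b j" if "j < m" for j
      using that m w supp(2) by (intro fix_low) (auto simp: unit_vec_index)
    ultimately show ?thesis by blast
  next
    case True
    have "\<exists>z \<in> carrier_vec ?N. hform n z = 0 \<and> hbil n w z \<noteq> 0 \<and> hbil n z (?b m) \<noteq> 0 \<and> (\<forall>i<m. z $ (n + i) = 0)"
    proof (cases "w $ m = 0")
      case False
      then show ?thesis using m
        by (intro bexI[of _ "?b (n + m)"]) (auto simp: hform_unit hbil_unit_right opp_def unit_vec_index)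
    next
      case wm: True
      from w(1,3) obtain i where i: "i < ?N" "w $ i \<noteq> 0"
        by (metis carrier_vecD eq_vecI index_zero_vec)
      have ne: "i \<noteq> m" "i \<noteq> n + m" using i True wm by auto
      have hi: "\<not> i < m" "\<not> (n \<le> i \<and> i < n + m)"
      proof -
        show "\<not> i < m" using i(2) supp(1)[of i] by auto
        show "\<not> (n \<le> i \<and> i < n + m)"
        proof
          assume "n \<le> i \<and> i < n + m"
          then have "i - n < m" "n + (i - n) = i" by auto
          then show False using i(2) supp(2)[of "i - n"] by simp
        qed
      qed
      \<comment> \<open>The first summand pairs with the \<open>m\<close>-th basis vector, the second one with \<open>w\<close>.\<close>
      let ?z = "?b (n + m) + ?b (opp n i)"
      have "hform n ?z = 0"
        using i m ne by (simp add: hform_add hform_unit hbil_unit_right unit_vec_index)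
      moreover have "hbil n w ?z = w $ i"
        using i m wm by (simp add: hbil_add_right hbil_unit_right) (simp add: opp_def)
      moreover have "hbil n ?z (?b m) = 1"
        using i m ne by (auto simp: hbil_add_left hbil_unit_right unit_vec_index opp_def)
      moreover have "?z $ (n + k) = 0" if "k < m" for k
        using that i m ne hi by (auto simp: unit_vec_index opp_def)
      ultimately show ?thesis using i(2) by (intro bexI[of _ ?z]) auto
    qed
    then obtain z where z: "z \<in> carrier_vec ?N" "hform n z = 0" "hbil n w z \<noteq> 0" "hbil n z (?b m) \<noteq> 0"
      "\<And>i. i < m \<Longrightarrow> z $ (n + i) = 0" by blast
    let ?r = "reflection n (w + z)" and ?s = "reflection n (z + ?b m)"
    note sw = reflection_swap[OF w(1) z(1) w(2) z(2,3)] reflection_swap[OF z(1) _ z(2) hform_unit z(4)]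
    have r: "hyp_frame n (hform n) ?r ?r" and s: "hyp_frame n (hform n) ?s ?s"
      using sw(1,4) m w z by (auto intro!: reflection_frame)
    have "(?r * ?s) *\<^sub>v ?b m = w"
      using sw m by (simp add: assoc_mult_mat_vec[of _ ?N ?N _ ?N])
    moreover have "(?r * ?s) *\<^sub>v ?b j = ?b j" if "j < m" for j
    proof -
      have "?s *\<^sub>v ?b j = ?b j"
        using that m z by (intro fix_low) (auto simp: unit_vec_index)
      moreover have "?r *\<^sub>v ?b j = ?b j"
        using that m z w supp(2) by (intro fix_low) auto
      ultimately show ?thesis by (simp add: assoc_mult_mat_vec[of _ ?N ?N _ ?N])
    qed
    ultimately show ?thesis using hyp_frame_trans[OF r s] by blast
  qed
qed

end

section \<open>Nilpotent elements lie in a nilradical\<close>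

lemma pow_mat_commute:
  fixes A :: "'k::semiring_1 mat"
  assumes "A \<in> carrier_mat N N"
  shows "A * A ^\<^sub>m k = A ^\<^sub>m k * A"
proof (induction k)
  case (Suc k)
  have "A * (A ^\<^sub>m k * A) = A * A ^\<^sub>m k * A"
    using assms by (intro assoc_mult_mat[symmetric, of _ N N _ N _ N]) auto
  then show ?case using Suc by simp
qed (use assms in simp)

lemma conj_pow:
  fixes A :: "'k::field mat"
  assumes "A \<in> carrier_mat N N" "R \<in> carrier_mat N N" "R' \<in> carrier_mat N N" "R * R' = 1\<^sub>m N" "R' * R = 1\<^sub>m N"
  shows "(R' * A * R) ^\<^sub>m k = R' * A ^\<^sub>m k * R"
proof (induction k)
  case (Suc k)
  have "A ^\<^sub>m k \<in> carrier_mat N N" using assms by simp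
  then show ?case using Suc assms
    by (simp add: assoc_mult_mat[of _ N N _ N _ N] mult_cancel_left[of _ N])
qed (use assms in simp)

context char_two_closed
begin

text \<open>
  The quadratic form along a line in a nonsingular direction is a nonconstant polynomial.
\<close>

lemma singular_combination:
  assumes v: "(v :: 'k vec) \<in> carrier_vec (2 * n)" and w: "w \<in> carrier_vec (2 * n)" "hform n w \<noteq> 0"
  shows "\<exists>b. hform n (v + b \<cdot>\<^sub>v w) = 0"
proof -
  let ?p = "[:hform n v, hbil n v w, hform n w:]"
  have "degree ?p > 0" using w by simp
  then obtain b where "poly ?p b = 0" using alg_closed_imp_poly_has_root by blast
  then show ?thesis using v w
    by (intro exI[of _ b]) (simp add: hform_add hform_smult hbil_smult_right power2_eq_square algebra_simps)
qed

text \<open>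
  Let \<open>V\<close> be the span of the first \<open>m\<close> basis vectors and \<open>V_perp\<close> its orthogonal space.  Both are
  stable under \<open>A\<close>, which induces a nilpotent map on \<open>V_perp / V\<close>; the indices in \<open>I\<close> form a basis of this
  quotient.  The matrix \<open>S\<close> of the induced alternating form has even size and a nonzero kernel vector, hence two independent
  ones, and over an algebraically closed field a combination of them is singular.
\<close>

lemma flag_stable_singular_kernel:
  assumes L: "(A :: 'k mat) \<in> std_lie n" and nil: "A ^\<^sub>m k = 0\<^sub>m (2 * n) (2 * n)" and m: "m < n"
    and flag: "\<And>i j. j < m \<Longrightarrow> i < 2 * n \<Longrightarrow> j \<le> i \<Longrightarrow> A $$ (i, j) = 0"
  shows "\<exists>w\<in>carrier_vec (2 * n). w \<noteq> 0\<^sub>v (2 * n) \<and> hform n w = 0 \<and>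
    (\<forall>i<m. w $ i = 0 \<and> w $ (n + i) = 0) \<and> (\<forall>i<2 * n. m \<le> i \<longrightarrow> (A *\<^sub>v w) $ i = 0)"
proof -
  let ?N = "2 * n"
  note D = std_lieD[OF L]
  define I where "I = {m..<n} \<union> {n + m..<?N}"
  have I_iff: "i \<in> I \<longleftrightarrow> i < ?N \<and> m \<le> i \<and> \<not> (n \<le> i \<and> i < n + m)" for i
    using m by (auto simp: I_def)
  have I: "finite I" "even (card I)"
  proof -
    show "finite I" by (simp add: I_def)
    have "card I = (n - m) + (?N - (n + m))" using m unfolding I_def by (subst card_Un_disjoint) auto
    also have "\<dots> = 2 * (n - m)" using m by simp
    finally show "even (card I)" by simp
  qed
  have opp_I: "opp n i \<in> I" if "i \<in> I" for i
    using that m by (auto simp: I_iff opp_def)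
  define V where "V = {v \<in> carrier_vec ?N. \<forall>i<?N. m \<le> i \<longrightarrow> v $ i = (0 :: 'k)}"
  define V_perp where "V_perp = {v \<in> carrier_vec ?N. \<forall>i<m. v $ (n + i) = (0 :: 'k)}"
  have V_perpD: "v $ j = 0" if "v \<in> V_perp" "n \<le> j" "j < n + m" for v j
  proof -
    have "j - n < m" "n + (j - n) = j" using that by auto
    then show ?thesis using that(1) unfolding V_perp_def by (metis (mono_tags, lifting) mem_Collect_eq)
  qed
  have A_index: "(A *\<^sub>v v) $ i = (\<Sum>j<?N. A $$ (i, j) * v $ j)" if "v \<in> carrier_vec ?N" "i < ?N" for v i
    using that D(1) by (simp add: scalar_prod_def lessThan_atLeast0)
  have AV: "A *\<^sub>v v \<in> V" if v: "v \<in> V" for v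
  proof -
    have "(A *\<^sub>v v) $ i = 0" if i: "i < ?N" "m \<le> i" for i
    proof -
      have "A $$ (i, j) * v $ j = 0" if "j < ?N" for j
        using v i that flag[of j i] by (cases "j < m") (auto simp: V_def)
      then have "(\<Sum>j<?N. A $$ (i, j) * v $ j) = 0" by (intro sum.neutral) auto
      then show ?thesis using v i A_index[of v i] by (simp add: V_def del: index_mult_mat_vec)
    qed
    then show ?thesis using v D(1) by (simp add: V_def)
  qed
  have AV_perp: "A *\<^sub>v v \<in> V_perp" if v: "v \<in> V_perp" for v
  proof -
    have "(A *\<^sub>v v) $ (n + i) = 0" if i: "i < m" for i
    proof -
      have "A $$ (n + i, j) * v $ j = 0" if j: "j < ?N" for j
      proof (cases "n \<le> j \<and> j < n + m")
        case True
        then show ?thesis using V_perpD[OF v] by simp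
      next
        case False
        have "A $$ (n + i, j) = A $$ (opp n j, i)"
          using D(4)[of "n + i" j] i j m by (simp add: opp_def)
        also have "\<dots> = 0"
          using i j m False by (intro flag) (auto simp: opp_def)
        finally show ?thesis by simp
      qed
      then have "(\<Sum>j<?N. A $$ (n + i, j) * v $ j) = 0" by (intro sum.neutral) auto
      then show ?thesis using v i m A_index[of v "n + i"] by (simp add: V_perp_def del: index_mult_mat_vec)
    qed
    then show ?thesis using v D(1) by (simp add: V_perp_def)
  qed
  \<comment> \<open>The last vector outside \<open>V\<close> in the sequence \<open>b\<close>, \<open>A b\<close>, \<open>A\<^sup>2 b\<close>, ... is a first kernel vector in the quotient.\<close>
  define b where "b = (unit_vec ?N m :: 'k vec)"
  have b: "b \<in> carrier_vec ?N" "b \<in> V_perp" "b \<notin> V"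
    using m by (auto simp: b_def V_def V_perp_def unit_vec_index)
  have pow: "A ^\<^sub>m l \<in> carrier_mat ?N ?N" for l using D(1) by simp
  have pow_perp: "A ^\<^sub>m l *\<^sub>v b \<in> V_perp" for l
  proof (induction l)
    case 0
    then show ?case using b D(1) by simp
  next
    case (Suc l)
    have "A * A ^\<^sub>m l = A ^\<^sub>m l * A" using pow_mat_commute D(1) by metis
    then have "A ^\<^sub>m Suc l *\<^sub>v b = A *\<^sub>v (A ^\<^sub>m l *\<^sub>v b)"
      using D(1) b pow by (simp add: assoc_mult_mat_vec[of _ ?N ?N _ ?N, symmetric])
    then show ?case using AV_perp[OF Suc] by simp
  qed
  define l where "l = (LEAST l. A ^\<^sub>m l *\<^sub>v b \<in> V)"
  have "0\<^sub>m ?N ?N *\<^sub>v b \<in> carrier_vec ?N"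
    by (rule mult_mat_vec_carrier[OF zero_carrier_mat b(1)])
  then have "A ^\<^sub>m k *\<^sub>v b \<in> V" using b(1) by (simp add: nil V_def)
  then have lV: "A ^\<^sub>m l *\<^sub>v b \<in> V" unfolding l_def by (rule LeastI)
  have "l \<noteq> 0"
  proof
    assume "l = 0"
    then show False using lV b D(1) by simp
  qed
  then obtain l' where l': "l = Suc l'" by (cases l) auto
  define u where "u = A ^\<^sub>m l' *\<^sub>v b"
  have uc: "u \<in> carrier_vec ?N" unfolding u_def by (rule mult_mat_vec_carrier[OF pow b(1)])
  have "u \<notin> V" unfolding u_def using not_less_Least[of l' "\<lambda>l. A ^\<^sub>m l *\<^sub>v b \<in> V"] l' by (simp add: l_def)
  moreover have "u \<in> V_perp" unfolding u_def by (rule pow_perp)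
  moreover have "A *\<^sub>v u \<in> V"
  proof -
    have "A * A ^\<^sub>m l' = A ^\<^sub>m l' * A" using pow_mat_commute D(1) by metis
    then have "A ^\<^sub>m l *\<^sub>v b = A *\<^sub>v u"
      using D(1) b pow by (simp add: u_def l' assoc_mult_mat_vec[of _ ?N ?N _ ?N, symmetric])
    then show ?thesis using lV by simp
  qed
  ultimately have u: "u \<notin> V" "u \<in> V_perp" "A *\<^sub>v u \<in> V" by auto
  from u(1) uc obtain a where a: "a < ?N" "m \<le> a" "u $ a \<noteq> 0" by (auto simp: V_def)
  have aI: "a \<in> I"
  proof -
    have "\<not> (n \<le> a \<and> a < n + m)" using V_perpD[OF u(2)] a(3) by blast
    then show ?thesis using a by (simp add: I_iff)
  qed
  \<comment> \<open>Matrix of the form induced by \<open>A\<close> on \<open>V_perp / V\<close>.\<close>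
  define S where "S i j = A $$ (opp n i, j)" for i j
  have sym: "S i j = S j i" if "i \<in> I" "j \<in> I" for i j
    using D(4)[of "opp n i" j] that by (simp add: S_def I_iff)
  have diag: "S i i = 0" if "i \<in> I" for i using D(3) that by (simp add: S_def I_iff)
  have u_ker: "(\<Sum>j\<in>I. S i j * u $ j) = 0" if i: "i \<in> I" for i
  proof -
    have oi: "opp n i \<in> I" by (rule opp_I[OF i])
    have "(\<Sum>j\<in>I. S i j * u $ j) = (\<Sum>j<?N. A $$ (opp n i, j) * u $ j)"
      unfolding S_def
    proof (rule sum.mono_neutral_left)
      show "\<forall>j\<in>{..<?N} - I. A $$ (opp n i, j) * u $ j = 0"
      proof
        fix j assume j: "j \<in> {..<?N} - I"
        then consider "j < m" | "n \<le> j" "j < n + m" by (auto simp: I_iff)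
        then show "A $$ (opp n i, j) * u $ j = 0"
        proof cases
          case 1
          then show ?thesis using flag[of j "opp n i"] oi by (simp add: I_iff)
        next
          case 2
          then show ?thesis using V_perpD[OF u(2)] by simp
        qed
      qed
    qed (auto simp: I_iff)
    also have "\<dots> = (A *\<^sub>v u) $ opp n i" using uc oi by (simp add: A_index I_iff del: index_mult_mat_vec)
    also have "\<dots> = 0" using u(3) oi unfolding V_def I_iff by blast
    finally show ?thesis .
  qed
  obtain z where z: "z a = 0" "\<exists>i\<in>I. z i \<noteq> 0" "\<And>i. i \<in> I \<Longrightarrow> (\<Sum>j\<in>I. S i j * z j) = 0"
    using alternating_second_kernel[OF I sym diag u_ker aI a(3)] by blast
  define ext where "ext f = vec ?N (\<lambda>i. if i \<in> I then f i else (0 :: 'k))" for f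
  have ext: "ext f \<in> carrier_vec ?N" "\<And>i. i < ?N \<Longrightarrow> ext f $ i = (if i \<in> I then f i else 0)" for f
    by (simp_all add: ext_def)
  have good: "(\<forall>i<m. ext f $ i = 0 \<and> ext f $ (n + i) = 0) \<and> (\<forall>i<?N. m \<le> i \<longrightarrow> (A *\<^sub>v ext f) $ i = 0)"
    if f: "\<And>i. i \<in> I \<Longrightarrow> (\<Sum>j\<in>I. S i j * f j) = 0" for f
  proof -
    have low: "\<forall>i<m. ext f $ i = 0 \<and> ext f $ (n + i) = 0" using m by (auto simp: ext I_iff)
    then have perp: "ext f \<in> V_perp" by (simp add: V_perp_def ext)
    have "(A *\<^sub>v ext f) $ i = 0" if i: "i < ?N" "m \<le> i" for i
    proof (cases "i \<in> I")
      case True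
      have "(A *\<^sub>v ext f) $ i = (\<Sum>j<?N. A $$ (i, j) * ext f $ j)"
        using i by (simp add: A_index ext del: index_mult_mat_vec)
      also have "\<dots> = (\<Sum>j\<in>I. A $$ (i, j) * f j)"
        by (rule sum.mono_neutral_cong_right) (auto simp: I_iff ext)
      also have "\<dots> = (\<Sum>j\<in>I. S (opp n i) j * f j)" using i by (simp add: S_def)
      also have "\<dots> = 0" by (rule f[OF opp_I[OF True]])
      finally show ?thesis .
    next
      case False
      then show ?thesis using V_perpD[OF AV_perp[OF perp]] i by (simp add: I_iff)
    qed
    with low show ?thesis by blast
  qed
  have nonzero: "ext f \<noteq> 0\<^sub>v ?N" if "i \<in> I" "f i \<noteq> 0" for f i
  proof
    assume "ext f = 0\<^sub>v ?N"
    then have "ext f $ i = 0" using that by (simp add: I_iff)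
    then show False using that ext(2)[of i f] by (simp add: I_iff)
  qed
  show ?thesis
  proof (cases "hform n (ext z) = 0")
    case True
    then show ?thesis using good[OF z(3)] nonzero z(2) ext(1) by blast
  next
    case False
    then obtain c where c: "hform n (ext (\<lambda>i. u $ i) + c \<cdot>\<^sub>v ext z) = 0"
      using singular_combination[OF ext(1) ext(1)] by blast
    let ?f = "\<lambda>i. u $ i + c * z i"
    have "ext (\<lambda>i. u $ i) + c \<cdot>\<^sub>v ext z = ext ?f"
      by (intro eq_vecI) (auto simp: ext_def)
    with c have "hform n (ext ?f) = 0" by simp
    moreover have "(\<Sum>j\<in>I. S i j * ?f j) = 0" if "i \<in> I" for i
    proof -
      have "(\<Sum>j\<in>I. S i j * ?f j) = (\<Sum>j\<in>I. S i j * u $ j) + c * (\<Sum>j\<in>I. S i j * z j)"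
        by (simp add: distrib_left sum.distrib sum_distrib_left mult_ac)
      then show ?thesis using u_ker[OF that] z(3)[OF that] by simp
    qed
    moreover have "?f a \<noteq> 0" using z(1) a(3) by simp
    ultimately show ?thesis using good[of ?f] nonzero[OF aI, of ?f] ext(1) by blast
  qed
qed

text \<open>
  Moving the next basis vector to the singular vector found in \<open>flag_stable_singular_kernel\<close> keeps the
  first \<open>m\<close> columns, because the isometry fixes the first \<open>m\<close> basis vectors.
\<close>

lemma flag_step:
  assumes L: "(A :: 'k mat) \<in> std_lie n" and nil: "A ^\<^sub>m k = 0\<^sub>m (2 * n) (2 * n)" and m: "m < n"
    and flag: "\<And>i j. j < m \<Longrightarrow> i < 2 * n \<Longrightarrow> j \<le> i \<Longrightarrow> A $$ (i, j) = 0"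
  shows "\<exists>h h'. hyp_frame n (hform n) h h' \<and>
    (\<forall>j\<le>m. \<forall>i<2 * n. j \<le> i \<longrightarrow> (h' * A * h) $$ (i, j) = 0)"
proof -
  let ?N = "2 * n"
  let ?b = "\<lambda>i. unit_vec ?N i :: 'k vec"
  note D = std_lieD[OF L]
  obtain w where w: "w \<in> carrier_vec ?N" "w \<noteq> 0\<^sub>v ?N" "hform n w = 0"
    "\<And>i. i < m \<Longrightarrow> w $ i = 0" "\<And>i. i < m \<Longrightarrow> w $ (n + i) = 0"
    "\<And>i. i < ?N \<Longrightarrow> m \<le> i \<Longrightarrow> (A *\<^sub>v w) $ i = 0"
    using flag_stable_singular_kernel[OF L nil m flag] by blast
  obtain h h' where h: "hyp_frame n (hform n) h h'" "h *\<^sub>v ?b m = w"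
    "\<And>j. j < m \<Longrightarrow> h *\<^sub>v ?b j = ?b j"
    using singular_vector_transport[OF m w(1,3,2,4,5)] by blast
  note H = hyp_frameD[OF h(1)]
  have h'_low: "h' $$ (i, j) = (if i = j then 1 else 0)" if "j < m" "i < ?N" for i j
  proof -
    have "h' *\<^sub>v (h *\<^sub>v ?b j) = ?b j" using H by (intro mult_vec_cancel_left[of _ ?N]) auto
    then have "h' *\<^sub>v ?b j = ?b j" using h(3)[OF that(1)] by simp
    then show ?thesis using mult_mat_unit_vec[OF H(2), of i j] that m by (simp add: unit_vec_index)
  qed
  have h'_fix: "h' *\<^sub>v y = y" if y: "y \<in> carrier_vec ?N" "\<And>i. i < ?N \<Longrightarrow> m \<le> i \<Longrightarrow> y $ i = 0" for y
  proof (rule eq_vecI)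
    fix i assume "i < dim_vec y"
    then have i: "i < ?N" using y by simp
    have "(h' *\<^sub>v y) $ i = (\<Sum>j<?N. h' $$ (i, j) * y $ j)"
      using i y H by (simp add: scalar_prod_def lessThan_atLeast0)
    also have "\<dots> = (\<Sum>j<?N. if i = j then y $ j else 0)"
    proof (rule sum.cong[OF refl])
      fix j assume "j \<in> {..<?N}"
      then show "h' $$ (i, j) * y $ j = (if i = j then y $ j else 0)"
        using h'_low[of j i] y(2)[of j] i by (cases "j < m") auto
    qed
    also have "\<dots> = y $ i" using i by simp
    finally show "(h' *\<^sub>v y) $ i = y $ i" .
  qed (use y H in auto)
  have col: "(h' * A * h) $$ (i, j) = (h' *\<^sub>v (A *\<^sub>v (h *\<^sub>v ?b j))) $ i" if "i < ?N" "j < ?N" for i j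
    using that H D(1) mult_mat_unit_vec[of "h' * A * h" ?N i j]
    by (simp add: assoc_mult_mat_vec[of _ ?N ?N _ ?N] del: index_mult_mat_vec)
  have "(h' * A * h) $$ (i, j) = 0" if ij: "j \<le> m" "i < ?N" "j \<le> i" for i j
  proof (cases "j = m")
    case True
    have "(h' * A * h) $$ (i, j) = (h' *\<^sub>v (A *\<^sub>v w)) $ i" using ij m True h(2) by (simp add: col)
    also have "h' *\<^sub>v (A *\<^sub>v w) = A *\<^sub>v w" using w(1,6) D(1) by (intro h'_fix) auto
    finally show ?thesis using w(6) ij True by simp
  next
    case False
    then have j: "j < m" using ij by simp
    have Aj: "(A *\<^sub>v ?b j) $ i = A $$ (i, j)" if "i < ?N" for i
      using mult_mat_unit_vec[OF D(1), of i j] that j m by simp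
    have "(h' * A * h) $$ (i, j) = (h' *\<^sub>v (A *\<^sub>v ?b j)) $ i" using ij m j h(3) by (simp add: col)
    also have "h' *\<^sub>v (A *\<^sub>v ?b j) = A *\<^sub>v ?b j"
    proof (rule h'_fix)
      show "(A *\<^sub>v ?b j) $ i = 0" if "i < ?N" "m \<le> i" for i
        unfolding Aj[OF that(1)] using flag[of j i] j that by simp
    qed (use D(1) in simp)
    finally show ?thesis unfolding Aj[OF ij(2)] using flag[of j i] j ij by simp
  qed
  then show ?thesis using h(1) by blast
qed

lemma nilpotent_conj_std_nilrad:
  assumes L: "(A :: 'k mat) \<in> std_lie n" and nil: "A ^\<^sub>m k = 0\<^sub>m (2 * n) (2 * n)"
  shows "\<exists>h h'. hyp_frame n (hform n) h h' \<and> h' * A * h \<in> std_nilrad n"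
proof -
  let ?N = "2 * n"
  note D = std_lieD[OF L]
  have lie: "h' * A * h \<in> std_lie n" if "hyp_frame n (hform n) h h'" for h h'
    using std_lie_conj[OF hyp_frame_sym[OF that] L] .
  have "\<exists>h h'. hyp_frame n (hform n) h h' \<and> (\<forall>j<m. \<forall>i<?N. j \<le> i \<longrightarrow> (h' * A * h) $$ (i, j) = 0)"
    if "m \<le> n" for m
    using that
  proof (induction m)
    case 0
    have "hyp_frame n (hform n) (1\<^sub>m ?N) (1\<^sub>m ?N)" by (simp add: hyp_frame_def)
    then show ?case by blast
  next
    case (Suc m)
    then obtain h h' where h: "hyp_frame n (hform n) h h'"
      "\<And>i j. j < m \<Longrightarrow> i < ?N \<Longrightarrow> j \<le> i \<Longrightarrow> (h' * A * h) $$ (i, j) = 0" by auto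
    note H = hyp_frameD[OF h(1)]
    have "(h' * A * h) ^\<^sub>m k = 0\<^sub>m ?N ?N"
      using conj_pow[OF D(1) H(1-4), of k] H by (simp add: nil)
    moreover have "m < n" using Suc.prems by simp
    ultimately obtain r r' where
      r: "hyp_frame n (hform n) r r'"
        "\<forall>j\<le>m. \<forall>i<?N. j \<le> i \<longrightarrow> (r' * (h' * A * h) * r) $$ (i, j) = 0"
      using flag_step[OF lie[OF h(1)] _ _ h(2)] by metis
    note RD = hyp_frameD[OF r(1)]
    have "r' * (h' * A * h) * r = (r' * h') * A * (h * r)"
      using H RD D(1) by (simp add: assoc_mult_mat[of _ ?N ?N _ ?N _ ?N])
    with r(2) hyp_frame_trans[OF h(1) r(1)] show ?case
      by (intro exI[of _ "h * r"] exI[of _ "r' * h'"]) (simp add: less_Suc_eq_le)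
  qed
  from this[of n] lie show ?thesis by (auto simp: std_nilrad_def)
qed

text \<open>
  The nilpotent elements are the conjugates of those that shift a standard flag; conjugating by the orthogonal
  group amounts to letting the hyperbolic basis vary.
\<close>

lemma nilpotent_elements_iff:
  assumes P: "hyp_frame n \<alpha> (P :: 'k mat) P'"
  shows "x \<in> nilpotent_elements n \<alpha> \<longleftrightarrow> (\<exists>R R' A. hyp_frame n \<alpha> R R' \<and> A \<in> std_nilrad n \<and> x = R * A * R')"
proof
  assume x: "x \<in> nilpotent_elements n \<alpha>"
  let ?N = "2 * n" and ?G = "orthogonal_group n \<alpha>"
  note PD = hyp_frameD[OF P]
  have xl: "x \<in> orthogonal_lie n \<alpha>" and cl: "0\<^sub>m ?N ?N \<in> zariski_closure ?N (orbit ?G (Ad ?G) x)"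
    using x by (auto simp: nilpotent_elements_def)
  have xc: "x \<in> carrier_mat ?N ?N" using xl by (simp add: orthogonal_lie_def)
  obtain A where A: "A \<in> std_lie n" "x = P * A * P'" using xl orthogonal_lie_iff[OF P] by blast
  note D = std_lieD[OF A(1)]
  have "x ^\<^sub>m ?N = 0\<^sub>m ?N ?N"
    by (rule nilpotent_if_zero_in_closure[OF xc cl]) (auto simp: orbit_def intro: similar_Ad[OF P _ xc])
  then have "P' * x ^\<^sub>m ?N * P = 0\<^sub>m ?N ?N" using PD by simp
  moreover have "P' * x * P = A"
    using PD D(1) by (simp add: A(2) assoc_mult_mat[of _ ?N ?N _ ?N _ ?N] mult_cancel_left[of _ ?N])
  ultimately have "A ^\<^sub>m ?N = 0\<^sub>m ?N ?N" using conj_pow[OF xc PD(1-4), of ?N] by simp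
  then obtain h h' where h: "hyp_frame n (hform n) h h'" "h' * A * h \<in> std_nilrad n"
    using nilpotent_conj_std_nilrad[OF A(1)] by blast
  note H = hyp_frameD[OF h(1)]
  have "x = (P * h) * (h' * A * h) * (h' * P')"
    using PD H D(1) by (simp add: A(2) assoc_mult_mat[of _ ?N ?N _ ?N _ ?N] mult_cancel_left[of _ ?N])
  then show "\<exists>R R' A. hyp_frame n \<alpha> R R' \<and> A \<in> std_nilrad n \<and> x = R * A * R'"
    using hyp_frame_trans[OF P h(1)] h(2) by blast
next
  assume "\<exists>R R' A. hyp_frame n \<alpha> R R' \<and> A \<in> std_nilrad n \<and> x = R * A * R'"
  then show "x \<in> nilpotent_elements n \<alpha>" using nilpotent_if_std_nilrad by blast
qed

end

section \<open>The Lie algebra and its dual over a ring of scalars\<close>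

text \<open>
  Subtraction is omitted because it coincides with addition in characteristic 2.
\<close>

definition closed_scalars :: "'k::field set \<Rightarrow> bool" where
  "closed_scalars K \<longleftrightarrow> 0 \<in> K \<and> 1 \<in> K \<and> (\<forall>a\<in>K. \<forall>b\<in>K. a + b \<in> K \<and> a * b \<in> K)"

definition kmat :: "'k set \<Rightarrow> nat \<Rightarrow> 'k mat set" where
  "kmat K N = {A \<in> carrier_mat N N. \<forall>i<N. \<forall>j<N. A $$ (i, j) \<in> K}"

lemma closed_scalarsD:
  assumes "closed_scalars K"
  shows "0 \<in> K" "1 \<in> K" "a \<in> K \<Longrightarrow> b \<in> K \<Longrightarrow> a + b \<in> K" "a \<in> K \<Longrightarrow> b \<in> K \<Longrightarrow> a * b \<in> K"
  using assms by (auto simp: closed_scalars_def)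

lemma closed_scalars_sum:
  assumes "closed_scalars K" "\<And>i. i \<in> I \<Longrightarrow> f i \<in> K"
  shows "sum f I \<in> K"
  using assms(2) closed_scalarsD[OF assms(1)] by (induction I rule: infinite_finite_induct) auto

lemma kmat_carrier: "A \<in> kmat K N \<Longrightarrow> A \<in> carrier_mat N N"
  by (simp add: kmat_def)

lemma kmat_mult:
  assumes K: "closed_scalars K" and A: "A \<in> kmat K N" and B: "B \<in> kmat K N"
  shows "A * B \<in> kmat K N"
proof -
  have "(A * B) $$ (i, j) \<in> K" if "i < N" "j < N" for i j
  proof -
    have "(A * B) $$ (i, j) = (\<Sum>k<N. A $$ (i, k) * B $$ (k, j))"
      using that kmat_carrier[OF A] kmat_carrier[OF B] by (simp add: scalar_prod_def lessThan_atLeast0)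
    also have "\<dots> \<in> K"
      using that A B by (intro closed_scalars_sum[OF K] closed_scalarsD(4)[OF K]) (auto simp: kmat_def)
    finally show ?thesis .
  qed
  then show ?thesis using A B by (simp add: kmat_def)
qed

lemma kmat_add:
  assumes "closed_scalars K" "A \<in> kmat K N" "B \<in> kmat K N"
  shows "A + B \<in> kmat K N"
  using assms closed_scalarsD[OF assms(1)] by (auto simp: kmat_def)

lemma kmat_smult:
  assumes "closed_scalars K" "c \<in> K" "A \<in> kmat K N"
  shows "c \<cdot>\<^sub>m A \<in> kmat K N"
  using assms closed_scalarsD[OF assms(1)] by (auto simp: kmat_def)

lemma kmat_std_adj: "A \<in> kmat K (2 * n) \<Longrightarrow> std_adj n A \<in> kmat K (2 * n)"
  by (simp add: kmat_def)

lemma kmat_std_half: "closed_scalars K \<Longrightarrow> A \<in> kmat K (2 * n) \<Longrightarrow> std_half n A \<in> kmat K (2 * n)"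
  by (simp add: kmat_def closed_scalarsD)

lemma kmat_unit_mat: "closed_scalars K \<Longrightarrow> unit_mat N i j \<in> kmat K N"
  by (simp add: kmat_def closed_scalarsD)

lemma tpair_closed_scalars:
  assumes "closed_scalars K" "A \<in> kmat K N" "B \<in> kmat K N"
  shows "tpair N A B \<in> K"
  unfolding tpair_def using assms
  by (intro closed_scalars_sum[OF assms(1)] closed_scalarsD(4)[OF assms(1)]) (auto simp: kmat_def)

text \<open>
  The functional \<open>y \<mapsto> tr (x W)\<close> for \<open>y = W + W\<^sup>*\<close>, with \<open>W\<close> chosen by \<open>std_half\<close>.
\<close>

definition trace_functional :: "nat \<Rightarrow> 'k::field mat \<Rightarrow> 'k mat \<Rightarrow> 'k mat set \<Rightarrow> 'k mat \<Rightarrow> 'k mat \<Rightarrow> 'k" where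
  "trace_functional n P P' L x = (\<lambda>y\<in>L. tpair (2 * n) (P' * x * P) (std_half n (P' * y * P)))"

context char_two
begin

lemma std_lie_coords:
  assumes "hyp_frame n \<alpha> (P :: 'k mat) P'" "x \<in> orthogonal_lie n \<alpha>"
  shows "P' * x * P \<in> std_lie n"
  using assms orthogonal_lie_iff[OF assms(1)] frame_conj_cancel[OF assms(1)] std_lieD(1) by metis

end

text \<open>
  Both \<open>K = \<FF>\<^sub>q\<close> and \<open>K = UNIV\<close> are of interest: the first for rational functionals and the second for
  deciding which of them are nilpotent.
\<close>

locale rational_frame = char_two type_of_scalars
  for type_of_scalars :: "'k::field itself" +
  fixes K :: "'k set" and n :: nat and \<alpha> :: "'k vec \<Rightarrow> 'k" and P P' :: "'k mat"
  assumes K: "closed_scalars K"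
    and frame: "hyp_frame n \<alpha> P P'"
    and P_rational: "P \<in> kmat K (2 * n)" "P' \<in> kmat K (2 * n)"
begin

abbreviation "L \<equiv> orthogonal_lie n \<alpha> \<inter> kmat K (2 * n)"

abbreviation "\<Phi> \<equiv> trace_functional n P P' L"

lemma coords:
  assumes "x \<in> L"
  shows "P' * x * P \<in> std_lie n" "P' * x * P \<in> kmat K (2 * n)" "x \<in> carrier_mat (2 * n) (2 * n)"
    "P * (P' * x * P) * P' = x"
proof -
  show x: "x \<in> carrier_mat (2 * n) (2 * n)" using assms kmat_carrier by blast
  show "P' * x * P \<in> std_lie n" using std_lie_coords[OF frame] assms by blast
  show "P' * x * P \<in> kmat K (2 * n)" using assms P_rational by (auto intro: kmat_mult[OF K])
  show "P * (P' * x * P) * P' = x" by (rule frame_conj_cancel(2)[OF frame x])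
qed

lemma from_coords:
  assumes "Y \<in> std_lie n" "Y \<in> kmat K (2 * n)"
  shows "P * Y * P' \<in> L"
  using assms P_rational orthogonal_lie_iff[OF frame] by (auto intro: kmat_mult[OF K])

lemma L_add: "x \<in> L \<Longrightarrow> y \<in> L \<Longrightarrow> x + y \<in> L"
  using from_coords[of "P' * (x + y) * P"] coords[of x] coords[of y]
    frame_conj_add(2)[OF frame, of x y] frame_conj_cancel(2)[OF frame, of "x + y"]
  by (simp add: std_lie_add kmat_add[OF K])

lemma L_smult: "c \<in> K \<Longrightarrow> x \<in> L \<Longrightarrow> c \<cdot>\<^sub>m x \<in> L"
  using from_coords[of "P' * (c \<cdot>\<^sub>m x) * P"] coords[of x]
    frame_conj_smult(2)[OF frame, of x c] frame_conj_cancel(2)[OF frame, of "c \<cdot>\<^sub>m x"]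
  by (simp add: std_lie_smult kmat_smult[OF K])

lemma sym_in_L:
  assumes "W \<in> kmat K (2 * n)"
  shows "P * (W + std_adj n W) * P' \<in> L"
  using assms by (intro from_coords std_lie_add_adj kmat_add[OF K] kmat_std_adj) (auto simp: kmat_def)

lemma trace_functional_sym:
  assumes "x \<in> orthogonal_lie n \<alpha>" "W \<in> carrier_mat (2 * n) (2 * n)" "P * (W + std_adj n W) * P' \<in> M"
  shows "trace_functional n P P' M x (P * (W + std_adj n W) * P') = tpair (2 * n) (P' * x * P) W"
  using assms frame_conj_cancel(1)[OF frame, of "W + std_adj n W"] std_lie_coords[OF frame assms(1)]
  by (simp add: trace_functional_def tpair_half_add_adj)

lemma trace_functional_dual:
  assumes "x \<in> L"
  shows "\<Phi> x \<in> dual_space K L"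
proof -
  note X = coords[OF assms]
  have "\<Phi> x (y + z) = \<Phi> x y + \<Phi> x z" if "y \<in> L" "z \<in> L" for y z
    using that coords[OF that(1)] coords[OF that(2)] L_add[OF that] hyp_frameD[OF frame]
    by (simp add: trace_functional_def frame_conj_add(2)[OF frame] std_half_add tpair_add_right[of _ "2 * n"])
  moreover have "\<Phi> x (c \<cdot>\<^sub>m y) = c * \<Phi> x y" if "c \<in> K" "y \<in> L" for c y
    using that coords[OF that(2)] L_smult[OF that] hyp_frameD[OF frame]
    by (simp add: trace_functional_def frame_conj_smult(2)[OF frame] std_half_smult tpair_smult_right[of _ "2 * n"])
  moreover have "\<Phi> x y \<in> K" if "y \<in> L" for y
    using that X coords[OF that] by (simp add: trace_functional_def tpair_closed_scalars[OF K] kmat_std_half[OF K])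
  ultimately show ?thesis
    by (auto simp: dual_space_def trace_functional_def)
qed

text \<open>
  The trace form on all matrices is nondegenerate, and its values on unit matrices are the entries.
\<close>

lemma eq_if_agree_on_sym:
  assumes "x \<in> orthogonal_lie n \<alpha>" "y \<in> orthogonal_lie n \<alpha>"
    and "\<And>i j. i < 2 * n \<Longrightarrow> j < 2 * n \<Longrightarrow>
      tpair (2 * n) (P' * x * P) (unit_mat (2 * n) j i) = tpair (2 * n) (P' * y * P) (unit_mat (2 * n) j i)"
  shows "x = y"
proof -
  have c: "x \<in> carrier_mat (2 * n) (2 * n)" "y \<in> carrier_mat (2 * n) (2 * n)"
    using assms(1,2) by (auto simp: orthogonal_lie_def)
  have "P' * x * P = P' * y * P"
    using assms(3) c hyp_frameD[OF frame]
    by (intro eq_matI) (auto simp: tpair_unit_mat simp del: index_mult_mat(1))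
  then show ?thesis
    using frame_conj_cancel(2)[OF frame c(1)] frame_conj_cancel(2)[OF frame c(2)] by metis
qed

text \<open>
  Evaluating \<open>\<xi>\<close> on \<open>E + E\<^sup>*\<close> for all unit matrices \<open>E\<close> gives the entries of a matrix \<open>A\<close> with
  \<open>tr (A W) = \<xi> (W + W\<^sup>*)\<close>.  It lies in \<open>std_lie n\<close>: exchanging \<open>E\<close> and \<open>E\<^sup>*\<close> shows that it is self-adjoint, and
  \<open>E + E\<^sup>* = 0\<close> for self-adjoint \<open>E\<close> gives the diagonal condition.
\<close>

lemma trace_functional_surj:
  assumes \<xi>: "\<xi> \<in> dual_space K L"
  shows "\<exists>x\<in>L. \<Phi> x = \<xi>"
proof -
  let ?N = "2 * n"
  have add: "\<xi> (y + z) = \<xi> y + \<xi> z" if "y \<in> L" "z \<in> L" for y z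
    using \<xi> that unfolding dual_space_def by blast
  have smult: "\<xi> (c \<cdot>\<^sub>m y) = c * \<xi> y" if "c \<in> K" "y \<in> L" for c y
    using \<xi> that unfolding dual_space_def by blast
  have vals: "\<xi> y \<in> K" if "y \<in> L" for y using \<xi> that unfolding dual_space_def by blast
  let ?s = "\<lambda>W. P * (W + std_adj n W) * P'"
  define A where "A = mat ?N ?N (\<lambda>(i, j). \<xi> (?s (unit_mat ?N j i)))"
  have unit_adj: "unit_mat ?N a b + std_adj n (unit_mat ?N a b) =
      unit_mat ?N (opp n b) (opp n a) + std_adj n (unit_mat ?N (opp n b) (opp n a) :: 'k mat)"
    if "a < ?N" "b < ?N" for a b
    using that by (simp add: unit_mat_adj comm_add_mat[of _ ?N ?N])
  have zero: "\<xi> (0\<^sub>m ?N ?N) = 0"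
  proof -
    have "0\<^sub>m ?N ?N \<in> L"
    proof -
      define y where "y = P * (unit_mat ?N 0 0 + std_adj n (unit_mat ?N 0 0)) * P'"
      have y: "y \<in> L" unfolding y_def by (rule sym_in_L[OF kmat_unit_mat[OF K]])
      have "0 \<cdot>\<^sub>m y = 0\<^sub>m ?N ?N" using coords(3)[OF y] by (intro eq_matI) auto
      then show ?thesis using L_smult[OF closed_scalarsD(1)[OF K] y] by simp
    qed
    from smult[OF closed_scalarsD(1)[OF K] this] show ?thesis by simp
  qed
  have A_lie: "A \<in> std_lie n"
  proof -
    have "A $$ (opp n j, opp n i) = A $$ (i, j)" if "i < ?N" "j < ?N" for i j
      using unit_adj[of j i] that by (simp add: A_def)
    moreover have "A $$ (opp n i, i) = 0" if "i < ?N" for i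
    proof -
      have "unit_mat ?N i (opp n i) + std_adj n (unit_mat ?N i (opp n i)) = (0\<^sub>m ?N ?N :: 'k mat)"
        using that by (intro eq_matI) (auto simp: unit_mat_adj)
      then show ?thesis using that zero hyp_frameD[OF frame] by (simp add: A_def)
    qed
    ultimately show ?thesis by (auto simp: std_lie_def A_def intro!: eq_matI)
  qed
  have A_K: "A \<in> kmat K ?N"
    using vals sym_in_L kmat_unit_mat[OF K] by (auto simp: kmat_def A_def)
  define x where "x = P * A * P'"
  have x: "x \<in> L" unfolding x_def by (rule from_coords[OF A_lie A_K])
  have xA: "P' * x * P = A" using frame_conj_cancel(1)[OF frame] std_lieD(1)[OF A_lie] by (simp add: x_def)
  have key: "\<xi> (?s W) = tpair ?N A W" if W: "W \<in> kmat K ?N" for W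
  proof -
    \<comment> \<open>Build up \<open>W\<close> one entry at a time to use the additivity of \<open>\<xi>\<close>.\<close>
    define cut where "cut S = mat ?N ?N (\<lambda>ij. if ij \<in> S then W $$ ij else 0)" for S
    have cut_K: "cut S \<in> kmat K ?N" for S
      using W closed_scalarsD(1)[OF K] by (auto simp: kmat_def cut_def)
    have "\<xi> (?s (cut S)) = tpair ?N A (cut S)" if "finite S" "S \<subseteq> {..<?N} \<times> {..<?N}" for S
      using that
    proof (induction S)
      case empty
      have "cut {} = 0\<^sub>m ?N ?N" by (auto simp: cut_def)
      moreover have "0\<^sub>m ?N ?N + std_adj n (0\<^sub>m ?N ?N) = (0\<^sub>m ?N ?N :: 'k mat)" by (intro eq_matI) auto
      ultimately show ?case using zero hyp_frameD[OF frame] by (simp add: tpair_def)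
    next
      case (insert p S)
      obtain a b where p: "p = (a, b)" "a < ?N" "b < ?N" using insert.prems by auto
      let ?c = "W $$ (a, b)"
      have c: "?c \<in> K" using W p by (simp add: kmat_def)
      have split: "cut (insert p S) = cut S + ?c \<cdot>\<^sub>m unit_mat ?N a b"
        using insert.hyps p by (intro eq_matI) (auto simp: cut_def)
      have carr: "cut S \<in> carrier_mat ?N ?N" by (simp add: cut_def)
      let ?E = "unit_mat ?N a b + std_adj n (unit_mat ?N a b) :: 'k mat"
      have "cut (insert p S) + std_adj n (cut (insert p S))
          = (cut S + std_adj n (cut S)) + ?c \<cdot>\<^sub>m ?E"
      proof (rule eq_matI)
        fix i j assume "i < dim_row ((cut S + std_adj n (cut S)) + ?c \<cdot>\<^sub>m ?E)"
          "j < dim_col ((cut S + std_adj n (cut S)) + ?c \<cdot>\<^sub>m ?E)"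
        then have ij: "i < ?N" "j < ?N" by auto
        have entry: "cut (insert p S) $$ (k, l) = cut S $$ (k, l) + ?c * unit_mat ?N a b $$ (k, l)"
          if "k < ?N" "l < ?N" for k l
          using that carr by (simp add: split)
        show "(cut (insert p S) + std_adj n (cut (insert p S))) $$ (i, j)
            = ((cut S + std_adj n (cut S)) + ?c \<cdot>\<^sub>m ?E) $$ (i, j)"
          using ij carr entry[of i j] entry[of "opp n j" "opp n i"]
          by (simp add: distrib_left add.assoc add.left_commute)
      qed auto
      then have "?s (cut (insert p S)) = ?s (cut S) + ?c \<cdot>\<^sub>m (P * ?E * P')"
        using carr frame_conj_add(1)[OF frame, of "cut S + std_adj n (cut S)" "?c \<cdot>\<^sub>m ?E"]
          frame_conj_smult(1)[OF frame, of ?E ?c] by simp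
      then have "\<xi> (?s (cut (insert p S))) = \<xi> (?s (cut S)) + ?c * \<xi> (P * ?E * P')"
        using add[OF sym_in_L[OF cut_K] L_smult[OF c sym_in_L[OF kmat_unit_mat[OF K]]]]
          smult[OF c sym_in_L[OF kmat_unit_mat[OF K]]] by simp
      also have "\<xi> (?s (cut S)) = tpair ?N A (cut S)" using insert by simp
      also have "\<xi> (P * ?E * P') = tpair ?N A (unit_mat ?N a b)"
        using p by (simp add: tpair_unit_mat) (simp add: A_def)
      finally show ?case
        unfolding split using carr by (simp add: tpair_add_right[of _ ?N] tpair_smult_right[of _ ?N])
    qed
    from this[of "{..<?N} \<times> {..<?N}"] have "\<xi> (?s (cut ({..<?N} \<times> {..<?N}))) = tpair ?N A (cut ({..<?N} \<times> {..<?N}))"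
      by simp
    moreover have "cut ({..<?N} \<times> {..<?N}) = W" using W by (intro eq_matI) (auto simp: cut_def kmat_def)
    ultimately show ?thesis by simp
  qed
  have "\<Phi> x y = \<xi> y" for y
  proof (cases "y \<in> L")
    case True
    note Y = coords[OF True]
    let ?W = "std_half n (P' * y * P)"
    have "?s ?W = y" using std_lie_eq_half[OF Y(1)] Y(4) by simp
    moreover have "\<xi> (?s ?W) = tpair ?N A ?W" by (intro key kmat_std_half[OF K] Y)
    moreover have "\<Phi> x y = tpair ?N A ?W" using True by (simp add: trace_functional_def xA)
    ultimately show ?thesis by simp
  next
    case False
    then show ?thesis using \<xi> by (auto simp: trace_functional_def dual_space_def PiE_def extensional_def)
  qed
  then show ?thesis using x by blast
qed

lemma bij_trace_functional: "bij_betw \<Phi> L (dual_space K L)"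
proof (rule bij_betw_imageI)
  show "inj_on \<Phi> L"
  proof (rule inj_onI)
    fix x y assume xy: "x \<in> L" "y \<in> L" and eq: "\<Phi> x = \<Phi> y"
    show "x = y"
    proof (rule eq_if_agree_on_sym)
      fix i j assume "i < 2 * n" "j < 2 * n"
      let ?E = "unit_mat (2 * n) j i :: 'k mat"
      have "P * (?E + std_adj n ?E) * P' \<in> L" by (rule sym_in_L[OF kmat_unit_mat[OF K]])
      then show "tpair (2 * n) (P' * x * P) ?E = tpair (2 * n) (P' * y * P) ?E"
        using trace_functional_sym[of x ?E L] trace_functional_sym[of y ?E L] xy eq by simp
    qed (use xy in auto)
  qed
  show "\<Phi> ` L = dual_space K L"
    using trace_functional_dual trace_functional_surj by blast
qed

end

section \<open>Nilpotent functionals\<close>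

context char_two_closed
begin

text \<open>
  Translating a functional by the group is the same as replacing the hyperbolic basis, so the
  choice of the fixed Borel subgroup is immaterial.
\<close>

lemma nilpotent_functional_iff_kills_borel:
  assumes P: "hyp_frame n \<alpha> (P :: 'k mat) P'" and \<xi>: "\<xi> \<in> dual_space UNIV (orthogonal_lie n \<alpha>)"
  shows "\<xi> \<in> nilpotent_functionals n \<alpha> P \<longleftrightarrow>
    (\<exists>R R'. hyp_frame n \<alpha> R R' \<and> (\<forall>Y\<in>std_borel n. \<xi> (R * Y * R') = 0))"
proof -
  let ?N = "2 * n" and ?G = "orthogonal_group n \<alpha>"
  note PD = hyp_frameD[OF P]
  have act: "coAd ?G (orthogonal_lie n \<alpha>) (P * h * P') \<xi> (P * Y * P') = \<xi> ((P * h') * Y * (h * P'))"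
    if h: "hyp_frame n (hform n) h h'" and Y: "Y \<in> std_borel n" for h h' Y
  proof -
    note H = hyp_frameD[OF h]
    have YL: "Y \<in> std_lie n" using Y by (simp add: std_borel_def)
    note D = std_lieD[OF YL]
    have "P * Y * P' \<in> orthogonal_lie n \<alpha>" using YL orthogonal_lie_iff[OF P] by blast
    moreover have "Ad ?G (inv\<^bsub>?G\<^esub> (P * h * P')) (P * Y * P') = (P * h') * Y * (h * P')"
      unfolding Ad_def inv_orthogonal_group[OF P h] inv_orthogonal_group[OF P hyp_frame_sym[OF h]]
      using PD H D(1) by (simp add: assoc_mult_mat[of _ ?N ?N _ ?N _ ?N] mult_cancel_left[of _ ?N])
    ultimately show ?thesis by (simp add: coAd_def)
  qed
  show ?thesis
  proof
    assume "\<xi> \<in> nilpotent_functionals n \<alpha> P"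
    then obtain g where g: "g \<in> carrier ?G"
      "\<And>Y. Y \<in> std_borel n \<Longrightarrow> coAd ?G (orthogonal_lie n \<alpha>) g \<xi> (P * Y * P') = 0"
      by (auto simp: nilpotent_functionals_def lie_algebra_of_borel[OF P])
    obtain h h' where h: "hyp_frame n (hform n) h h'" "g = P * h * P'"
      using g(1) orthogonal_group_carrier_iff[OF P] by blast
    show "\<exists>R R'. hyp_frame n \<alpha> R R' \<and> (\<forall>Y\<in>std_borel n. \<xi> (R * Y * R') = 0)"
      using hyp_frame_trans[OF P hyp_frame_sym[OF h(1)]] g(2) act[OF h(1)] h(2) by metis
  next
    assume "\<exists>R R'. hyp_frame n \<alpha> R R' \<and> (\<forall>Y\<in>std_borel n. \<xi> (R * Y * R') = 0)"
    then obtain R R' where R: "hyp_frame n \<alpha> R R'" "\<And>Y. Y \<in> std_borel n \<Longrightarrow> \<xi> (R * Y * R') = 0" by blast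
    note RD = hyp_frameD[OF R(1)]
    have h: "hyp_frame n (hform n) (R' * P) (P' * R)" by (rule hyp_frame_rel[OF R(1) P])
    have e: "P * (P' * R) = R" "(R' * P) * P' = R'"
      using PD RD by (auto simp: assoc_mult_mat[of _ ?N ?N _ ?N _ ?N] mult_cancel_left[of _ ?N])
    have "coAd ?G (orthogonal_lie n \<alpha>) (P * (R' * P) * P') \<xi> (P * Y * P') = 0" if "Y \<in> std_borel n" for Y
      using act[OF h that] R(2)[OF that] e by simp
    moreover have "P * (R' * P) * P' \<in> carrier ?G" using h orthogonal_group_carrier_iff[OF P] by blast
    ultimately show "\<xi> \<in> nilpotent_functionals n \<alpha> P"
      using \<xi> unfolding nilpotent_functionals_def lie_algebra_of_borel[OF P] by blast
  qed
qed

text \<open>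
  The functional can be computed in any hyperbolic basis, not only in the one that defines it.
\<close>

lemma trace_functional_change_frame:
  assumes P: "hyp_frame n \<alpha> (P :: 'k mat) P'" and R: "hyp_frame n \<alpha> R R'"
    and x: "x \<in> orthogonal_lie n \<alpha>" and Y: "Y \<in> std_lie n"
  shows "trace_functional n P P' (orthogonal_lie n \<alpha>) x (R * Y * R')
    = tpair (2 * n) (R' * x * R) (std_half n Y)"
proof -
  let ?N = "2 * n"
  note PD = hyp_frameD[OF P] and RD = hyp_frameD[OF R] and D = std_lieD[OF Y]
  have xc: "x \<in> carrier_mat ?N ?N" using x by (simp add: orthogonal_lie_def)
  have "P' * (R * Y * R') * P = (P' * R) * Y * (R' * P)"
    using PD RD D(1) by (simp add: assoc_mult_mat[of _ ?N ?N _ ?N _ ?N])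
  moreover have "(R' * P) * (P' * x * P) * (P' * R) = R' * x * R"
    using PD RD xc by (simp add: assoc_mult_mat[of _ ?N ?N _ ?N _ ?N] mult_cancel_left[of _ ?N])
  moreover have "R * Y * R' \<in> orthogonal_lie n \<alpha>" using Y orthogonal_lie_iff[OF R] by blast
  ultimately show ?thesis
    using tpair_half_conj[OF hyp_frame_rel[OF P R] std_lie_coords[OF P x] Y]
    by (simp add: trace_functional_def)
qed

text \<open>
  A functional kills the Borel subalgebra of a hyperbolic basis exactly if the corresponding element
  shifts its flag; the two characterisations of nilpotency then agree.
\<close>

lemma nilpotent_trace_functional_iff:
  assumes P: "hyp_frame n \<alpha> (P :: 'k mat) P'" and Q: "hyp_frame n \<alpha> Q Q'"
    and x: "x \<in> orthogonal_lie n \<alpha>"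
    and dual: "trace_functional n P P' (orthogonal_lie n \<alpha>) x \<in> dual_space UNIV (orthogonal_lie n \<alpha>)"
  shows "trace_functional n P P' (orthogonal_lie n \<alpha>) x \<in> nilpotent_functionals n \<alpha> Q
    \<longleftrightarrow> x \<in> nilpotent_elements n \<alpha>"
proof -
  let ?\<xi> = "trace_functional n P P' (orthogonal_lie n \<alpha>) x"
  have xc: "x \<in> carrier_mat (2 * n) (2 * n)" using x by (simp add: orthogonal_lie_def)
  have *: "(\<forall>Y\<in>std_borel n. ?\<xi> (R * Y * R') = 0) \<longleftrightarrow> (\<exists>A\<in>std_nilrad n. x = R * A * R')"
    if R: "hyp_frame n \<alpha> R R'" for R R'
  proof -
    have "(\<forall>Y\<in>std_borel n. ?\<xi> (R * Y * R') = 0)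
        \<longleftrightarrow> (\<forall>Y\<in>std_borel n. tpair (2 * n) (R' * x * R) (std_half n Y) = 0)"
      by (rule ball_cong[OF refl]) (simp add: trace_functional_change_frame[OF P R x] std_borel_def)
    also have "\<dots> \<longleftrightarrow> R' * x * R \<in> std_nilrad n"
      by (rule std_nilrad_eq_perp[OF std_lie_coords[OF R x], symmetric])
    also have "\<dots> \<longleftrightarrow> (\<exists>A\<in>std_nilrad n. x = R * A * R')"
    proof
      assume "R' * x * R \<in> std_nilrad n"
      then show "\<exists>A\<in>std_nilrad n. x = R * A * R'" using frame_conj_cancel(2)[OF R xc] by metis
    next
      assume "\<exists>A\<in>std_nilrad n. x = R * A * R'"
      then obtain A where A: "A \<in> std_nilrad n" "x = R * A * R'" by blast
      then have "A \<in> carrier_mat (2 * n) (2 * n)" using std_lieD(1) by (auto simp: std_nilrad_def)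
      then show "R' * x * R \<in> std_nilrad n" using A frame_conj_cancel(1)[OF R] by simp
    qed
    finally show ?thesis .
  qed
  show ?thesis
    unfolding nilpotent_functional_iff_kills_borel[OF Q dual] nilpotent_elements_iff[OF P]
    using * by blast
qed

lemma nilpotent_elements_Ad:
  assumes P: "hyp_frame n \<alpha> (P :: 'k mat) P'" and h: "hyp_frame n (hform n) h h'"
    and x: "x \<in> nilpotent_elements n \<alpha>"
  shows "(P * h * P') * x * (P * h' * P') \<in> nilpotent_elements n \<alpha>"
proof -
  let ?N = "2 * n"
  obtain R R' A where R: "hyp_frame n \<alpha> R R'" "A \<in> std_nilrad n" "x = R * A * R'"
    using x nilpotent_elements_iff[OF P] by blast
  have A: "A \<in> carrier_mat ?N ?N" using R(2) std_lieD(1) by (auto simp: std_nilrad_def)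
  have F: "hyp_frame n \<alpha> (P * h * (P' * R)) ((R' * P) * (h' * P'))"
    by (rule hyp_frame_trans[OF hyp_frame_trans[OF P h] hyp_frame_rel[OF P R(1)]])
  have "(P * h * P') * x * (P * h' * P') = (P * h * (P' * R)) * A * ((R' * P) * (h' * P'))"
    using hyp_frameD[OF P] hyp_frameD[OF R(1)] hyp_frameD[OF h] A
    by (simp add: R(3) assoc_mult_mat[of _ ?N ?N _ ?N _ ?N])
  then show ?thesis using nilpotent_if_std_nilrad[OF F R(2)] by simp
qed

end

section \<open>Rational points and orbits\<close>

lemma card_orbits_bij:
  assumes bij: "bij_betw f E F"
    and inv: "\<And>g x. g \<in> carrier G \<Longrightarrow> x \<in> E \<Longrightarrow> \<phi> g x \<in> E"
    and eqv: "\<And>g x. g \<in> carrier G \<Longrightarrow> x \<in> E \<Longrightarrow> f (\<phi> g x) = \<psi> g (f x)"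
  shows "card (orbits G E \<phi>) = card (orbits G F \<psi>)"
proof -
  have orb: "f ` orbit G \<phi> x = orbit G \<psi> (f x)" if "x \<in> E" for x
    unfolding orbit_def using eqv that by force
  have sub: "orbit G \<phi> x \<subseteq> E" if "x \<in> E" for x
    unfolding orbit_def using inv that by auto
  have F: "F = f ` E" using bij by (simp add: bij_betw_def)
  have "orbits G F \<psi> = (\<lambda>x. orbit G \<psi> (f x)) ` E"
    unfolding orbits_def F by auto
  also have "\<dots> = (\<lambda>x. f ` orbit G \<phi> x) ` E"
    using orb by (intro image_cong) auto
  also have "\<dots> = (`) f ` orbits G E \<phi>"
    unfolding orbits_def by auto
  finally have "orbits G F \<psi> = (`) f ` orbits G E \<phi>" .
  moreover have "inj_on ((`) f) (orbits G E \<phi>)"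
  proof (rule inj_on_subset[OF inj_on_image_Pow])
    show "inj_on f E" using bij by (simp add: bij_betw_def)
    show "orbits G E \<phi> \<subseteq> Pow E" using sub by (auto simp: orbits_def)
  qed
  ultimately show ?thesis by (simp add: card_image)
qed

lemma frobenius_mult:
  fixes A B :: "'k::field mat"
  assumes "CHAR('k) = 2" "A \<in> carrier_mat N N" "B \<in> carrier_mat N N"
  shows "frobenius (2 ^ e) (A * B) = frobenius (2 ^ e) A * frobenius (2 ^ e) B"
proof (rule eq_matI)
  fix i j assume "i < dim_row (frobenius (2 ^ e) A * frobenius (2 ^ e) B)"
    "j < dim_col (frobenius (2 ^ e) A * frobenius (2 ^ e) B)"
  then have ij: "i < N" "j < N" using assms by (auto simp: frobenius_def)
  have "frobenius (2 ^ e) (A * B) $$ (i, j) = (\<Sum>k<N. A $$ (i, k) * B $$ (k, j)) ^ 2 ^ e"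
    using ij assms by (simp add: frobenius_def scalar_prod_def lessThan_atLeast0)
  also have "\<dots> = (\<Sum>k<N. (A $$ (i, k) * B $$ (k, j)) ^ 2 ^ e)"
    by (rule freshmans_dream_sum') (use assms(1) in auto)
  also have "\<dots> = (frobenius (2 ^ e) A * frobenius (2 ^ e) B) $$ (i, j)"
    using ij assms by (simp add: frobenius_def scalar_prod_def lessThan_atLeast0 power_mult_distrib)
  finally show "frobenius (2 ^ e) (A * B) $$ (i, j) = (frobenius (2 ^ e) A * frobenius (2 ^ e) B) $$ (i, j)" .
qed (use assms in \<open>auto simp: frobenius_def\<close>)

lemma frobenius_fixed_iff:
  "A \<in> carrier_mat N N \<Longrightarrow> frobenius q A = A \<longleftrightarrow> A \<in> kmat {a. a ^ q = a} N"
  by (auto simp: frobenius_def kmat_def mat_eq_iff)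

text \<open>
  The Frobenius image of the inverse is an inverse of the same matrix.
\<close>

lemma frobenius_fixed_inverse:
  fixes P P' :: "'k::field mat"
  assumes "CHAR('k) = 2" and P: "P \<in> carrier_mat N N" "P' \<in> carrier_mat N N"
    and inv: "P * P' = 1\<^sub>m N" "P' * P = 1\<^sub>m N" and "frobenius (2 ^ e) P = P"
  shows "frobenius (2 ^ e) P' = P'"
proof -
  let ?F = "frobenius (2 ^ e) :: 'k mat \<Rightarrow> 'k mat"
  have F: "?F P' \<in> carrier_mat N N" using P by (simp add: frobenius_def)
  have one: "?F (1\<^sub>m N) = 1\<^sub>m N" by (intro eq_matI) (auto simp: frobenius_def)
  have "P * ?F P' = 1\<^sub>m N" using frobenius_mult[OF assms(1) P, of e] assms(6) inv one by simp
  then have "P' * (P * ?F P') = P'" using P by simp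
  then show ?thesis using mult_cancel_left[OF P(2,1) inv(2) F] by simp
qed

lemma closed_scalars_frobenius:
  assumes "CHAR('k::field) = 2"
  shows "closed_scalars {a :: 'k. a ^ 2 ^ e = a}"
proof -
  have "(a + b) ^ 2 ^ e = a ^ 2 ^ e + b ^ 2 ^ e" for a b :: 'k
    by (rule freshmans_dream') (use assms in auto)
  then show ?thesis by (auto simp: closed_scalars_def power_mult_distrib)
qed

text \<open>
  Translation by 1 permutes a finite field, so summing all elements shows that its cardinality vanishes
  in it.
\<close>

lemma CHAR_eq_2_if_card_power:
  assumes "CARD('f::{field,finite}) = 2 ^ e"
  shows "CHAR('f) = 2"
proof -
  have "(\<Sum>x\<in>(UNIV :: 'f set). x) = (\<Sum>x\<in>(UNIV :: 'f set). x + 1)"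
    by (rule sum.reindex_bij_witness[of _ "\<lambda>x. x + 1" "\<lambda>x. x - 1"]) auto
  then have "of_nat (CARD('f)) = (0 :: 'f)" by (simp add: sum.distrib)
  then have "(2 :: 'f) ^ e = 0" using assms by simp
  then have "(of_nat 2 :: 'f) = 0" by simp
  then have "CHAR('f) dvd 2" by (simp only: of_nat_eq_0_iff_char_dvd)
  moreover have "CHAR('f) \<noteq> 1" using CHAR_not_1 by auto
  ultimately show ?thesis using prime_nat_iff two_is_prime_nat by blast
qed

theorem proposition4p1:
  fixes \<alpha> :: "'f :: {field, finite} alg_closure vec \<Rightarrow> 'f alg_closure"
    and P :: "'f alg_closure mat"
    and n q e :: nat
  assumes "q = CARD('f)" and "q = 2 ^ e"
    and "quadratic_form (2 * n) \<alpha>"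
    and "nondefective (2 * n) \<alpha>"
    and "split_frobenius q n \<alpha>"
    and "hyperbolic_basis n \<alpha> P"
  shows "card (orbits (rational_group q n \<alpha>) (rational_nilpotents q n \<alpha>)
             (Ad (rational_group q n \<alpha>)))
       = card (orbits (rational_group q n \<alpha>) (rational_nilpotent_functionals q n \<alpha> P)
             (coAd (rational_group q n \<alpha>) (rational_lie q n \<alpha>)))"
proof -
  let ?N = "2 * n" and ?G = "rational_group q n \<alpha>"
  let ?K = "{a :: 'f alg_closure. a ^ q = a}"
  have char: "CHAR('f alg_closure) = 2"
    using CHAR_eq_2_if_card_power[where ?'f = 'f, of e] assms(1,2) by simp
  interpret char_two_closed "TYPE('f alg_closure)" by unfold_locales (rule char)
  have K: "closed_scalars ?K" using closed_scalars_frobenius[OF char, of e] assms(2) by simp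
  obtain Q Q' where Q: "hyp_frame n \<alpha> Q Q'" "frobenius q Q = Q"
    using assms(5) unfolding split_frobenius_def hyperbolic_basis_iff by blast
  note QD = hyp_frameD[OF Q(1)]
  have "frobenius q Q' = Q'"
    using frobenius_fixed_inverse[OF char QD(1-4), of e] Q(2) assms(2) by simp
  with Q(2) have QK: "Q \<in> kmat ?K ?N" "Q' \<in> kmat ?K ?N"
    using frobenius_fixed_iff QD(1,2) by blast+
  obtain P' where P: "hyp_frame n \<alpha> P P'" using assms(6) hyperbolic_basis_iff by blast
  interpret rat: rational_frame "TYPE('f alg_closure)" ?K n \<alpha> Q Q'
    by unfold_locales (fact K Q(1) QK)+
  interpret geom: rational_frame "TYPE('f alg_closure)" UNIV n \<alpha> Q Q'
    by unfold_locales (use Q(1) QD in \<open>auto simp: closed_scalars_def kmat_def\<close>)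
  let ?L = "orthogonal_lie n \<alpha>"
  have L_UNIV: "?L \<inter> kmat UNIV ?N = ?L" by (auto simp: kmat_def orthogonal_lie_def)
  have L_rat: "rational_lie q n \<alpha> = ?L \<inter> kmat ?K ?N"
    using frobenius_fixed_iff by (auto simp: rational_lie_def orthogonal_lie_def)
  let ?\<Phi> = "trace_functional n Q Q' (rational_lie q n \<alpha>)"
  let ?\<Xi> = "trace_functional n Q Q' ?L"
  have dual: "?\<Xi> x \<in> dual_space UNIV ?L" if "x \<in> ?L" for x
    using geom.trace_functional_dual[of x] that unfolding L_UNIV by simp
  have nil_iff: "?\<Phi> x \<in> rational_nilpotent_functionals q n \<alpha> P \<longleftrightarrow> x \<in> nilpotent_elements n \<alpha>"
    if x: "x \<in> rational_lie q n \<alpha>" for x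
  proof
    have xL: "x \<in> ?L" using x by (simp add: L_rat)
    assume "?\<Phi> x \<in> rational_nilpotent_functionals q n \<alpha> P"
    then obtain \<xi> where \<xi>: "\<xi> \<in> nilpotent_functionals n \<alpha> P" "\<And>y. y \<in> rational_lie q n \<alpha> \<Longrightarrow> \<xi> y = ?\<Phi> x y"
      by (auto simp: rational_nilpotent_functionals_def)
    \<comment> \<open>The given extension of \<open>?\<Phi> x\<close> comes from some \<open>z\<close>.  The elements \<open>E + E\<^sup>*\<close> are
      rational, so \<open>z\<close> and \<open>x\<close> have the same entries.\<close>
    then obtain z where z: "z \<in> ?L" "?\<Xi> z = \<xi>"
      using geom.trace_functional_surj[of \<xi>] unfolding L_UNIV nilpotent_functionals_def by blast
    have "z = x"
    proof (rule rat.eq_if_agree_on_sym[OF z(1) xL])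
      fix i j
      let ?E = "unit_mat ?N j i :: 'f alg_closure mat"
      let ?y = "Q * (?E + std_adj n ?E) * Q'"
      have y: "?y \<in> rational_lie q n \<alpha>" unfolding L_rat by (rule rat.sym_in_L[OF kmat_unit_mat[OF K]])
      then have "?y \<in> ?L" by (simp add: L_rat)
      then show "tpair ?N (Q' * z * Q) ?E = tpair ?N (Q' * x * Q) ?E"
        using rat.trace_functional_sym[OF z(1), of ?E ?L] rat.trace_functional_sym[OF xL, of ?E "rational_lie q n \<alpha>"]
          \<xi>(2)[OF y] y z(2) by simp
    qed
    then show "x \<in> nilpotent_elements n \<alpha>"
      using nilpotent_trace_functional_iff[OF Q(1) P xL dual[OF xL]] \<xi>(1) z(2) by simp
  next
    have xL: "x \<in> ?L" using x by (simp add: L_rat)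
    assume nil: "x \<in> nilpotent_elements n \<alpha>"
    have "?\<Xi> x \<in> nilpotent_functionals n \<alpha> P"
      using nilpotent_trace_functional_iff[OF Q(1) P xL dual[OF xL]] nil by simp
    moreover have "?\<Xi> x y = ?\<Phi> x y" if "y \<in> rational_lie q n \<alpha>" for y
      using that by (simp add: trace_functional_def L_rat)
    moreover have "?\<Phi> x \<in> rational_dual q n \<alpha>"
      using rat.trace_functional_dual[of x] x unfolding rational_dual_def L_rat by simp
    ultimately show "?\<Phi> x \<in> rational_nilpotent_functionals q n \<alpha> P"
      by (auto simp: rational_nilpotent_functionals_def)
  qed
  have bij: "bij_betw ?\<Phi> (rational_nilpotents q n \<alpha>) (rational_nilpotent_functionals q n \<alpha> P)"
  proof (rule bij_betw_subset[of ?\<Phi> "rational_lie q n \<alpha>" "rational_dual q n \<alpha>"])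
    show all: "bij_betw ?\<Phi> (rational_lie q n \<alpha>) (rational_dual q n \<alpha>)"
      unfolding rational_dual_def L_rat by (rule rat.bij_trace_functional)
    have "\<psi> \<in> ?\<Phi> ` rational_nilpotents q n \<alpha>" if \<psi>: "\<psi> \<in> rational_nilpotent_functionals q n \<alpha> P" for \<psi>
    proof -
      have "\<psi> \<in> rational_dual q n \<alpha>" using \<psi> by (simp add: rational_nilpotent_functionals_def)
      then obtain x where "x \<in> rational_lie q n \<alpha>" "\<psi> = ?\<Phi> x"
        using all unfolding bij_betw_def by blast
      then show ?thesis using nil_iff \<psi> by (auto simp: rational_nilpotents_def)
    qed
    then show "?\<Phi> ` rational_nilpotents q n \<alpha> = rational_nilpotent_functionals q n \<alpha> P"
      using nil_iff by (auto simp: rational_nilpotents_def)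
  qed (auto simp: rational_nilpotents_def)
  have group: "\<exists>h h'. hyp_frame n (hform n) h h' \<and> g = Q * h * Q' \<and> inv\<^bsub>?G\<^esub> g = Q * h' * Q'
      \<and> g \<in> kmat ?K ?N \<and> Q * h' * Q' \<in> kmat ?K ?N" if g: "g \<in> carrier ?G" for g
  proof -
    have "g \<in> carrier (orthogonal_group n \<alpha>)" and fixed: "frobenius q g = g"
      using g by (auto simp: rational_group_def)
    then obtain h h' where h: "hyp_frame n (hform n) h h'" "g = Q * h * Q'"
      using orthogonal_group_carrier_iff[OF Q(1)] by blast
    note H = hyp_frameD[OF h(1)]
    have c: "g \<in> carrier_mat ?N ?N" "Q * h' * Q' \<in> carrier_mat ?N ?N" using h(2) QD H by auto
    have gK: "g \<in> kmat ?K ?N" using fixed frobenius_fixed_iff[OF c(1)] by blast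
    have "h = Q' * g * Q" using frame_conj_cancel(1)[OF Q(1) H(1)] h(2) by simp
    then have "h \<in> kmat ?K ?N" using kmat_mult[OF K] QK gK by blast
    then have "h' \<in> kmat ?K ?N" using hyp_frame_inverse_eq[OF h(1)] kmat_std_adj by blast
    then have kK: "Q * h' * Q' \<in> kmat ?K ?N" using kmat_mult[OF K] QK by blast
    then have "frobenius q (Q * h' * Q') = Q * h' * Q'" using frobenius_fixed_iff[OF c(2)] by blast
    from inv_rational_group[OF Q(1) h(1) this] show ?thesis using h gK kK by blast
  qed
  have Ad_lie: "(Q * h * Q') * x * (Q * h' * Q') \<in> rational_lie q n \<alpha>"
    if h: "hyp_frame n (hform n) h h'" and hK: "Q * h * Q' \<in> kmat ?K ?N" "Q * h' * Q' \<in> kmat ?K ?N"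
      and x: "x \<in> rational_lie q n \<alpha>" for h h' x
  proof -
    note H = hyp_frameD[OF h]
    have xL: "x \<in> ?L" and xK: "x \<in> kmat ?K ?N" using x by (auto simp: L_rat)
    have "(Q * h * Q') * x * (Q * h' * Q') = Q * (h * (Q' * x * Q) * h') * Q'"
      using QD H kmat_carrier[OF xK] by (simp add: assoc_mult_mat[of _ ?N ?N _ ?N _ ?N])
    moreover have "h * (Q' * x * Q) * h' \<in> std_lie n"
      by (rule std_lie_conj[OF h std_lie_coords[OF Q(1) xL]])
    ultimately have "(Q * h * Q') * x * (Q * h' * Q') \<in> ?L"
      using orthogonal_lie_iff[OF Q(1)] by blast
    then show ?thesis unfolding L_rat using kmat_mult[OF K] hK xK by blast
  qed
  show ?thesis
  proof (rule card_orbits_bij[OF bij])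
    fix g x assume g: "g \<in> carrier ?G" and x: "x \<in> rational_nilpotents q n \<alpha>"
    obtain h h' where h: "hyp_frame n (hform n) h h'" "g = Q * h * Q'" "inv\<^bsub>?G\<^esub> g = Q * h' * Q'"
      "g \<in> kmat ?K ?N" "Q * h' * Q' \<in> kmat ?K ?N" using group[OF g] by blast
    have Ad_g: "Ad ?G g x = (Q * h * Q') * x * (Q * h' * Q')"
      unfolding Ad_def h(3) using h(2) by simp
    have xr: "x \<in> rational_lie q n \<alpha>" and xn: "x \<in> nilpotent_elements n \<alpha>"
      using x by (auto simp: rational_nilpotents_def)
    have in_lie: "Ad ?G g x \<in> rational_lie q n \<alpha>"
      unfolding Ad_g using Ad_lie[OF h(1) _ h(5) xr] h(2,4) by simp
    moreover have "Ad ?G g x \<in> nilpotent_elements n \<alpha>"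
      unfolding Ad_g by (rule nilpotent_elements_Ad[OF Q(1) h(1) xn])
    ultimately show "Ad ?G g x \<in> rational_nilpotents q n \<alpha>"
      by (simp add: rational_nilpotents_def)
    have gi: "Q * h' * Q' \<in> carrier ?G"
    proof -
      have "Q * h' * Q' \<in> carrier_mat ?N ?N" using h(5) kmat_carrier by blast
      then have "frobenius q (Q * h' * Q') = Q * h' * Q'" using frobenius_fixed_iff h(5) by blast
      moreover have "Q * h' * Q' \<in> carrier (orthogonal_group n \<alpha>)"
        using hyp_frame_sym[OF h(1)] orthogonal_group_carrier_iff[OF Q(1)] by blast
      ultimately show ?thesis by (simp add: rational_group_def)
    qed
    have inv_inv: "inv\<^bsub>?G\<^esub> (Q * h' * Q') = Q * h * Q'"
    proof (rule inv_rational_group[OF Q(1) hyp_frame_sym[OF h(1)]])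
      show "frobenius q (Q * h * Q') = Q * h * Q'" using g h(2) by (simp add: rational_group_def)
    qed
    show "?\<Phi> (Ad ?G g x) = coAd ?G (rational_lie q n \<alpha>) g (?\<Phi> x)"
    proof
      fix y
      show "?\<Phi> (Ad ?G g x) y = coAd ?G (rational_lie q n \<alpha>) g (?\<Phi> x) y"
      proof (cases "y \<in> rational_lie q n \<alpha>")
        case True
        note H = hyp_frameD[OF h(1)]
        have c: "x \<in> carrier_mat ?N ?N" "y \<in> carrier_mat ?N ?N" "x \<in> ?L" "y \<in> ?L"
          using xr True by (auto simp: L_rat kmat_def)
        let ?y = "(Q * h' * Q') * y * (Q * h * Q')"
        have y': "?y \<in> rational_lie q n \<alpha>"
          using Ad_lie[OF hyp_frame_sym[OF h(1)] h(5) _ True] h(2,4) by simp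
        have "coAd ?G (rational_lie q n \<alpha>) g (?\<Phi> x) y = ?\<Phi> x ?y"
          using True unfolding coAd_def Ad_def h(3) inv_inv by simp
        also have "\<dots> = tpair ?N (Q' * x * Q) (std_half n (Q' * ?y * Q))"
          using y' by (simp add: trace_functional_def)
        also have "Q' * ?y * Q = h' * (Q' * y * Q) * h"
          using QD H c by (simp add: assoc_mult_mat[of _ ?N ?N _ ?N _ ?N] mult_cancel_left[of _ ?N])
        also have "tpair ?N (Q' * x * Q) (std_half n (h' * (Q' * y * Q) * h))
            = tpair ?N (h * (Q' * x * Q) * h') (std_half n (Q' * y * Q))"
          by (rule tpair_half_conj[OF hyp_frame_sym[OF h(1)]]) (use std_lie_coords[OF Q(1)] c in auto)
        also have "h * (Q' * x * Q) * h' = Q' * Ad ?G g x * Q"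
          unfolding Ad_g
          using QD H c by (simp add: assoc_mult_mat[of _ ?N ?N _ ?N _ ?N] mult_cancel_left[of _ ?N])
        also have "tpair ?N (Q' * Ad ?G g x * Q) (std_half n (Q' * y * Q)) = ?\<Phi> (Ad ?G g x) y"
          using True by (simp add: trace_functional_def)
        finally show ?thesis by (rule sym)
      qed (simp add: trace_functional_def coAd_def)
    qed
  qed
qed

end
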